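(* Let $n\ge 3$ and let $\mathcal{M}\subset\mathbb{R}^n$ be an embedded minimal tube with axis $Ox_n$. Let $t\in t(\mathcal{M})$ be a regular value of the coordinate function $x_n|_{\mathcal{M}}$ and let $\Sigma\subset\Sigma_t$ be a simple cycle with flow vector $J(\Sigma)$. Let $\gamma:\mathcal{M}\to S^{n-1}$ be the Gauss map. Then the spherical diameter of $\gamma(\Sigma)$ satisfies $$d(\gamma(\Sigma))\ \ge\ 2\alpha(\Sigma),$$ where $\alpha(\Sigma)$ is the angle between $J(\Sigma)$ and $e_n$.
   Context: Let $M$ be an orientable Riemannian manifold of dimension $n-1$ ($n\ge3$) and $x:M\to\mathbb{R}^n$ an embedding (the metric of $M$ being the induced one) whose image is the surface $\mathcal{M}$; $M$ is identified with $\mathcal{M}=x(M)$. Let $e_1,\dots,e_n$ be the standard orthonormal basis and $\Pi_t=\{x\in\mathbb{R}^n: x_n=t\}$. Tube: $\mathcal{M}$ is a tube with axis $Ox_n$ and projection interval $t(\mathcal{M})$ (an open interval of $\mathbb{R}$) if (1) for all $t\in t(\mathcal{M})$ the cross-section $\Sigma_t=\mathcal{M}\cap\Pi_t$ is a nonempty compact set lying in the interior of $\mathcal{M}$ (i.e. $x^{-1}(\Sigma_t)$ is a compact subset of $M$); and (2) for all $t_1,t_2\in t(\mathcal{M})$ any portion of $\mathcal{M}$ situated between $\Pi_{t_1}$ and $\Pi_{t_2}$ is compact. The tube is minimal if it has zero mean curvature. Cycles and flow vector: for a regular value $t$ of $x_n|_{\mathcal{M}}$, $\Sigma_t$ is a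 finite union of compact connected $(n-2)$-dimensional submanifolds of $\mathcal{M}$ (its components). Let $\nu$ be the unit normal to $\Sigma_t$, tangent to $\mathcal{M}$, exterior to $\mathcal{M}\cap\{x_n<t\}$ (so $\langle\nu,e_n\rangle>0$ on $\Sigma_t$). A cycle is a union $\Sigma$ of components of $\Sigma_t$ with the induced orientation. Its flow vector $J(\Sigma)\in\mathbb{R}^n$ is defined by $\langle e,J(\Sigma)\rangle=\int_\Sigma\langle e,\nu\rangle$ for all $e\in\mathbb{R}^n$ (integration with respect to $(n-2)$-dimensional volume); one has $\langle J(\Sigma),e_n\rangle>0$, so $J(\Sigma)\neq0$. A cycle $\Sigma\subset\Sigma_t$ is simple if it is connected and is the boundary of an open subset of the hyperplane $\Pi_t$. Gauss map: $\gamma(m)\in S^{n-1}$ is the unit normal to $\mathcal{M}$ at $m$ (a continuous choice given by the orientation), $S^{n-1}$ being the unit sphere of $\mathbb{R}^n$. For $E\subset S^{n-1}$, $d(E)$ is the spherical diameter of $E$, i.e. the supremum of the angles between pairs of points of $E$. *)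

theory Defs
  imports "HOL-Analysis.Analysis"
begin

text \<open>
  Throughout, \<open>\<real>\<^sup>n\<close> is the Euclidean space \<^typ>\<open>'a \<times> real\<close> with \<open>n = DIM('a) + 1\<close>: the last
  coordinate \<open>x\<^sub>n\<close> is \<^const>\<open>snd\<close>, \<open>e\<^sub>n\<close> is \<open>(0, 1)\<close>, and \<^typ>\<open>'a\<close> itself plays the role of
  \<open>\<real>\<^bsup>n-1\<^esup>\<close>.
\<close>

section \<open>Hausdorff measure\<close>

text \<open>
  The \<open>k\<close>-dimensional volume on a \<open>k\<close>-dimensional submanifold is the restriction of the
  Hausdorff measure, normalised so that it agrees with Lebesgue measure on \<open>k\<close>-planes.
  Boundedness of the covering sets is needed because \<^const>\<open>diameter\<close> is meaningless
  for unbounded sets; the case distinction only matters for \<open>k = 0\<close>.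
\<close>

definition hausdorff_gauge :: "nat \<Rightarrow> 'a::metric_space set \<Rightarrow> ennreal" where
  "hausdorff_gauge k C =
     (if C = {} then 0 else ennreal (unit_ball_vol (real k) * (diameter C / 2) ^ k))"

definition hausdorff_pre :: "nat \<Rightarrow> real \<Rightarrow> 'a::metric_space set \<Rightarrow> ennreal" where
  "hausdorff_pre k \<delta> A =
     (INF C\<in>{C :: nat \<Rightarrow> 'a set. A \<subseteq> (\<Union>i. C i) \<and> (\<forall>i. bounded (C i) \<and> diameter (C i) \<le> \<delta>)}.
        \<Sum>i. hausdorff_gauge k (C i))"

definition hausdorff_outer :: "nat \<Rightarrow> 'a::metric_space set \<Rightarrow> ennreal" where
  "hausdorff_outer k A = (SUP \<delta>\<in>{0<..}. hausdorff_pre k \<delta> A)"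

definition hausdorff_measure :: "nat \<Rightarrow> 'a::metric_space measure" where
  "hausdorff_measure k = measure_of UNIV (sets borel) (hausdorff_outer k)"

text \<open>
  \<^const>\<open>measure_of\<close> yields the zero measure unless it is given a countably additive set
  function.  We check Caratheodory's criterion, so that \<open>hausdorff_measure k\<close> really takes the
  values \<open>hausdorff_outer k\<close> on Borel sets.
\<close>

lemma hausdorff_pre_le:
  assumes "A \<subseteq> (\<Union>i. C i)" "\<And>i. bounded (C i)" "\<And>i. diameter (C i) \<le> \<delta>"
  shows "hausdorff_pre k \<delta> A \<le> (\<Sum>i. hausdorff_gauge k (C i))"
  unfolding hausdorff_pre_def using assms by (intro INF_lower) auto

lemma hausdorff_pre_mono: "A \<subseteq> B \<Longrightarrow> hausdorff_pre k \<delta> A \<le> hausdorff_pre k \<delta> B"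
  unfolding hausdorff_pre_def by (rule INF_superset_mono) auto

lemma hausdorff_pre_antimono: "\<delta> \<le> \<epsilon> \<Longrightarrow> hausdorff_pre k \<epsilon> A \<le> hausdorff_pre k \<delta> A"
  unfolding hausdorff_pre_def by (rule INF_superset_mono) (auto intro: order_trans)

lemma hausdorff_pre_le_outer: "0 < \<delta> \<Longrightarrow> hausdorff_pre k \<delta> A \<le> hausdorff_outer k A"
  unfolding hausdorff_outer_def by (rule SUP_upper) auto

lemma hausdorff_outer_mono: "A \<subseteq> B \<Longrightarrow> hausdorff_outer k A \<le> hausdorff_outer k B"
  unfolding hausdorff_outer_def by (rule SUP_mono) (auto intro: hausdorff_pre_mono)

lemma hausdorff_outer_empty: "hausdorff_outer k {} = 0"
proof -
  have "hausdorff_pre k \<delta> {} \<le> 0" if "0 < \<delta>" for \<delta> :: real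
    using hausdorff_pre_le[of "{}" "\<lambda>_. {}" \<delta> k] that by (simp add: hausdorff_gauge_def)
  then show ?thesis
    unfolding hausdorff_outer_def bot_ennreal[symmetric] SUP_bot_conv by (auto simp: bot_unique)
qed

lemma hausdorff_pre_countably_subadditive:
  "hausdorff_pre k \<delta> (\<Union>i. A i) \<le> (\<Sum>n. hausdorff_pre k \<delta> (A n))"
proof (rule ennreal_le_epsilon)
  fix e :: real
  assume e: "0 < e" and fin: "(\<Sum>n. hausdorff_pre k \<delta> (A n)) < top"
  have lt: "hausdorff_pre k \<delta> (A n) < hausdorff_pre k \<delta> (A n) + e * (1/2)^Suc n" for n
    using e fin by (auto simp add: less_top dest!: ennreal_suminf_lessD)
  have "\<exists>C. A n \<subseteq> (\<Union>i. C i) \<and> (\<forall>i. bounded (C i) \<and> diameter (C i) \<le> \<delta>) \<and>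
      (\<Sum>i. hausdorff_gauge k (C i)) \<le> hausdorff_pre k \<delta> (A n) + e * (1/2)^Suc n" for n
    using lt[of n] unfolding hausdorff_pre_def[of k \<delta> "A n"] INF_less_iff
    by (auto intro: less_imp_le)
  then obtain B where B: "\<And>n. A n \<subseteq> (\<Union>i. B n i)"
      "\<And>n i. bounded (B n i)" "\<And>n i. diameter (B n i) \<le> \<delta>"
      "\<And>n. (\<Sum>i. hausdorff_gauge k (B n i)) \<le> hausdorff_pre k \<delta> (A n) + e * (1/2)^Suc n"
    by metis
  define C where "C = case_prod B o prod_decode"
  have "(\<Union>i. A i) \<subseteq> (\<Union>i. C i)"
    using B(1) by (auto simp add: C_def subset_eq) (metis prod.case prod_encode_inverse)
  then have "hausdorff_pre k \<delta> (\<Union>i. A i) \<le> (\<Sum>i. hausdorff_gauge k (C i))"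
    using B by (intro hausdorff_pre_le) (auto simp: C_def split: prod.split)
  also have "\<dots> = (\<Sum>n. \<Sum>i. hausdorff_gauge k (B n i))"
    using suminf_ennreal_2dimen[of "\<lambda>n. \<Sum>i. hausdorff_gauge k (B n i)"
        "\<lambda>(n, i). hausdorff_gauge k (B n i)"]
    by (simp add: C_def comp_def split_def)
  also have "\<dots> \<le> (\<Sum>n. hausdorff_pre k \<delta> (A n) + e * (1/2) ^ Suc n)"
    by (intro suminf_le allI B) auto
  also have "\<dots> = (\<Sum>n. hausdorff_pre k \<delta> (A n)) + (\<Sum>n. ennreal e * ennreal ((1/2) ^ Suc n))"
    using \<open>0 < e\<close> by (subst suminf_add[symmetric])
      (auto simp del: ennreal_suminf_cmult simp add: ennreal_mult[symmetric])
  also have "\<dots> = (\<Sum>n. hausdorff_pre k \<delta> (A n)) + e"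
    unfolding ennreal_suminf_cmult
    by (subst suminf_ennreal_eq[OF zero_le_power power_half_series]) auto
  finally show "hausdorff_pre k \<delta> (\<Union>i. A i) \<le> (\<Sum>n. hausdorff_pre k \<delta> (A n)) + e" .
qed

lemma hausdorff_outer_countably_subadditive:
  "hausdorff_outer k (\<Union>i. A i) \<le> (\<Sum>n. hausdorff_outer k (A n))"
proof -
  have "hausdorff_pre k \<delta> (\<Union>i. A i) \<le> (\<Sum>n. hausdorff_outer k (A n))" if "0 < \<delta>" for \<delta>
    using hausdorff_pre_countably_subadditive[of k \<delta> A]
    by (rule order_trans) (intro suminf_le hausdorff_pre_le_outer that, auto)
  then show ?thesis
    unfolding hausdorff_outer_def[of k "\<Union>i. A i"] by (intro SUP_least) auto
qed

lemma outer_measure_space_hausdorff: "outer_measure_space UNIV (hausdorff_outer k)"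
  using hausdorff_outer_countably_subadditive
  by (auto simp: outer_measure_space_def positive_def increasing_def countably_subadditive_def
      hausdorff_outer_empty intro: hausdorff_outer_mono)

lemma hausdorff_outer_subadditive:
  "hausdorff_outer k (A \<union> B) \<le> hausdorff_outer k A + hausdorff_outer k B"
proof -
  have *: "(\<Union>i::nat. if i = 0 then A else if i = 1 then B else {}) = A \<union> B"
    by (force split: if_splits)
  have "(\<Sum>i. hausdorff_outer k (if i = 0 then A else if i = 1 then B else {}))
      = (\<Sum>i\<in>{0, 1::nat}. hausdorff_outer k (if i = 0 then A else if i = 1 then B else {}))"
    by (rule suminf_finite) (auto simp: hausdorff_outer_empty)
  then show ?thesis
    using hausdorff_outer_countably_subadditive[of k "\<lambda>i. if i = 0 then A else if i = 1 then B else {}"]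
    unfolding * by simp
qed

lemma hausdorff_gauge_mono:
  assumes "C \<subseteq> D" "bounded D"
  shows "hausdorff_gauge k C \<le> hausdorff_gauge k D"
  using assms
  by (auto simp: hausdorff_gauge_def
      intro!: ennreal_leI mult_left_mono power_mono divide_right_mono diameter_subset
        diameter_ge_0 bounded_subset[OF assms(2)])

lemma hausdorff_outer_add:
  assumes "0 < d" and sep: "\<And>x y. x \<in> A \<Longrightarrow> y \<in> B \<Longrightarrow> d \<le> dist x y"
  shows "hausdorff_outer k A + hausdorff_outer k B \<le> hausdorff_outer k (A \<union> B)"
proof -
  have pre: "hausdorff_pre k \<delta> A + hausdorff_pre k \<delta> B \<le> hausdorff_pre k \<delta> (A \<union> B)"
    if \<delta>: "0 < \<delta>" "\<delta> < d" for \<delta>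
    unfolding hausdorff_pre_def[of k \<delta> "A \<union> B"]
  proof (rule INF_greatest, safe)
    fix C :: "nat \<Rightarrow> 'a set"
    assume C: "A \<union> B \<subseteq> (\<Union>i. C i)" "\<forall>i. bounded (C i) \<and> diameter (C i) \<le> \<delta>"
    have sub: "hausdorff_pre k \<delta> E \<le> (\<Sum>i. hausdorff_gauge k (C i \<inter> E))"
      if "E \<subseteq> (\<Union>i. C i)" for E
    proof (rule hausdorff_pre_le)
      show "diameter (C i \<inter> E) \<le> \<delta>" for i
        using C(2) diameter_subset[of "C i \<inter> E" "C i"] by (meson inf_le1 order_trans)
    qed (use that C(2) bounded_Int in auto)
    have le: "hausdorff_gauge k (C i \<inter> A) + hausdorff_gauge k (C i \<inter> B) \<le> hausdorff_gauge k (C i)" for i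
    proof -
      have "C i \<inter> A = {} \<or> C i \<inter> B = {}"
      proof (rule ccontr)
        assume "\<not> ?thesis"
        then obtain x y where xy: "x \<in> C i" "x \<in> A" "y \<in> C i" "y \<in> B" by blast
        then have "dist x y \<le> diameter (C i)"
          using C(2) by (intro diameter_bounded_bound) auto
        with sep[of x y] xy C(2) \<delta> show False by (meson linorder_not_less order_trans)
      qed
      then show ?thesis
        using hausdorff_gauge_mono[of "C i \<inter> A" "C i" k] hausdorff_gauge_mono[of "C i \<inter> B" "C i" k] C(2)
        by (auto simp: hausdorff_gauge_def[of k "{}"])
    qed
    have "hausdorff_pre k \<delta> A + hausdorff_pre k \<delta> B
        \<le> (\<Sum>i. hausdorff_gauge k (C i \<inter> A)) + (\<Sum>i. hausdorff_gauge k (C i \<inter> B))"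
      using C(1) by (intro add_mono sub) auto
    also have "\<dots> = (\<Sum>i. hausdorff_gauge k (C i \<inter> A) + hausdorff_gauge k (C i \<inter> B))"
      by (rule suminf_add) auto
    also have "\<dots> \<le> (\<Sum>i. hausdorff_gauge k (C i))"
      by (intro suminf_le le) auto
    finally show "hausdorff_pre k \<delta> A + hausdorff_pre k \<delta> B \<le> (\<Sum>i. hausdorff_gauge k (C i))" .
  qed
  have "hausdorff_outer k A + hausdorff_outer k B
      = (SUP \<delta>\<in>{0<..}. hausdorff_pre k \<delta> A + hausdorff_pre k \<delta> B)"
    unfolding hausdorff_outer_def
  proof (rule SUP_add_directed_ennreal[symmetric])
    show "\<exists>r\<in>{0<..}. hausdorff_pre k i A + hausdorff_pre k j B \<le> hausdorff_pre k r A + hausdorff_pre k r B"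
      if "i \<in> {0<..}" "j \<in> {0<..}" for i j :: real
      using that by (intro bexI[of _ "min i j"] add_mono hausdorff_pre_antimono) auto
  qed
  also have "\<dots> \<le> hausdorff_outer k (A \<union> B)"
  proof (rule SUP_least)
    fix \<delta> :: real assume "\<delta> \<in> {0<..}"
    define r where "r = min \<delta> (d / 2)"
    have r: "0 < r" "r < d" "r \<le> \<delta>"
      using \<open>\<delta> \<in> {0<..}\<close> \<open>0 < d\<close> by (auto simp: r_def min_def)
    have "hausdorff_pre k \<delta> A + hausdorff_pre k \<delta> B \<le> hausdorff_pre k r A + hausdorff_pre k r B"
      using r by (intro add_mono hausdorff_pre_antimono)
    also have "\<dots> \<le> hausdorff_pre k r (A \<union> B)" using r by (intro pre)
    also have "\<dots> \<le> hausdorff_outer k (A \<union> B)" using r by (intro hausdorff_pre_le_outer)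
    finally show "hausdorff_pre k \<delta> A + hausdorff_pre k \<delta> B \<le> hausdorff_outer k (A \<union> B)" .
  qed
  finally show ?thesis .
qed

lemma hausdorff_outer_sum_le:
  fixes R :: "nat \<Rightarrow> 'a::metric_space set"
  assumes sub: "\<And>m. R m \<subseteq> E"
    and sep: "\<And>m. \<exists>d>0. \<forall>j<m. \<forall>x\<in>R j. \<forall>y\<in>R m. d \<le> dist x y"
  shows "(\<Sum>m. hausdorff_outer k (R m)) \<le> hausdorff_outer k E"
proof -
  have "(\<Sum>m<N. hausdorff_outer k (R m)) \<le> hausdorff_outer k (\<Union>m<N. R m)" for N
  proof (induction N)
    case (Suc N)
    obtain d where d: "d > 0" "\<forall>j<N. \<forall>x\<in>R j. \<forall>y\<in>R N. d \<le> dist x y"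
      using sep by blast
    have "(\<Sum>m<Suc N. hausdorff_outer k (R m)) \<le> hausdorff_outer k (\<Union>m<N. R m) + hausdorff_outer k (R N)"
      using Suc.IH by (simp add: add_right_mono)
    also have "\<dots> \<le> hausdorff_outer k ((\<Union>m<N. R m) \<union> R N)"
      using d by (intro hausdorff_outer_add[of d]) auto
    also have "(\<Union>m<N. R m) \<union> R N = (\<Union>m<Suc N. R m)"
      by (auto simp: lessThan_Suc)
    finally show ?case .
  qed simp
  also have "hausdorff_outer k (\<Union>m<N. R m) \<le> hausdorff_outer k E" for N
    using sub by (intro hausdorff_outer_mono) auto
  finally show ?thesis
    by (intro suminf_le_const) auto
qed

lemma hausdorff_outer_closed:
  fixes F :: "'a::metric_space set"
  assumes "closed F"
  shows "hausdorff_outer k (E \<inter> F) + hausdorff_outer k (E - F) \<le> hausdorff_outer k E"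
proof (cases "F = {} \<or> hausdorff_outer k E = \<infinity>")
  case True
  then show ?thesis by (auto simp: hausdorff_outer_empty)
next
  case False
  then have F: "F \<noteq> {}" and fin: "hausdorff_outer k E < \<infinity>"
    by (auto simp: less_top)
  define A where "A n = {x\<in>E. 1 / real (Suc n) \<le> infdist x F}" for n
  define R where "R n = A (Suc n) - A n" for n
  have mono: "A m \<subseteq> A n" if "m \<le> n" for m n
    using that unfolding A_def
    by (auto intro: order_trans[rotated] simp: frac_le)
  have add: "hausdorff_outer k (E \<inter> F) + hausdorff_outer k (A n) \<le> hausdorff_outer k E" for n
  proof -
    have "hausdorff_outer k (E \<inter> F) + hausdorff_outer k (A n) \<le> hausdorff_outer k (E \<inter> F \<union> A n)"
    proof (rule hausdorff_outer_add[of "1 / real (Suc n)"])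
      show "1 / real (Suc n) \<le> dist x y" if "x \<in> E \<inter> F" "y \<in> A n" for x y
        using that infdist_le[of x F y] by (auto simp: A_def dist_commute)
    qed simp
    also have "\<dots> \<le> hausdorff_outer k E"
      by (intro hausdorff_outer_mono) (auto simp: A_def)
    finally show ?thesis .
  qed
  have sepR: "1 / real (j + 2) - 1 / real (m + 1) \<le> dist x y"
    if "x \<in> R j" "y \<in> R m" for j m x y
  proof -
    have "1 / real (j + 2) \<le> infdist x F" "infdist y F \<le> 1 / real (m + 1)"
      using that by (auto simp: R_def A_def)
    moreover have "infdist x F \<le> infdist y F + dist x y"
      by (rule infdist_triangle)
    ultimately show ?thesis by linarith
  qed
  have half: "(\<Sum>m. hausdorff_outer k (R (2 * m + c))) \<le> hausdorff_outer k E" for c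
  proof (rule hausdorff_outer_sum_le)
    show "R (2 * m + c) \<subseteq> E" for m
      by (auto simp: R_def A_def)
    fix m
    show "\<exists>d>0. \<forall>j<m. \<forall>x\<in>R (2 * j + c). \<forall>y\<in>R (2 * m + c). d \<le> dist x y"
    proof (cases "m = 0")
      case True
      then show ?thesis by (intro exI[of _ 1]) auto
    next
      case False
      show ?thesis
      proof (intro exI conjI allI impI ballI)
        show "0 < 1 / real (2 * m + c) - 1 / real (2 * m + c + 1)"
          using False by (simp add: divide_strict_left_mono)
      next
        fix j x y
        assume j: "j < m" and x: "x \<in> R (2 * j + c)" and y: "y \<in> R (2 * m + c)"
        have "1 / real (2 * m + c) \<le> 1 / real (2 * j + c + 2)"
          using j by (intro divide_left_mono) auto
        with sepR[OF x y] show "1 / real (2 * m + c) - 1 / real (2 * m + c + 1) \<le> dist x y"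
          by linarith
      qed
    qed
  qed
  define f where "f m = hausdorff_outer k (R m)" for m
  have "(\<Sum>m<N. f m) \<le> 2 * hausdorff_outer k E" for N
  proof -
    have "(\<Sum>m<N. f m) \<le> (\<Sum>m<2 * N. f m)"
      by (rule sum_mono2) auto
    also have "(\<Sum>m<2 * N. f m) = (\<Sum>m<N. f (2 * m)) + (\<Sum>m<N. f (2 * m + 1))"
      by (induction N) (auto simp: algebra_simps)
    also have "\<dots> \<le> (\<Sum>m. f (2 * m)) + (\<Sum>m. f (2 * m + 1))"
      by (intro add_mono sum_le_suminf) auto
    also have "\<dots> \<le> hausdorff_outer k E + hausdorff_outer k E"
      using half[of 0] half[of 1] by (intro add_mono) (auto simp: f_def)
    finally show ?thesis by (simp add: mult_2)
  qed
  then have "(\<Sum>m. f m) \<le> 2 * hausdorff_outer k E"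
    by (intro suminf_le_const) auto
  also have "\<dots> < top"
    using fin by (simp add: ennreal_mult_less_top)
  finally have fin_f: "(\<Sum>m. f m) < top" .
  define g where "g m = enn2real (f m)" for m
  have f_g: "f m = ennreal (g m)" for m
    using ennreal_suminf_lessD[OF fin_f] by (simp add: g_def less_top)
  have g0: "0 \<le> g m" for m
    by (simp add: g_def)
  have sum_g: "summable g"
    using fin_f g0 by (intro summable_suminf_not_top) (auto simp: f_g less_top)
  show ?thesis
  proof (rule ennreal_le_epsilon)
    fix e :: real assume "0 < e"
    have "(\<lambda>n. \<Sum>m. g (m + n)) \<longlonglongrightarrow> 0"
      by (rule suminf_exist_split2[OF sum_g])
    then obtain n where n: "(\<Sum>m. g (m + n)) < e"
      using order_tendstoD(2)[of _ 0 sequentially e] \<open>0 < e\<close>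
      by (meson eventually_sequentially order_refl)
    have "E - F \<subseteq> A n \<union> (\<Union>m. R (m + n))"
    proof
      fix x assume x: "x \<in> E - F"
      then have pos: "0 < infdist x F"
        using \<open>closed F\<close> F by (metis DiffD2 in_closed_iff_infdist_zero infdist_nonneg order_le_less)
      then obtain N where "1 / real (Suc N) < infdist x F"
        using nat_approx_posE by blast
      then have ex: "\<exists>N. x \<in> A N"
        using x by (auto simp: A_def intro!: exI[of _ N] less_imp_le)
      define M where "M = (LEAST N. x \<in> A N)"
      have M: "x \<in> A M" "\<And>N. N < M \<Longrightarrow> x \<notin> A N"
        using ex by (auto simp: M_def intro: LeastI_ex dest: not_less_Least)
      show "x \<in> A n \<union> (\<Union>m. R (m + n))"
      proof (cases "M \<le> n")
        case True
        then show ?thesis using M(1) mono by blast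
      next
        case False
        then obtain m where "M = Suc (m + n)"
          by (metis add.commute less_iff_Suc_add not_le)
        then have "x \<in> R (m + n)"
          using M by (auto simp: R_def)
        then show ?thesis by blast
      qed
    qed
    then have "hausdorff_outer k (E - F) \<le> hausdorff_outer k (A n \<union> (\<Union>m. R (m + n)))"
      by (rule hausdorff_outer_mono)
    also have "\<dots> \<le> hausdorff_outer k (A n) + hausdorff_outer k (\<Union>m. R (m + n))"
      by (rule hausdorff_outer_subadditive)
    also have "\<dots> \<le> hausdorff_outer k (A n) + (\<Sum>m. f (m + n))"
      unfolding f_def by (intro add_left_mono hausdorff_outer_countably_subadditive)
    also have "(\<Sum>m. f (m + n)) = ennreal (\<Sum>m. g (m + n))"
      unfolding f_g using g0 sum_g by (intro suminf_ennreal2) (auto simp: summable_iff_shift)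
    also have "\<dots> \<le> ennreal e"
      using n by (intro ennreal_leI) simp
    finally have "hausdorff_outer k (E - F) \<le> hausdorff_outer k (A n) + ennreal e"
      by (simp add: add_left_mono)
    then have "hausdorff_outer k (E \<inter> F) + hausdorff_outer k (E - F)
        \<le> hausdorff_outer k (E \<inter> F) + hausdorff_outer k (A n) + ennreal e"
      by (simp add: add_left_mono add.assoc)
    also have "\<dots> \<le> hausdorff_outer k E + ennreal e"
      by (intro add_right_mono add)
    finally show "hausdorff_outer k (E \<inter> F) + hausdorff_outer k (E - F) \<le> hausdorff_outer k E + ennreal e" .
  qed
qed

lemma measure_space_hausdorff_measure:
  "measure_space UNIV (sets (borel :: 'a::metric_space measure)) (hausdorff_outer k)"
proof -
  let ?L = "lambda_system UNIV UNIV (hausdorff_outer k) :: 'a set set"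
  interpret sigma_algebra UNIV "UNIV :: 'a set set"
    using sigma_algebra_Pow[of UNIV] by simp
  have L: "measure_space UNIV ?L (hausdorff_outer k)"
    by (rule caratheodory_lemma[OF outer_measure_space_hausdorff])
  have "F \<in> ?L" if "closed F" for F :: "'a set"
  proof -
    have "hausdorff_outer k (E \<inter> F) + hausdorff_outer k (E - F) = hausdorff_outer k E" for E
      using hausdorff_outer_subadditive[of k "E \<inter> F" "E - F"] hausdorff_outer_closed[OF that, of k E]
      by (simp add: Int_Diff_Un)
    then show ?thesis
      by (auto simp: lambda_system_eq)
  qed
  then have "sigma_sets UNIV {F. closed F} \<subseteq> ?L"
    using L by (intro sigma_algebra.sigma_sets_subset) (auto simp: measure_space_def)
  then have "sets borel \<subseteq> ?L"
    by (simp add: borel_eq_closed)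
  with L show ?thesis
    using sets.sigma_algebra_axioms[of "borel :: 'a measure"]
    by (auto simp: measure_space_def positive_def countably_additive_def subset_iff)
qed

lemma sets_hausdorff_measure [simp, measurable_cong]: "sets (hausdorff_measure k) = sets borel"
  unfolding hausdorff_measure_def
  by (metis sets.sigma_sets_eq sets_measure_of space_borel subset_UNIV Pow_UNIV)

lemma space_hausdorff_measure [simp]: "space (hausdorff_measure k) = UNIV"
  by (simp add: hausdorff_measure_def space_measure_of_conv)

lemma emeasure_hausdorff_measure:
  assumes "A \<in> sets borel"
  shows "emeasure (hausdorff_measure k) A = hausdorff_outer k A"
  unfolding hausdorff_measure_def
  using measure_space_hausdorff_measure[of k] assms
  by (intro emeasure_measure_of_sigma) (auto simp: measure_space_def)


section \<open>Embedded hypersurfaces\<close>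

text \<open>
  \<open>Ck_on k f U\<close>: \<open>f\<close> has continuous partial derivatives up to order \<open>k\<close> on the open set \<open>U\<close>.
\<close>

fun Ck_on :: "nat \<Rightarrow> ('a::euclidean_space \<Rightarrow> 'b::real_normed_vector) \<Rightarrow> 'a set \<Rightarrow> bool" where
  "Ck_on 0 f U \<longleftrightarrow> continuous_on U f"
| "Ck_on (Suc k) f U \<longleftrightarrow>
     (\<forall>x\<in>U. f differentiable at x) \<and>
     (\<forall>i\<in>Basis. Ck_on k (\<lambda>x. frechet_derivative f (at x) i) U)"

definition local_parametrization ::
    "('a::euclidean_space \<times> real) set \<Rightarrow> 'a set \<Rightarrow> ('a \<Rightarrow> 'a \<times> real) \<Rightarrow> bool" where
  "local_parametrization M U X \<longleftrightarrow>
     open U \<and> Ck_on 2 X U \<and> (\<forall>u\<in>U. inj (frechet_derivative X (at u))) \<and>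
     openin (top_of_set M) (X ` U) \<and> (\<exists>Y. homeomorphism U (X ` U) X Y)"

text \<open>
  An embedded submanifold of dimension \<open>n - 1\<close> without boundary (not necessarily closed in
  \<open>\<real>\<^sup>n\<close>), of class \<open>C\<^sup>2\<close>, the least regularity for which the mean curvature makes sense.
\<close>

definition embedded_hypersurface :: "('a::euclidean_space \<times> real) set \<Rightarrow> bool" where
  "embedded_hypersurface M \<longleftrightarrow> (\<forall>p\<in>M. \<exists>U X. local_parametrization M U X \<and> p \<in> X ` U)"

definition tangent_space :: "'b::real_normed_vector set \<Rightarrow> 'b \<Rightarrow> 'b set" where
  "tangent_space S p =
     {v. \<exists>c :: real \<Rightarrow> 'b. c 0 = p \<and> (\<forall>\<^sub>F s in at 0. c s \<in> S) \<and>
         (c has_vector_derivative v) (at 0)}"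

text \<open>A continuous unit normal field; its existence says that \<open>M\<close> is orientable.\<close>

definition gauss_map :: "'b::euclidean_space set \<Rightarrow> ('b \<Rightarrow> 'b) \<Rightarrow> bool" where
  "gauss_map M \<gamma> \<longleftrightarrow> continuous_on M \<gamma> \<and>
     (\<forall>p\<in>M. norm (\<gamma> p) = 1 \<and> (\<forall>v\<in>tangent_space M p. \<gamma> p \<bullet> v = 0))"

text \<open>
  The mean curvature is the trace of the shape operator \<open>-d\<gamma>\<close> on the tangent space, divided by
  its dimension \<open>n - 1\<close>.  The derivative of \<open>\<gamma>\<close> within \<open>M\<close> is determined only on tangent
  vectors, so it is composed with the orthogonal projection to the tangent space; the trace of
  the composition on \<open>\<real>\<^sup>n\<close> is the trace of \<open>d\<gamma>\<close> on the tangent space.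
\<close>

definition tangential_projection :: "'b::euclidean_space \<Rightarrow> 'b \<Rightarrow> 'b" where
  "tangential_projection N v = v - (v \<bullet> N) *\<^sub>R N"

definition mean_curvature :: "'b::euclidean_space set \<Rightarrow> ('b \<Rightarrow> 'b) \<Rightarrow> 'b \<Rightarrow> real" where
  "mean_curvature M \<gamma> p =
     - (\<Sum>i\<in>Basis. frechet_derivative \<gamma> (at p within M) (tangential_projection (\<gamma> p) i) \<bullet> i)
       / (real DIM('b) - 1)"

definition minimal :: "'b::euclidean_space set \<Rightarrow> ('b \<Rightarrow> 'b) \<Rightarrow> bool" where
  "minimal M \<gamma> \<longleftrightarrow> (\<forall>p\<in>M. mean_curvature M \<gamma> p = 0)"


section \<open>Tubes, cycles and flow vectors\<close>

definition hyperplane :: "real \<Rightarrow> ('a \<times> real) set" where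
  "hyperplane t = {p. snd p = t}"

definition cross_section :: "('a \<times> real) set \<Rightarrow> real \<Rightarrow> ('a \<times> real) set" where
  "cross_section M t = M \<inter> hyperplane t"

definition tube :: "('a::euclidean_space \<times> real) set \<Rightarrow> real set \<Rightarrow> bool" where
  "tube M I \<longleftrightarrow> open I \<and> is_interval I \<and>
     (\<forall>t\<in>I. cross_section M t \<noteq> {} \<and> compact (cross_section M t)) \<and>
     (\<forall>t\<^sub>1\<in>I. \<forall>t\<^sub>2\<in>I. compact {p\<in>M. t\<^sub>1 \<le> snd p \<and> snd p \<le> t\<^sub>2})"

text \<open>\<open>t\<close> is a regular value of the restriction of \<open>x\<^sub>n\<close> to \<open>M\<close>.\<close>

definition regular_value :: "('a::euclidean_space \<times> real) set \<Rightarrow> real \<Rightarrow> bool" where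
  "regular_value M t \<longleftrightarrow> (\<forall>p\<in>cross_section M t. \<exists>v\<in>tangent_space M p. snd v \<noteq> 0)"

definition cycle :: "('a::euclidean_space \<times> real) set \<Rightarrow> real \<Rightarrow> ('a \<times> real) set \<Rightarrow> bool" where
  "cycle M t S \<longleftrightarrow> (\<exists>\<C>. \<C> \<subseteq> components (cross_section M t) \<and> \<C> \<noteq> {} \<and> S = \<Union>\<C>)"

definition simple_cycle :: "('a::euclidean_space \<times> real) set \<Rightarrow> real \<Rightarrow> ('a \<times> real) set \<Rightarrow> bool" where
  "simple_cycle M t S \<longleftrightarrow> cycle M t S \<and> connected S \<and>
     (\<exists>\<Omega>. openin (top_of_set (hyperplane t)) \<Omega> \<and> S = top_of_set (hyperplane t) frontier_of \<Omega>)"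

text \<open>
  The unit normal of the cross-section that is tangent to \<open>M\<close> and exterior to the part of \<open>M\<close>
  below the hyperplane, i.e. pointing upwards.
\<close>

definition conormal :: "('a::euclidean_space \<times> real) set \<Rightarrow> real \<Rightarrow> 'a \<times> real \<Rightarrow> 'a \<times> real" where
  "conormal M t p =
     (THE \<nu>. \<nu> \<in> tangent_space M p \<and> norm \<nu> = 1 \<and>
         (\<forall>w\<in>tangent_space (cross_section M t) p. \<nu> \<bullet> w = 0) \<and> \<nu> \<bullet> (0, 1) > 0)"

definition flow_vector ::
    "('a::euclidean_space \<times> real) set \<Rightarrow> real \<Rightarrow> ('a \<times> real) set \<Rightarrow> 'a \<times> real" where
  "flow_vector M t S =
     (THE J. \<forall>e. e \<bullet> J =
        (LINT p:S|hausdorff_measure (DIM('a \<times> real) - 2). e \<bullet> conormal M t p))"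


section \<open>Angles\<close>

definition angle :: "'b::real_inner \<Rightarrow> 'b \<Rightarrow> real" where
  "angle u v = arccos (u \<bullet> v / (norm u * norm v))"

definition spherical_diameter :: "'b::real_inner set \<Rightarrow> real" where
  "spherical_diameter E = (SUP (u, v)\<in>E \<times> E. angle u v)"

end

theory Submission
  imports Defs
begin

text \<open>
  Write \<open>\<Sigma>\<close> for the cycle, \<open>J\<close> for its flow vector, \<open>e\<^sub>n = (0, 1)\<close>, and \<open>\<alpha>\<close> for the angle between
  \<open>J\<close> and \<open>e\<^sub>n\<close>.  At a point of \<open>\<Sigma>\<close> both the Gauss map \<open>\<gamma>\<close> and the conormal \<open>\<nu>\<close> are orthogonal to
  the tangent space of \<open>\<Sigma>\<close>, so they lie in the plane spanned by \<open>e\<^sub>n\<close> and the horizontal unit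
  normal \<open>N\<close> of \<open>\<Sigma>\<close>: with a tilt \<open>\<theta>\<close> strictly between \<open>-\<pi>/2\<close> and \<open>\<pi>/2\<close>,
  \<open>\<gamma> = cos \<theta> N - sin \<theta> e\<^sub>n\<close> and \<open>\<nu> = cos \<theta> e\<^sub>n + sin \<theta> N\<close>.  The angle between two values of \<open>\<gamma>\<close> is at
  least the difference of the two tilts, so it is enough that \<open>\<theta>\<close> oscillates by at least
  \<open>2\<alpha>\<close> on \<open>\<Sigma>\<close>.

  Let \<open>e\<close> be the direction of the horizontal part of \<open>J\<close>.  The definition of \<open>\<alpha>\<close> says that
  \<open>cos \<alpha> \<integral> sin \<theta> \<langle>N, e\<rangle> = sin \<alpha> \<integral> cos \<theta>\<close>, and \<open>\<integral> N = 0\<close> because \<open>\<Sigma>\<close> is a closed hypersurface of a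
  hyperplane.  Hence \<open>\<integral> ((sin \<theta> cos \<alpha> - k) \<langle>N, e\<rangle> - cos \<theta> sin \<alpha>) = 0\<close> for every constant \<open>k\<close>.  If
  \<open>\<theta>\<close> oscillated by less than \<open>2\<alpha>\<close>, then \<open>sin (\<theta>\<^sub>1 - \<alpha>) < sin (\<theta>\<^sub>2 + \<alpha>)\<close> for any two of its values, and
  a \<open>k\<close> between the largest of the left-hand sides and the smallest of the right-hand sides
  would make the integrand negative everywhere.

  The substance is \<open>\<integral> N = 0\<close> for the Hausdorff measure, \<open>integral_normal_eq_0\<close>.  It is the case
  \<open>\<psi>(x) = \<langle>f, x\<rangle>\<close> with a unit vector \<open>f\<close> orthogonal to \<open>e\<close> of the tangential divergence theorem
  \<open>\<integral> (\<langle>N, e\<rangle> \<partial>\<^sub>f \<psi> - \<langle>N, f\<rangle> \<partial>\<^sub>e \<psi>) = 0\<close>, \<open>tangential_flux_zero\<close>.  That theorem is local: cutting off with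
  bump functions, one may assume that \<open>\<psi>\<close> is supported where the hypersurface is a graph over
  the hyperplane orthogonal to some \<open>n\<close>.  If \<open>e = n\<close> and \<open>f\<close> is orthogonal to \<open>n\<close>, the integrand
  is \<open>\<langle>N, n\<rangle>\<close> times the derivative of \<open>\<psi>\<close> along the tangent vector that projects to \<open>f\<close>.  The
  projection carries the measure \<open>\<langle>N, n\<rangle> dA\<close> to the Hausdorff measure of the hyperplane
  (\<open>projection_flux\<close>), so the integral is that of \<open>\<partial>\<^sub>f\<close> of a compactly supported function, which
  vanishes by translation invariance.  Other pairs of directions follow by bilinearity.

  The area formula \<open>projection_flux\<close> needs the Jacobian of the orthogonal projection between
  two hyperplanes (\<open>hausdorff_outer_projection_of_plane\<close>).  The Hausdorff measure of a
  hyperplane times length along its unit normal is a translation-invariant measure, hence a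
  multiple of Lebesgue measure, and by symmetry the same multiple for all hyperplanes; the
  volume of an oblique prism, computed with respect to two hyperplanes, gives the Jacobian.
  Small pieces of the hypersurface are nearly flat, and Lipschitz estimates transfer the
  formula from tangent hyperplanes to the hypersurface.
\<close>

section \<open>Hausdorff measure and Lipschitz maps\<close>

lemma hausdorff_outer_lipschitz:
  fixes f :: "'x::metric_space \<Rightarrow> 'y::metric_space"
  assumes L: "0 < L" and lip: "\<And>x y. x \<in> A \<Longrightarrow> y \<in> A \<Longrightarrow> dist (f x) (f y) \<le> L * dist x y"
  shows "hausdorff_outer k (f ` A) \<le> ennreal (L ^ k) * hausdorff_outer k A"
proof -
  have img: "bounded (f ` (C \<inter> A)) \<and> diameter (f ` (C \<inter> A)) \<le> L * diameter C"
    if C: "bounded C" for C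
  proof -
    have le: "dist (f x) (f y) \<le> L * diameter C" if "x \<in> C \<inter> A" "y \<in> C \<inter> A" for x y
      using lip[of x y] diameter_bounded_bound[OF C, of x y] that L
      by (smt (verit) IntE mult_left_mono)
    have "0 \<le> L * diameter C" using L C by (simp add: diameter_ge_0)
    then have "diameter (f ` (C \<inter> A)) \<le> L * diameter C"
      using le unfolding diameter_def[of "f ` (C \<inter> A)"] by (auto intro!: cSUP_least)
    moreover have "bounded (f ` (C \<inter> A))"
      unfolding bounded_two_points using le by (intro exI[of _ "L * diameter C"]) auto
    ultimately show ?thesis by blast
  qed
  have pre: "hausdorff_pre k \<delta> (f ` A) \<le> ennreal (L ^ k) * hausdorff_pre k (\<delta> / L) A" if "0 < \<delta>" for \<delta>
  proof -
    have le: "hausdorff_pre k \<delta> (f ` A) \<le> ennreal (L ^ k) * (\<Sum>i. hausdorff_gauge k (C i))"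
      if C: "A \<subseteq> (\<Union>i. C i)" "\<forall>i. bounded (C i) \<and> diameter (C i) \<le> \<delta> / L" for C :: "nat \<Rightarrow> 'x set"
    proof -
      have "hausdorff_pre k \<delta> (f ` A) \<le> (\<Sum>i. hausdorff_gauge k (f ` (C i \<inter> A)))"
      proof (rule hausdorff_pre_le)
        show "f ` A \<subseteq> (\<Union>i. f ` (C i \<inter> A))" using C(1) by blast
        show "bounded (f ` (C i \<inter> A))" for i using img C(2) by blast
        show "diameter (f ` (C i \<inter> A)) \<le> \<delta>" for i
        proof -
          have "L * diameter (C i) \<le> \<delta>"
            using C(2) L by (metis mult.commute pos_le_divide_eq)
          then show ?thesis using img[of "C i"] C(2) by fastforce
        qed
      qed
      also have "\<dots> \<le> (\<Sum>i. ennreal (L ^ k) * hausdorff_gauge k (C i))"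
      proof (intro suminf_le allI)
        fix i
        have "hausdorff_gauge k (f ` (C i \<inter> A)) \<le> ennreal (unit_ball_vol k * (L * diameter (C i) / 2) ^ k)"
          using img[of "C i"] C(2)
          by (auto simp: hausdorff_gauge_def intro!: ennreal_leI mult_left_mono power_mono diameter_ge_0)
        also have "unit_ball_vol k * (L * diameter (C i) / 2) ^ k
            = L ^ k * (unit_ball_vol k * (diameter (C i) / 2) ^ k)"
          by (simp add: power_mult_distrib power_divide field_simps)
        also have "ennreal \<dots> = ennreal (L ^ k) * ennreal (unit_ball_vol k * (diameter (C i) / 2) ^ k)"
          using L C(2) by (intro ennreal_mult) (auto intro!: mult_nonneg_nonneg zero_le_power simp: diameter_ge_0)
        finally show "hausdorff_gauge k (f ` (C i \<inter> A)) \<le> ennreal (L ^ k) * hausdorff_gauge k (C i)"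
          by (cases "C i = {}") (auto simp: hausdorff_gauge_def)
      qed auto
      finally show ?thesis by simp
    qed
    have *: "ennreal (1 / L ^ k) * hausdorff_pre k \<delta> (f ` A) \<le> (\<Sum>i. hausdorff_gauge k (C i))"
      if "A \<subseteq> (\<Union>i. C i)" "\<forall>i. bounded (C i) \<and> diameter (C i) \<le> \<delta> / L" for C :: "nat \<Rightarrow> 'x set"
    proof -
      have "ennreal (1 / L ^ k) * hausdorff_pre k \<delta> (f ` A)
          \<le> ennreal (1 / L ^ k) * (ennreal (L ^ k) * (\<Sum>i. hausdorff_gauge k (C i)))"
        using that by (intro mult_left_mono le) auto
      then show ?thesis using L by (simp add: mult.assoc[symmetric] ennreal_mult[symmetric])
    qed
    have "ennreal (1 / L ^ k) * hausdorff_pre k \<delta> (f ` A) \<le> hausdorff_pre k (\<delta> / L) A"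
      unfolding hausdorff_pre_def[of k "\<delta> / L"] using * by (intro INF_greatest) auto
    then have "ennreal (L ^ k) * (ennreal (1 / L ^ k) * hausdorff_pre k \<delta> (f ` A))
        \<le> ennreal (L ^ k) * hausdorff_pre k (\<delta> / L) A"
      by (intro mult_left_mono) auto
    then show ?thesis using L by (simp add: mult.assoc[symmetric] ennreal_mult[symmetric])
  qed
  show ?thesis
    unfolding hausdorff_outer_def[of k "f ` A"]
  proof (rule SUP_least)
    fix \<delta> :: real assume "\<delta> \<in> {0<..}"
    then have "hausdorff_pre k \<delta> (f ` A) \<le> ennreal (L ^ k) * hausdorff_pre k (\<delta> / L) A"
      using pre by auto
    also have "\<dots> \<le> ennreal (L ^ k) * hausdorff_outer k A"
      using L \<open>\<delta> \<in> {0<..}\<close> by (intro mult_left_mono hausdorff_pre_le_outer) auto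
    finally show "hausdorff_pre k \<delta> (f ` A) \<le> ennreal (L ^ k) * hausdorff_outer k A" .
  qed
qed

lemma hausdorff_outer_isometry:
  fixes f :: "'x::metric_space \<Rightarrow> 'y::metric_space"
  assumes iso: "\<And>x y. x \<in> A \<Longrightarrow> y \<in> A \<Longrightarrow> dist (f x) (f y) = dist x y"
  shows "hausdorff_outer k (f ` A) = hausdorff_outer k A"
proof (rule antisym)
  have inj: "inj_on f A" using iso by (metis dist_eq_0_iff inj_onI)
  show "hausdorff_outer k (f ` A) \<le> hausdorff_outer k A"
    using hausdorff_outer_lipschitz[of 1 A f k] iso by auto
  have "dist (inv_into A f u) (inv_into A f v) \<le> 1 * dist u v" if "u \<in> f ` A" "v \<in> f ` A" for u v
    using that iso inj by auto
  from hausdorff_outer_lipschitz[OF _ this, where k=k]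
  have "hausdorff_outer k (inv_into A f ` f ` A) \<le> hausdorff_outer k (f ` A)"
    by simp
  then show "hausdorff_outer k A \<le> hausdorff_outer k (f ` A)"
    using inj by simp
qed

text \<open>
  The two-map form serves for projections, which are compared with each other rather than
  with the set that they are applied to: the Lipschitz map is \<open>g\<close> after the inverse of \<open>f\<close>.
\<close>

lemma hausdorff_outer_compare_images:
  fixes f :: "'x \<Rightarrow> 'y::metric_space" and g :: "'x \<Rightarrow> 'z::metric_space"
  assumes L: "0 < L" and le: "\<And>x y. x \<in> A \<Longrightarrow> y \<in> A \<Longrightarrow> dist (g x) (g y) \<le> L * dist (f x) (f y)"
  shows "hausdorff_outer k (g ` A) \<le> ennreal (L ^ k) * hausdorff_outer k (f ` A)"
proof -
  define h where "h y = g (inv_into A f y)" for y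
  have hf: "h (f x) = g x" if "x \<in> A" for x
  proof -
    have "inv_into A f (f x) \<in> A" "f (inv_into A f (f x)) = f x"
      using that by (auto intro: inv_into_into f_inv_into_f)
    then have "dist (g (inv_into A f (f x))) (g x) \<le> 0"
      using le[of "inv_into A f (f x)" x] that by simp
    then show ?thesis by (simp add: h_def)
  qed
  have "hausdorff_outer k (h ` f ` A) \<le> ennreal (L ^ k) * hausdorff_outer k (f ` A)"
    using le hf by (intro hausdorff_outer_lipschitz[OF L]) auto
  moreover have "h ` f ` A = g ` A" using hf by force
  ultimately show ?thesis by simp
qed

lemma hausdorff_pre_finite_cover_le:
  assumes F: "finite F" and A: "A \<subseteq> (\<Union>f\<in>F. C f)"
    and C: "\<And>f. f \<in> F \<Longrightarrow> bounded (C f) \<and> diameter (C f) \<le> \<delta>" and "0 \<le> \<delta>" "k > 0"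
  shows "hausdorff_pre k \<delta> A \<le> (\<Sum>f\<in>F. hausdorff_gauge k (C f))"
proof -
  obtain e where e: "bij_betw e {..<card F} F"
    using F by (metis bij_betw_from_nat_into_finite)
  define D where "D i = (if i < card F then C (e i) else {})" for i
  have "hausdorff_pre k \<delta> A \<le> (\<Sum>i. hausdorff_gauge k (D i))"
  proof (rule hausdorff_pre_le)
    show "A \<subseteq> (\<Union>i. D i)"
    proof
      fix x assume "x \<in> A"
      then obtain f where "f \<in> F" "x \<in> C f" using A by auto
      then obtain i where "i < card F" "f = e i" using e by (auto simp: bij_betw_def)
      with \<open>x \<in> C f\<close> show "x \<in> (\<Union>i. D i)" by (auto simp: D_def)
    qed
    show "bounded (D i)" "diameter (D i) \<le> \<delta>" for i
      using C[of "e i"] e \<open>0 \<le> \<delta>\<close> by (auto simp: D_def bij_betw_def)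
  qed
  also have "\<dots> = (\<Sum>i<card F. hausdorff_gauge k (D i))"
    by (rule suminf_finite) (auto simp: hausdorff_gauge_def D_def)
  also have "\<dots> = (\<Sum>i<card F. hausdorff_gauge k (C (e i)))"
    by (intro sum.cong) (auto simp: D_def)
  also have "\<dots> = (\<Sum>f\<in>F. hausdorff_gauge k (C f))"
    by (rule sum.reindex_bij_betw[OF e])
  finally show ?thesis .
qed

section \<open>Translation-invariant measures\<close>

lemma emeasure_lborel_reflect:
  fixes A :: "'a::euclidean_space set"
  assumes [measurable]: "A \<in> sets borel"
  shows "(\<integral>\<^sup>+y. indicator A (x - y) \<partial>lborel) = emeasure lborel A"
proof -
  have eq: "distr lborel borel (\<lambda>y::'a. x - y) = lborel"
    using lborel_affine[of "-1" x] by (simp add: density_1)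
  have "(\<integral>\<^sup>+y. indicator A (x - y) \<partial>lborel) = (\<integral>\<^sup>+y. indicator A y \<partial>distr lborel borel (\<lambda>y. x - y))"
    by (subst nn_integral_distr) auto
  then show ?thesis by (simp add: eq)
qed

text \<open>
  Uniqueness of Haar measure up to a factor, by Fubini:  \<open>\<mu>(A) \<lambda>(B)\<close> is the double integral of
  \<open>1\<^sub>A(x) 1\<^sub>B(y + x)\<close>, and shifting \<open>x\<close> by \<open>-y\<close> inside the \<open>\<mu>\<close>-integral exchanges the roles of \<open>A\<close>
  and \<open>B\<close>.  The product form of the conclusion avoids choosing a set to normalise with.
\<close>

lemma translation_invariant_measure_eq:
  fixes \<mu> :: "'a::euclidean_space measure"
  assumes sets: "sets \<mu> = sets borel" and sf: "sigma_finite_measure \<mu>"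
    and inv: "\<And>w. distr \<mu> borel (\<lambda>x. x + w) = \<mu>"
    and [measurable]: "A \<in> sets borel" "B \<in> sets borel"
  shows "emeasure \<mu> A * emeasure lborel B = emeasure lborel A * emeasure \<mu> B"
proof -
  interpret \<mu>: sigma_finite_measure \<mu> by fact
  interpret P: pair_sigma_finite \<mu> lborel ..
  note [measurable_cong] = sets
  have shift: "(\<integral>\<^sup>+x. f (x + w) \<partial>\<mu>) = (\<integral>\<^sup>+x. f x \<partial>\<mu>)"
    if [measurable]: "f \<in> borel_measurable borel" for f :: "'a \<Rightarrow> ennreal" and w
  proof -
    have "(\<integral>\<^sup>+x. f x \<partial>distr \<mu> borel (\<lambda>x. x + w)) = (\<integral>\<^sup>+x. f (x + w) \<partial>\<mu>)"
      by (subst nn_integral_distr) auto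
    then show ?thesis by (simp add: inv)
  qed
  have "emeasure \<mu> A * emeasure lborel B = (\<integral>\<^sup>+x. indicator A x * emeasure lborel B \<partial>\<mu>)"
    by (subst nn_integral_multc) (auto simp: sets)
  also have "\<dots> = (\<integral>\<^sup>+x. \<integral>\<^sup>+y. indicator A x * indicator B (y + x) \<partial>lborel \<partial>\<mu>)"
  proof (rule nn_integral_cong)
    fix x
    have "(\<integral>\<^sup>+y. indicator B (y + x) \<partial>lborel) = (\<integral>\<^sup>+y. indicator B y \<partial>distr lborel borel ((+) x))"
      by (subst nn_integral_distr) (auto simp: add.commute)
    also have "\<dots> = emeasure lborel B" by (simp add: lborel_distr_plus)
    finally show "indicator A x * emeasure lborel B = (\<integral>\<^sup>+y. indicator A x * indicator B (y + x) \<partial>lborel)"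
      by (subst nn_integral_cmult) auto
  qed
  also have "\<dots> = (\<integral>\<^sup>+y. \<integral>\<^sup>+x. indicator A x * indicator B (y + x) \<partial>\<mu> \<partial>lborel)"
    by (intro P.Fubini'[symmetric]) (auto simp: split_beta')
  also have "\<dots> = (\<integral>\<^sup>+y. \<integral>\<^sup>+x. indicator A (x - y) * indicator B x \<partial>\<mu> \<partial>lborel)"
  proof (rule nn_integral_cong)
    fix y :: 'a
    show "(\<integral>\<^sup>+x. indicator A x * indicator B (y + x) \<partial>\<mu>) = (\<integral>\<^sup>+x. indicator A (x - y) * indicator B x \<partial>\<mu>)"
      using shift[of "\<lambda>x. indicator A (x - y) * indicator B x" y] by (simp add: add.commute)
  qed
  also have "\<dots> = (\<integral>\<^sup>+x. \<integral>\<^sup>+y. indicator A (x - y) * indicator B x \<partial>lborel \<partial>\<mu>)"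
    by (intro P.Fubini') (auto simp: split_beta')
  also have "\<dots> = (\<integral>\<^sup>+x. emeasure lborel A * indicator B x \<partial>\<mu>)"
    by (intro nn_integral_cong) (subst nn_integral_multc, auto simp: emeasure_lborel_reflect)
  also have "\<dots> = emeasure lborel A * emeasure \<mu> B"
    by (subst nn_integral_cmult) (auto simp: sets)
  finally show ?thesis .
qed

section \<open>Hausdorff measure of boxes in coordinate hyperplanes\<close>

text \<open>
  With \<open>d = DIM('a)\<close>, a box of dimension \<open>d - 1\<close> is covered by about \<open>N\<^bsup>d-1\<^esup>\<close> cubes of diameter of
  order \<open>1/N\<close>, so the sums of gauges stay bounded as \<open>N\<close> grows.
\<close>

lemma hausdorff_outer_coordinate_box_finite:
  fixes b :: "'a::euclidean_space"
  assumes b: "b \<in> Basis" and dim: "DIM('a) \<ge> 2" and m: "0 < m"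
  shows "hausdorff_outer (DIM('a) - 1) {x::'a. x \<bullet> b = 0 \<and> (\<forall>j\<in>Basis. \<bar>x \<bullet> j\<bar> \<le> m)} < \<infinity>"
    (is "hausdorff_outer ?k ?B < _")
proof -
  let ?u = "unit_ball_vol (real ?k)"
  have k: "?k > 0" using dim by simp
  have cardB: "card (Basis - {b}) = ?k" using b by simp
  have pre: "hausdorff_pre ?k \<delta> ?B \<le> ennreal (?u * (2 * real ?k * m) ^ ?k)" if \<delta>: "0 < \<delta>" for \<delta>
  proof -
    obtain N :: nat where N: "real ?k * (2 * m) / \<delta> < real N" using reals_Archimedean2 by blast
    have N0: "0 < N" using N m \<delta> k
      by (metis divide_nonneg_pos less_le_not_le mult_nonneg_nonneg not_gr_zero of_nat_0 of_nat_0_le_iff order_less_imp_le zero_le_numeral)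
    define D where "D = real ?k * (2 * m / N)"
    have D: "0 \<le> D" "D \<le> \<delta>" using N N0 m \<delta> by (auto simp: D_def field_simps)
    define F where "F = (Basis - {b}) \<rightarrow>\<^sub>E {..N}"
    \<comment> \<open>The cells of a grid of mesh \<open>2 m / N\<close>, indexed by the integer coordinates of a corner.\<close>
    define Q where "Q f = {x::'a. x \<bullet> b = 0 \<and> (\<forall>j\<in>Basis - {b}. - m + 2 * m / N * real (f j) \<le> x \<bullet> j \<and> x \<bullet> j \<le> - m + 2 * m / N * (real (f j) + 1))}" for f :: "'a \<Rightarrow> nat"
    have distQ: "dist x y \<le> D" if "x \<in> Q f" "y \<in> Q f" for x y f
    proof -
      have "dist x y \<le> (\<Sum>j\<in>Basis. \<bar>(x - y) \<bullet> j\<bar>)"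
        unfolding dist_norm by (rule norm_le_l1)
      also have "\<dots> = (\<Sum>j\<in>Basis - {b}. \<bar>(x - y) \<bullet> j\<bar>)"
        using b that by (subst sum.remove[of _ b]) (auto simp: Q_def inner_diff_left)
      also have "\<dots> \<le> (\<Sum>j\<in>Basis - {b}. 2 * m / N)"
      proof (rule sum_mono)
        fix j assume j: "j \<in> Basis - {b}"
        have step: "- m + 2 * m / N * (real (f j) + 1) = - m + 2 * m / N * real (f j) + 2 * m / N"
          by (simp add: algebra_simps add_divide_distrib)
        have "- m + 2 * m / N * real (f j) \<le> z \<bullet> j \<and> z \<bullet> j \<le> - m + 2 * m / N * (real (f j) + 1)"
          if "z \<in> Q f" for z
          using that j by (auto simp: Q_def)
        note bds = this[OF that(1)] this[OF that(2)]
        from bds step show "\<bar>(x - y) \<bullet> j\<bar> \<le> 2 * m / N"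
          unfolding inner_diff_left by linarith
      qed
      also have "\<dots> = D" by (simp add: cardB D_def)
      finally show ?thesis .
    qed
    have diamQ: "bounded (Q f) \<and> diameter (Q f) \<le> D" for f
    proof
      show "bounded (Q f)" unfolding bounded_two_points using distQ by blast
      show "diameter (Q f) \<le> D" using distQ D by (intro diameter_le) (auto simp: dist_norm)
    qed
    have "hausdorff_pre ?k \<delta> ?B \<le> (\<Sum>f\<in>F. hausdorff_gauge ?k (Q f))"
    proof (rule hausdorff_pre_finite_cover_le)
      show "finite F" unfolding F_def by (intro finite_PiE) auto
      show "?B \<subseteq> (\<Union>f\<in>F. Q f)"
      proof
        fix x assume x: "x \<in> ?B"
        define f where "f = (\<lambda>j\<in>Basis - {b}. nat \<lfloor>(x \<bullet> j + m) * N / (2 * m)\<rfloor>)"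
        have fj: "- m + 2 * m / N * real (f j) \<le> x \<bullet> j \<and> x \<bullet> j \<le> - m + 2 * m / N * (real (f j) + 1) \<and> f j \<le> N"
          if "j \<in> Basis - {b}" for j
        proof -
          let ?q = "(x \<bullet> j + m) * N / (2 * m)"
          have xj: "\<bar>x \<bullet> j\<bar> \<le> m" using x that by auto
          have q: "0 \<le> ?q" using xj m by (auto intro!: divide_nonneg_nonneg mult_nonneg_nonneg)
          have "(x \<bullet> j + m) * N \<le> (2 * m) * N" using xj by (intro mult_right_mono) auto
          then have qN: "?q \<le> N" using m by (simp add: field_simps)
          have f: "f j = nat \<lfloor>?q\<rfloor>" using that by (simp add: f_def)
          have 1: "real (f j) \<le> ?q" "?q \<le> real (f j) + 1" using q f by linarith+
          have "f j \<le> N" using 1 qN by linarith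
          moreover have "x \<bullet> j = - m + 2 * m / N * ?q" using m N0 by simp
          moreover have "2 * m / N * real (f j) \<le> 2 * m / N * ?q" "2 * m / N * ?q \<le> 2 * m / N * (real (f j) + 1)"
            using 1 m by (auto intro!: mult_left_mono simp del: times_divide_eq_right times_divide_eq_left)
          ultimately show ?thesis by linarith
        qed
        have "f \<in> F" using fj by (auto simp: F_def f_def)
        moreover have "x \<in> Q f" using x fj by (auto simp: Q_def)
        ultimately show "x \<in> (\<Union>f\<in>F. Q f)" by blast
      qed
      show "bounded (Q f) \<and> diameter (Q f) \<le> \<delta>" for f using diamQ[of f] D by auto
    qed (use \<delta> k in auto)
    also have "\<dots> \<le> (\<Sum>f\<in>F. ennreal (?u * (D / 2) ^ ?k))"
      using diamQ by (intro sum_mono)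
        (auto simp: hausdorff_gauge_def intro!: ennreal_leI mult_left_mono power_mono diameter_ge_0)
    also have "\<dots> = ennreal (real (card F) * (?u * (D / 2) ^ ?k))"
      using D by (simp add: ennreal_mult ennreal_of_nat_eq_real_of_nat)
    also have "card F = (N + 1) ^ ?k"
      by (simp add: F_def card_PiE cardB)
    also have "real ((N + 1) ^ ?k) * (?u * (D / 2) ^ ?k) = ?u * ((real N + 1) / N * (real ?k * m)) ^ ?k"
      by (simp add: D_def power_mult_distrib power_divide add.commute)
    also have "ennreal \<dots> \<le> ennreal (?u * (2 * real ?k * m) ^ ?k)"
    proof (intro ennreal_leI mult_left_mono power_mono)
      have "(real N + 1) / N \<le> 2" using N0 by (simp add: field_simps)
      then have "(real N + 1) / N * (real ?k * m) \<le> 2 * (real ?k * m)"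
        using m by (intro mult_right_mono) auto
      then show "(real N + 1) / N * (real ?k * m) \<le> 2 * real ?k * m" by (simp only: mult.assoc)
    qed (use m in auto)
    finally show ?thesis .
  qed
  have "hausdorff_outer ?k ?B \<le> ennreal (?u * (2 * real ?k * m) ^ ?k)"
    unfolding hausdorff_outer_def using pre by (intro SUP_least) auto
  then show ?thesis by (rule order_le_less_trans) auto
qed

text \<open>
  A covering of the box, thickened by a unit segment in the missing direction, covers the unit
  cube.  A set of diameter \<open>\<delta>\<close> thickens into a box of volume \<open>(2\<delta>)\<^bsup>d-1\<^esup>\<close> for \<open>d = DIM('a)\<close>,
  which is a fixed multiple of its gauge.
\<close>

lemma hausdorff_outer_coordinate_box_pos:
  fixes b :: "'a::euclidean_space"
  assumes b: "b \<in> Basis" and dim: "DIM('a) \<ge> 2"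
  shows "hausdorff_outer (DIM('a) - 1) {x::'a. x \<bullet> b = 0 \<and> (\<forall>j\<in>Basis. 0 \<le> x \<bullet> j \<and> x \<bullet> j \<le> 1)} > 0"
    (is "hausdorff_outer ?k ?B > _")
proof -
  let ?u = "unit_ball_vol (real ?k)"
  define K where "K = 4 ^ ?k / ?u"
  have K: "K > 0" by (simp add: K_def)
  have cardB: "card (Basis - {b}) = ?k" using b by simp
  have "ennreal (1 / K) \<le> hausdorff_pre ?k 1 ?B"
    unfolding hausdorff_pre_def
  proof (rule INF_greatest, safe)
    fix C :: "nat \<Rightarrow> 'a set"
    assume C: "?B \<subseteq> (\<Union>i. C i)" "\<forall>i. bounded (C i) \<and> diameter (C i) \<le> 1"
    define c where "c i = (SOME x. x \<in> C i)" for i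
    define lo where "lo i = (\<Sum>j\<in>Basis. (if j = b then 0 else c i \<bullet> j - diameter (C i)) *\<^sub>R j)" for i
    define hi where "hi i = (\<Sum>j\<in>Basis. (if j = b then 1 else c i \<bullet> j + diameter (C i)) *\<^sub>R j)" for i
    define T where "T i = (if C i = {} then {} else cbox (lo i) (hi i))" for i
    have D0: "0 \<le> diameter (C i)" for i using C(2) by (simp add: diameter_ge_0)
    have em: "emeasure lborel (T i) \<le> ennreal K * hausdorff_gauge ?k (C i)" for i
    proof (cases "C i = {}")
      case False
      have "emeasure lborel (cbox (lo i) (hi i)) = ennreal (\<Prod>j\<in>Basis. (hi i - lo i) \<bullet> j)"
        using D0[of i] by (intro emeasure_lborel_cbox) (auto simp: lo_def hi_def)
      also have "(\<Prod>j\<in>Basis. (hi i - lo i) \<bullet> j) = (\<Prod>j\<in>Basis - {b}. (hi i - lo i) \<bullet> j)"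
        using b by (subst prod.remove[of _ b]) (auto simp: lo_def hi_def inner_diff_left)
      also have "\<dots> = (\<Prod>j\<in>Basis - {b}. 2 * diameter (C i))"
        by (intro prod.cong) (auto simp: lo_def hi_def inner_diff_left)
      also have "\<dots> = K * (?u * (diameter (C i) / 2) ^ ?k)"
      proof -
        have u: "?u \<noteq> 0" using unit_ball_vol_pos[of "real ?k"] by linarith
        have pow: "(2 * diameter (C i)) ^ ?k = 4 ^ ?k * (diameter (C i) / 2) ^ ?k"
        proof -
          have "4 * (diameter (C i) / 2) = 2 * diameter (C i)" by simp
          then show ?thesis using power_mult_distrib[of 4 "diameter (C i) / 2" ?k] by metis
        qed
        have cancel: "P / u * (u * X) = P * X" if "u \<noteq> 0" for P u X :: real
          using that by simp
        show ?thesis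
          by (simp only: prod_constant cardB K_def pow cancel[OF u])
      qed
      also have "ennreal \<dots> = ennreal K * hausdorff_gauge ?k (C i)"
        using False D0[of i] K by (simp add: hausdorff_gauge_def ennreal_mult)
      finally show ?thesis using False by (simp add: T_def)
    qed (simp add: T_def)
    have "cbox 0 One \<subseteq> (\<Union>i. T i)"
    proof
      fix x :: 'a assume x: "x \<in> cbox 0 One"
      define y where "y = x - (x \<bullet> b) *\<^sub>R b"
      have yj: "y \<bullet> j = (if j = b then 0 else x \<bullet> j)" if "j \<in> Basis" for j
        using that b by (auto simp: y_def inner_diff_left inner_Basis)
      have "y \<in> ?B" using x b yj by (auto simp: mem_box)
      then obtain i where i: "y \<in> C i" using C(1) by blast
      then have ci: "c i \<in> C i" unfolding c_def by (rule someI)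
      have d: "dist y (c i) \<le> diameter (C i)"
        using C(2) i ci by (intro diameter_bounded_bound) auto
      have "\<bar>y \<bullet> j - c i \<bullet> j\<bar> \<le> diameter (C i)" if "j \<in> Basis" for j
        using Basis_le_norm[OF that, of "y - c i"] d by (simp add: dist_norm inner_diff_left)
      then have "lo i \<bullet> j \<le> x \<bullet> j \<and> x \<bullet> j \<le> hi i \<bullet> j" if "j \<in> Basis" for j
        using that x yj[OF that] by (fastforce simp: lo_def hi_def mem_box abs_le_iff)
      then have "x \<in> T i" using i by (auto simp: T_def mem_box)
      then show "x \<in> (\<Union>i. T i)" by blast
    qed
    then have "emeasure lborel (cbox 0 One :: 'a set) \<le> emeasure lborel (\<Union>i. T i)"
      by (intro emeasure_mono) (auto simp: T_def)
    also have "\<dots> \<le> (\<Sum>i. emeasure lborel (T i))"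
      by (intro emeasure_subadditive_countably) (auto simp: T_def)
    also have "\<dots> \<le> (\<Sum>i. ennreal K * hausdorff_gauge ?k (C i))"
      by (intro suminf_le em) auto
    also have "\<dots> = ennreal K * (\<Sum>i. hausdorff_gauge ?k (C i))" by simp
    finally have "1 \<le> ennreal K * (\<Sum>i. hausdorff_gauge ?k (C i))"
      by (simp add: emeasure_lborel_cbox)
    then have "ennreal (1 / K) * 1 \<le> ennreal (1 / K) * (ennreal K * (\<Sum>i. hausdorff_gauge ?k (C i)))"
      by (intro mult_left_mono) auto
    then show "ennreal (1 / K) \<le> (\<Sum>i. hausdorff_gauge ?k (C i))"
      using K by (simp add: mult.assoc[symmetric] ennreal_mult[symmetric])
  qed
  also have "\<dots> \<le> hausdorff_outer ?k ?B" by (rule hausdorff_pre_le_outer) simp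
  finally have le: "ennreal (1 / K) \<le> hausdorff_outer ?k ?B" .
  have "0 < ennreal (1 / K)" using K by simp
  then show ?thesis using le by (rule less_le_trans)
qed

text \<open>
  The reflection in the hyperplane orthogonal to \<open>n - b\<close>; if \<open>n = b\<close>, division by zero makes the
  formula the identity.  It carries every statement about coordinate hyperplanes to all hyperplanes.
\<close>

lemma reflection_exchanging:
  fixes n b :: "'a::euclidean_space"
  assumes n: "norm n = 1" and b: "norm b = 1"
  obtains R :: "'a \<Rightarrow> 'a" where "linear R" "\<And>x. norm (R x) = norm x" "\<And>x. R (R x) = x"
    "\<And>x. R x \<bullet> b = x \<bullet> n" "\<And>x. R x \<bullet> n = x \<bullet> b"
proof -
  define w where "w = n - b"
  define R where "R x = x - (2 * (x \<bullet> w) / (w \<bullet> w)) *\<^sub>R w" for x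
  have nn: "n \<bullet> n = 1" "b \<bullet> b = 1" using n b by (auto simp: norm_eq_1)
  have ww: "w \<bullet> b = - (w \<bullet> w) / 2" "w \<bullet> n = (w \<bullet> w) / 2"
    using nn by (auto simp: w_def inner_diff inner_commute)
  have lin: "linear R"
    by (rule linearI) (auto simp: R_def inner_add_left algebra_simps add_divide_distrib)
  have norm: "norm (R x) = norm x" for x
  proof -
    have "R x \<bullet> R x = x \<bullet> x"
      by (cases "w = 0") (auto simp: R_def inner_diff_left inner_diff_right inner_commute power2_eq_square)
    then show ?thesis by (simp add: norm_eq_sqrt_inner)
  qed
  have inv: "R (R x) = x" for x
    by (cases "w = 0") (auto simp: R_def inner_diff_left)
  have Rb: "R x \<bullet> b = x \<bullet> n" for x
    by (cases "w = 0") (auto simp: R_def inner_diff_left ww, auto simp: w_def inner_diff_right)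
  have Rn: "R x \<bullet> n = x \<bullet> b" for x
    by (cases "w = 0") (auto simp: R_def inner_diff_left ww, auto simp: w_def inner_diff_right)
  from that[OF lin norm inv Rb Rn] show thesis .
qed

section \<open>Hausdorff measure of hyperplanes and Lebesgue measure\<close>

definition normal_plane :: "'a::real_inner \<Rightarrow> 'a set" where
  "normal_plane n = {y. y \<bullet> n = 0}"

text \<open>
  The measure lives on the whole space, so that hyperplanes through the origin with different
  normals need no types of their own.
\<close>

definition plane_measure :: "'a::euclidean_space \<Rightarrow> 'a measure" where
  "plane_measure n = density (hausdorff_measure (DIM('a) - 1)) (indicator (normal_plane n))"

lemma closed_normal_plane: "closed (normal_plane n)"
  unfolding normal_plane_def by (intro closed_Collect_eq continuous_intros)

lemma borel_normal_plane [measurable]: "normal_plane (n::'a::euclidean_space) \<in> sets borel"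
  using closed_normal_plane by (rule borel_closed)

lemma sets_plane_measure [simp, measurable_cong]: "sets (plane_measure n) = sets borel"
  by (simp add: plane_measure_def)

lemma space_plane_measure [simp]: "space (plane_measure n) = UNIV"
  by (simp add: plane_measure_def)

lemma emeasure_plane_measure:
  fixes A :: "'a::euclidean_space set"
  assumes [measurable]: "A \<in> sets borel"
  shows "emeasure (plane_measure n) A = hausdorff_outer (DIM('a) - 1) (A \<inter> normal_plane n)"
proof -
  have "emeasure (plane_measure n) A = emeasure (hausdorff_measure (DIM('a) - 1)) (normal_plane n \<inter> A)"
    unfolding plane_measure_def by (subst emeasure_density) (auto simp: nn_integral_indicator[symmetric] indicator_inter_arith simp del: nn_integral_indicator intro!: nn_integral_cong)
  then show ?thesis by (simp add: emeasure_hausdorff_measure Int_commute)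
qed

lemma AE_plane_measure: "AE y in plane_measure n. y \<bullet> n = 0"
  unfolding plane_measure_def by (subst AE_density) (auto simp: normal_plane_def indicator_def)

lemma hausdorff_outer_normal_plane_bounded:
  fixes n :: "'a::euclidean_space"
  assumes n: "norm n = 1" and dim: "DIM('a) \<ge> 2" and bdd: "bounded A"
  shows "hausdorff_outer (DIM('a) - 1) (A \<inter> normal_plane n) < \<infinity>"
proof -
  obtain b :: 'a where b: "b \<in> Basis" using nonempty_Basis by blast
  then have nb: "norm b = 1" by simp
  obtain R :: "'a \<Rightarrow> 'a" where R: "linear R" "\<And>x. norm (R x) = norm x" "\<And>x. R (R x) = x"
    "\<And>x. R x \<bullet> b = x \<bullet> n" "\<And>x. R x \<bullet> n = x \<bullet> b" using reflection_exchanging[OF n nb] by blast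
  obtain m where m: "0 < m" "\<And>x. x \<in> A \<Longrightarrow> norm x \<le> m" using bdd bounded_pos by blast
  have "hausdorff_outer (DIM('a) - 1) (A \<inter> normal_plane n) = hausdorff_outer (DIM('a) - 1) (R ` (A \<inter> normal_plane n))"
    using R by (intro hausdorff_outer_isometry[symmetric]) (metis dist_norm linear_diff)
  also have "\<dots> \<le> hausdorff_outer (DIM('a) - 1) {x::'a. x \<bullet> b = 0 \<and> (\<forall>j\<in>Basis. \<bar>x \<bullet> j\<bar> \<le> m)}"
    using R m by (intro hausdorff_outer_mono) (auto simp: normal_plane_def intro: order_trans[OF Basis_le_norm])
  also have "\<dots> < \<infinity>" by (intro hausdorff_outer_coordinate_box_finite b dim m)
  finally show ?thesis .
qed

lemma plane_measure_bounded:
  fixes n :: "'a::euclidean_space"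
  assumes "norm n = 1" "DIM('a) \<ge> 2" "bounded A" "A \<in> sets borel"
  shows "emeasure (plane_measure n) A < \<infinity>"
  using hausdorff_outer_normal_plane_bounded[OF assms(1-3)] assms(4)
  by (simp add: emeasure_plane_measure del: infinity_ennreal_def)

lemma sigma_finite_measure_bounded:
  fixes \<mu> :: "'a::euclidean_space measure"
  assumes "sets \<mu> = sets borel" "\<And>r. emeasure \<mu> (cball 0 r) < \<infinity>"
  shows "sigma_finite_measure \<mu>"
proof
  have "(\<Union>i::nat. cball (0::'a) (real i)) = UNIV"
    using real_arch_simple by (fastforce simp: dist_norm)
  then show "\<exists>A. countable A \<and> A \<subseteq> sets \<mu> \<and> \<Union> A = space \<mu> \<and> (\<forall>a\<in>A. emeasure \<mu> a \<noteq> \<infinity>)"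
    using assms sets_eq_imp_space_eq[OF assms(1)]
    by (intro exI[of _ "range (\<lambda>i::nat. cball 0 (real i))"]) (auto simp: less_top)
qed

lemma sigma_finite_plane_measure:
  fixes n :: "'a::euclidean_space"
  assumes "norm n = 1" "DIM('a) \<ge> 2"
  shows "sigma_finite_measure (plane_measure n)"
  using assms by (intro sigma_finite_measure_bounded) (auto simp: plane_measure_bounded simp del: infinity_ennreal_def)

lemma plane_measure_isometry:
  fixes n n' :: "'a::euclidean_space"
  assumes iso: "\<And>x y. dist (R x) (R y) = dist x y" and R: "R ` normal_plane n = normal_plane n'"
    and meas [measurable]: "R \<in> borel_measurable borel"
  shows "distr (plane_measure n) borel R = plane_measure n'"
proof (rule measure_eqI)
  fix A assume "A \<in> sets (distr (plane_measure n) borel R)"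
  then have [measurable]: "A \<in> sets borel" by simp
  have "emeasure (distr (plane_measure n) borel R) A = hausdorff_outer (DIM('a) - 1) (R -` A \<inter> normal_plane n)"
    by (subst emeasure_distr) (auto simp: emeasure_plane_measure measurable_sets_borel[OF meas])
  also have "\<dots> = hausdorff_outer (DIM('a) - 1) (R ` (R -` A \<inter> normal_plane n))"
    by (intro hausdorff_outer_isometry[symmetric] iso)
  also have "R ` (R -` A \<inter> X) = A \<inter> R ` X" for X by auto
  finally show "emeasure (distr (plane_measure n) borel R) A = emeasure (plane_measure n') A"
    by (simp add: emeasure_plane_measure R)
qed auto

lemma plane_measure_translation:
  fixes n :: "'a::euclidean_space"
  assumes "w \<bullet> n = 0"
  shows "distr (plane_measure n) borel (\<lambda>x. x + w) = plane_measure n"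
proof (rule plane_measure_isometry)
  show "(\<lambda>x. x + w) ` normal_plane n = normal_plane n"
  proof
    show "(\<lambda>x. x + w) ` normal_plane n \<subseteq> normal_plane n"
      using assms by (auto simp: normal_plane_def inner_add_left)
    have "y - w \<in> normal_plane n" if "y \<in> normal_plane n" for y
      using that assms by (simp add: normal_plane_def inner_diff_left)
    then show "normal_plane n \<subseteq> (\<lambda>x. x + w) ` normal_plane n"
      by (force intro: image_eqI[of _ _ "_ - w"])
  qed
qed auto

lemma nn_integral_plane_measure_translation:
  fixes n :: "'a::euclidean_space"
  assumes "w \<bullet> n = 0" and [measurable]: "f \<in> borel_measurable borel"
  shows "(\<integral>\<^sup>+y. f (y + w) \<partial>plane_measure n) = (\<integral>\<^sup>+y. f y \<partial>plane_measure n)"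
proof -
  have "(\<integral>\<^sup>+y. f (y + w) \<partial>plane_measure n) = (\<integral>\<^sup>+y. f y \<partial>distr (plane_measure n) borel (\<lambda>x. x + w))"
    by (subst nn_integral_distr) auto
  then show ?thesis by (simp add: plane_measure_translation assms)
qed

text \<open>
  A multiple of Lebesgue measure in disguise (\<open>plane_times_line_eq_lborel\<close>); its definition makes
  Fubini's theorem available for the splitting of space into \<open>normal_plane n\<close> and the line along \<open>n\<close>.
\<close>

definition plane_times_line :: "'a::euclidean_space \<Rightarrow> 'a measure" where
  "plane_times_line n = distr (plane_measure n \<Otimes>\<^sub>M lborel) borel (\<lambda>(y, h). y + h *\<^sub>R n)"

lemma sets_plane_times_line [simp, measurable_cong]: "sets (plane_times_line n) = sets borel"
  by (simp add: plane_times_line_def)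

context
  fixes n :: "'a::euclidean_space"
  assumes n: "norm n = 1" and dim: "DIM('a) \<ge> 2"
begin

interpretation pm: sigma_finite_measure "plane_measure n"
  by (rule sigma_finite_plane_measure[OF n dim])

interpretation pl: pair_sigma_finite "plane_measure n" "lborel :: real measure" ..

lemma nn_integral_plane_times_line:
  assumes [measurable]: "f \<in> borel_measurable borel"
  shows "(\<integral>\<^sup>+x. f x \<partial>plane_times_line n) = (\<integral>\<^sup>+y. \<integral>\<^sup>+h. f (y + h *\<^sub>R n) \<partial>lborel \<partial>plane_measure n)"
  unfolding plane_times_line_def
  by (subst nn_integral_distr) (auto simp: split_beta' lborel.nn_integral_fst[symmetric])

lemma nn_integral_plane_times_line':
  assumes [measurable]: "f \<in> borel_measurable borel"
  shows "(\<integral>\<^sup>+x. f x \<partial>plane_times_line n) = (\<integral>\<^sup>+h. \<integral>\<^sup>+y. f (y + h *\<^sub>R n) \<partial>plane_measure n \<partial>lborel)"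
  unfolding nn_integral_plane_times_line[OF assms]
  by (intro pl.Fubini'[symmetric]) (auto simp: split_beta')

lemma plane_times_line_translation: "distr (plane_times_line n) borel (\<lambda>x. x + w) = plane_times_line n"
proof (rule measure_eqI)
  fix A assume "A \<in> sets (distr (plane_times_line n) borel (\<lambda>x. x + w))"
  then have [measurable]: "A \<in> sets borel" by simp
  define v where "v = w - (w \<bullet> n) *\<^sub>R n"
  have nn: "n \<bullet> n = 1" using n by (simp add: norm_eq_1)
  have v: "v \<bullet> n = 0" using nn by (simp add: v_def inner_diff_left)
  have "emeasure (distr (plane_times_line n) borel (\<lambda>x. x + w)) A = (\<integral>\<^sup>+x. indicator A x \<partial>distr (plane_times_line n) borel (\<lambda>x. x + w))"
    by simp
  also have "\<dots> = (\<integral>\<^sup>+x. indicator A (x + w) \<partial>plane_times_line n)"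
    by (rule nn_integral_distr) auto
  also have "\<dots> = (\<integral>\<^sup>+h. \<integral>\<^sup>+y. indicator A (y + h *\<^sub>R n + w) \<partial>plane_measure n \<partial>lborel)"
    by (rule nn_integral_plane_times_line') measurable
  also have "\<dots> = (\<integral>\<^sup>+h. \<integral>\<^sup>+y. indicator A (y + ((w \<bullet> n) + h) *\<^sub>R n) \<partial>plane_measure n \<partial>lborel)"
  proof (rule nn_integral_cong)
    fix h :: real
    have "(\<integral>\<^sup>+y. indicator A (y + v + ((w \<bullet> n) + h) *\<^sub>R n) \<partial>plane_measure n)
        = (\<integral>\<^sup>+y. indicator A (y + ((w \<bullet> n) + h) *\<^sub>R n) \<partial>plane_measure n)"
      by (rule nn_integral_plane_measure_translation[OF v]) auto
    then show "(\<integral>\<^sup>+y. indicator A (y + h *\<^sub>R n + w) \<partial>plane_measure n) = (\<integral>\<^sup>+y. indicator A (y + ((w \<bullet> n) + h) *\<^sub>R n) \<partial>plane_measure n)"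
      by (simp add: v_def algebra_simps)
  qed
  also have "\<dots> = (\<integral>\<^sup>+h. \<integral>\<^sup>+y. indicator A (y + h *\<^sub>R n) \<partial>plane_measure n \<partial>distr lborel borel ((+) (w \<bullet> n)))"
    by (subst nn_integral_distr) auto
  also have "\<dots> = (\<integral>\<^sup>+x. indicator A x \<partial>plane_times_line n)"
    unfolding lborel_distr_plus by (rule nn_integral_plane_times_line'[symmetric]) auto
  finally show "emeasure (distr (plane_times_line n) borel (\<lambda>x. x + w)) A = emeasure (plane_times_line n) A"
    by simp
qed auto

lemma norm_plane_plus_line: "y \<bullet> n = 0 \<Longrightarrow> (norm (y + h *\<^sub>R n))\<^sup>2 = (norm y)\<^sup>2 + h\<^sup>2"
proof -
  assume "y \<bullet> n = 0"
  moreover from this have "n \<bullet> y = 0" by (simp add: inner_commute)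
  moreover have "n \<bullet> n = 1" using n by (simp add: norm_eq_1)
  ultimately show ?thesis by (simp add: power2_norm_eq_inner inner_simps power2_eq_square[of h])
qed

text \<open>
  The right-hand side depends on \<open>n\<close> only through the distribution of the norm, which a
  reflection carries from one hyperplane to another.
\<close>

lemma plane_times_line_cball:
  "emeasure (plane_times_line n) (cball 0 r) = (\<integral>\<^sup>+y. \<integral>\<^sup>+h. indicator {..r} (sqrt ((norm y)\<^sup>2 + h\<^sup>2)) \<partial>lborel \<partial>plane_measure n)"
proof -
  have "emeasure (plane_times_line n) (cball 0 r) = (\<integral>\<^sup>+x. indicator (cball 0 r) x \<partial>plane_times_line n)"
    by (rule nn_integral_indicator[symmetric]) auto
  also have "\<dots> = (\<integral>\<^sup>+y. \<integral>\<^sup>+h. indicator (cball 0 r) (y + h *\<^sub>R n) \<partial>lborel \<partial>plane_measure n)"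
    by (rule nn_integral_plane_times_line) (intro borel_measurable_indicator borel_closed closed_cball)
  also have "\<dots> = (\<integral>\<^sup>+y. \<integral>\<^sup>+h. indicator {..r} (sqrt ((norm y)\<^sup>2 + h\<^sup>2)) \<partial>lborel \<partial>plane_measure n)"
  proof (intro nn_integral_cong_AE, use AE_plane_measure in eventually_elim, intro nn_integral_cong)
    fix y h assume "y \<bullet> n = 0"
    then have "sqrt ((norm y)\<^sup>2 + h\<^sup>2) = norm (y + h *\<^sub>R n)"
      by (metis norm_plane_plus_line norm_ge_zero real_sqrt_unique)
    then show "indicator (cball 0 r) (y + h *\<^sub>R n) = (indicator {..r} (sqrt ((norm y)\<^sup>2 + h\<^sup>2)) :: ennreal)"
      by (simp add: indicator_def)
  qed
  finally show ?thesis .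
qed

lemma plane_times_line_cball_finite: "emeasure (plane_times_line n) (cball 0 r) < \<infinity>"
proof -
  have "emeasure (plane_times_line n) (cball 0 r) = (\<integral>\<^sup>+x. indicator (cball 0 r) x \<partial>plane_times_line n)"
    by (rule nn_integral_indicator[symmetric]) auto
  also have "\<dots> = (\<integral>\<^sup>+y. \<integral>\<^sup>+h. indicator (cball 0 r) (y + h *\<^sub>R n) \<partial>lborel \<partial>plane_measure n)"
    by (rule nn_integral_plane_times_line) (intro borel_measurable_indicator borel_closed closed_cball)
  also have "\<dots> \<le> (\<integral>\<^sup>+y. \<integral>\<^sup>+h. indicator (cball 0 r) y * indicator {-r..r} h \<partial>lborel \<partial>plane_measure n)"
  proof (intro nn_integral_mono_AE, use AE_plane_measure in eventually_elim, intro nn_integral_mono)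
    fix y h assume y: "y \<bullet> n = 0"
    have "(norm y)\<^sup>2 \<le> (norm (y + h *\<^sub>R n))\<^sup>2" "\<bar>h\<bar>\<^sup>2 \<le> (norm (y + h *\<^sub>R n))\<^sup>2"
      unfolding norm_plane_plus_line[OF y] by simp_all
    then have "norm y \<le> norm (y + h *\<^sub>R n)" "\<bar>h\<bar> \<le> norm (y + h *\<^sub>R n)"
      by (simp_all only: power2_le_imp_le norm_ge_zero)
    then show "indicator (cball 0 r) (y + h *\<^sub>R n) \<le> (indicator (cball 0 r) y * indicator {-r..r} h :: ennreal)"
      by (auto simp: indicator_def)
  qed
  also have "\<dots> = (\<integral>\<^sup>+y. emeasure lborel {-r..r} * indicator (cball 0 r) y \<partial>plane_measure n)"
    by (intro nn_integral_cong) (subst nn_integral_cmult, auto simp: mult.commute)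
  also have "\<dots> = emeasure lborel {-r..r} * emeasure (plane_measure n) (cball 0 r)"
    by (subst nn_integral_cmult) (auto intro!: borel_measurable_indicator borel_closed)
  also have "\<dots> < \<infinity>"
    using plane_measure_bounded[OF n dim, of "cball 0 r"]
    by (auto simp: ennreal_mult_less_top emeasure_lborel_Icc_eq)
  finally show ?thesis .
qed

lemma sigma_finite_plane_times_line: "sigma_finite_measure (plane_times_line n)"
  by (intro sigma_finite_measure_bounded plane_times_line_cball_finite) auto

lemma plane_times_line_eq_lborel:
  assumes "A \<in> sets borel" "B \<in> sets borel"
  shows "emeasure (plane_times_line n) A * emeasure lborel B = emeasure lborel A * emeasure (plane_times_line n) B"
  by (intro translation_invariant_measure_eq sigma_finite_plane_times_line plane_times_line_translation assms) simp

end

text \<open>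
  Both measures are multiples of Lebesgue measure, and a reflection exchanging the normals
  shows that they agree on the unit ball.
\<close>

lemma plane_times_line_independent:
  fixes n n' :: "'a::euclidean_space"
  assumes n: "norm n = 1" and n': "norm n' = 1" and dim: "DIM('a) \<ge> 2"
  shows "plane_times_line n = plane_times_line n'"
proof (rule measure_eqI)
  obtain R :: "'a \<Rightarrow> 'a" where R: "linear R" "\<And>x. norm (R x) = norm x" "\<And>x. R (R x) = x"
    "\<And>x. R x \<bullet> n' = x \<bullet> n" "\<And>x. R x \<bullet> n = x \<bullet> n'" using reflection_exchanging[OF n n'] by blast
  have [measurable]: "R \<in> borel_measurable borel"
    using R(1) by (simp add: borel_measurable_continuous_onI linear_continuous_on linear_linear)
  have dR: "distr (plane_measure n) borel R = plane_measure n'"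
  proof (rule plane_measure_isometry)
    show "dist (R x) (R y) = dist x y" for x y using R by (metis dist_norm linear_diff)
    show "R ` normal_plane n = normal_plane n'"
      using R by (auto simp: normal_plane_def image_iff intro!: exI[of _ "R _"])
  qed auto
  let ?B = "cball 0 1 :: 'a set"
  have eqB: "emeasure (plane_times_line n) ?B = emeasure (plane_times_line n') ?B"
    unfolding plane_times_line_cball[OF n dim] plane_times_line_cball[OF n' dim] dR[symmetric]
    by (subst nn_integral_distr) (auto simp: R)
  fix A assume "A \<in> sets (plane_times_line n)"
  then have A: "A \<in> sets borel" by simp
  have "emeasure (plane_times_line n) A * emeasure lborel ?B = emeasure (plane_times_line n') A * emeasure lborel ?B"
    using plane_times_line_eq_lborel[OF n dim A, of ?B] plane_times_line_eq_lborel[OF n' dim A, of ?B] eqB by simp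
  moreover have "emeasure lborel ?B \<noteq> 0" "emeasure lborel ?B \<noteq> top"
  proof -
    have vol: "emeasure lborel ?B = ennreal (unit_ball_vol (real DIM('a)))"
      by (simp add: emeasure_cball)
    show "emeasure lborel ?B \<noteq> 0" "emeasure lborel ?B \<noteq> top"
      unfolding vol using unit_ball_vol_pos[OF of_nat_0_le_iff, of "DIM('a)"] by (simp_all only: ennreal_eq_0_iff not_le ennreal_neq_top not_False_eq_True)
  qed
  ultimately show "emeasure (plane_times_line n) A = emeasure (plane_times_line n') A"
    by (metis ennreal_mult_cancel_left mult.commute)
qed simp

section \<open>Orthogonal projections between hyperplanes\<close>

lemma ennreal_indicator_line:
  fixes a :: real
  shows "(\<integral>\<^sup>+h. indicator {0..1} (a + h) \<partial>lborel) = (1::ennreal)"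
proof -
  have "(\<integral>\<^sup>+h. indicator {0..1} (a + h) \<partial>lborel) = (\<integral>\<^sup>+h. indicator {0..1::real} h \<partial>distr lborel borel ((+) a))"
    by (subst nn_integral_distr) auto
  then show ?thesis by (simp add: lborel_distr_plus)
qed

lemma plane_times_line_unit_cube_pos:
  fixes n :: "'a::euclidean_space"
  assumes n: "norm n = 1" and dim: "DIM('a) \<ge> 2"
  shows "emeasure (plane_times_line n) (cbox 0 One) > 0"
proof -
  obtain b :: 'a where b: "b \<in> Basis" using nonempty_Basis by blast
  then have nb: "norm b = 1" by simp
  let ?B = "{x::'a. x \<bullet> b = 0 \<and> (\<forall>j\<in>Basis. 0 \<le> x \<bullet> j \<and> x \<bullet> j \<le> 1)}"
  have B_eq: "?B = normal_plane b \<inter> cbox 0 One"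
    by (auto simp: normal_plane_def mem_box)
  have [measurable]: "?B \<in> sets borel"
    unfolding B_eq by auto
  have "emeasure (plane_times_line n) (cbox 0 One) = (\<integral>\<^sup>+x. indicator (cbox 0 One) x \<partial>plane_times_line b)"
    by (simp add: plane_times_line_independent[OF n nb dim])
  also have "\<dots> = (\<integral>\<^sup>+y. \<integral>\<^sup>+h. indicator (cbox 0 One) (y + h *\<^sub>R b) \<partial>lborel \<partial>plane_measure b)"
    by (rule nn_integral_plane_times_line[OF nb dim]) measurable
  also have "\<dots> = (\<integral>\<^sup>+y. indicator ?B y \<partial>plane_measure b)"
  proof (intro nn_integral_cong_AE, use AE_plane_measure in eventually_elim)
    fix y :: 'a assume y: "y \<bullet> b = 0"
    have "y + h *\<^sub>R b \<in> cbox 0 One \<longleftrightarrow> y \<in> ?B \<and> h \<in> {0..1}" for h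
    proof -
      have coord: "(y + h *\<^sub>R b) \<bullet> j = (if j = b then h else y \<bullet> j)" if "j \<in> Basis" for j
        using that b y by (auto simp: inner_simps inner_Basis)
      have "y + h *\<^sub>R b \<in> cbox 0 One \<longleftrightarrow>
          (\<forall>j\<in>Basis. 0 \<le> (if j = b then h else y \<bullet> j) \<and> (if j = b then h else y \<bullet> j) \<le> 1)"
        using coord by (simp add: mem_box)
      also have "\<dots> \<longleftrightarrow> y \<in> ?B \<and> h \<in> {0..1}"
      proof
        assume *: "\<forall>j\<in>Basis. 0 \<le> (if j = b then h else y \<bullet> j) \<and> (if j = b then h else y \<bullet> j) \<le> 1"
        have "0 \<le> y \<bullet> j \<and> y \<bullet> j \<le> 1" if "j \<in> Basis" for j
          using bspec[OF * that] y by (auto split: if_splits)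
        then show "y \<in> ?B \<and> h \<in> {0..1}" using bspec[OF * b] y by simp
      qed (use y in auto)
      finally show ?thesis .
    qed
    then have "(\<integral>\<^sup>+h. indicator (cbox 0 One) (y + h *\<^sub>R b) \<partial>lborel) = (\<integral>\<^sup>+h. indicator ?B y * indicator {0..1::real} (0 + h) \<partial>lborel)"
      by (intro nn_integral_cong) (simp add: indicator_def)
    also have "\<dots> = indicator ?B y"
      by (subst nn_integral_cmult) (auto simp: ennreal_indicator_line)
    finally show "(\<integral>\<^sup>+h. indicator (cbox 0 One) (y + h *\<^sub>R b) \<partial>lborel) = (indicator ?B y :: ennreal)" .
  qed
  also have "\<dots> = emeasure (plane_measure b) ?B"
    by (subst nn_integral_indicator) auto
  also have "\<dots> = hausdorff_outer (DIM('a) - 1) ?B"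
    by (subst emeasure_plane_measure) (auto simp: B_eq Int_ac)
  also have "\<dots> > 0" by (rule hausdorff_outer_coordinate_box_pos[OF b dim])
  finally show ?thesis .
qed

text \<open>
  If the ball were a null set in the hyperplane, a ball of the ambient space would be a null
  set for \<open>plane_times_line n\<close>, which is a nonzero multiple of Lebesgue measure.
\<close>

lemma hausdorff_outer_plane_ball_pos:
  fixes n :: "'a::euclidean_space"
  assumes n: "norm n = 1" and dim: "DIM('a) \<ge> 2" and y: "y \<bullet> n = 0" and r: "r > 0"
  shows "hausdorff_outer (DIM('a) - 1) (ball y r \<inter> normal_plane n) > 0"
proof (rule ccontr)
  assume "\<not> ?thesis"
  then have zero: "emeasure (plane_measure n) (ball y r) = 0"
    by (simp add: emeasure_plane_measure not_less)
  have "emeasure (plane_times_line n) (ball y r) = (\<integral>\<^sup>+x. indicator (ball y r) x \<partial>plane_times_line n)"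
    by simp
  also have "\<dots> = (\<integral>\<^sup>+z. \<integral>\<^sup>+h. indicator (ball y r) (z + h *\<^sub>R n) \<partial>lborel \<partial>plane_measure n)"
    by (rule nn_integral_plane_times_line[OF n dim]) (intro borel_measurable_indicator borel_open open_ball)
  also have "\<dots> = (\<integral>\<^sup>+z. 0 \<partial>plane_measure n)"
  proof (intro nn_integral_cong_AE)
    have "AE z in plane_measure n. z \<notin> ball y r"
      using zero by (intro AE_not_in null_setsI) auto
    then show "AE z in plane_measure n. (\<integral>\<^sup>+h. indicator (ball y r) (z + h *\<^sub>R n) \<partial>lborel) = (0::ennreal)"
      using AE_plane_measure
    proof eventually_elim
      fix z assume z: "z \<notin> ball y r" "z \<bullet> n = 0"
      have "z + h *\<^sub>R n \<notin> ball y r" for h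
      proof -
        have "(norm ((z - y) + h *\<^sub>R n))\<^sup>2 = (norm (z - y))\<^sup>2 + h\<^sup>2"
          using z y by (intro norm_plane_plus_line[OF n dim]) (simp add: inner_diff_left)
        then have "(norm (z - y))\<^sup>2 \<le> (norm ((z - y) + h *\<^sub>R n))\<^sup>2" by simp
        then have "norm (z - y) \<le> norm ((z - y) + h *\<^sub>R n)" by (rule power2_le_imp_le) simp
        then show ?thesis using z by (auto simp: dist_norm norm_minus_commute algebra_simps)
      qed
      then show "(\<integral>\<^sup>+h. indicator (ball y r) (z + h *\<^sub>R n) \<partial>lborel) = (0::ennreal)" by simp
    qed
  qed
  finally have "emeasure (plane_times_line n) (ball y r) = 0" by simp
  moreover have "emeasure (plane_times_line n) (ball y r) * emeasure lborel (cbox 0 One :: 'a set)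
      = emeasure lborel (ball y r) * emeasure (plane_times_line n) (cbox 0 One)"
    by (intro plane_times_line_eq_lborel n dim) auto
  moreover have "emeasure lborel (ball y r) \<noteq> 0"
  proof -
    have "0 < unit_ball_vol (real DIM('a)) * r ^ DIM('a)" using r by simp
    then show ?thesis using r by (simp only: emeasure_ball less_imp_le ennreal_eq_0_iff not_le not_False_eq_True)
  qed
  ultimately show False using plane_times_line_unit_cube_pos[OF n dim] by auto
qed

lemma inner_tangential_projection: "norm n = 1 \<Longrightarrow> tangential_projection n x \<bullet> n = 0"
  by (simp add: tangential_projection_def inner_diff_left norm_eq_1)

lemma tangential_projection_diff:
  "tangential_projection n (x - y) = tangential_projection n x - tangential_projection n y"
  by (simp add: tangential_projection_def inner_diff_left algebra_simps)

lemma continuous_on_tangential_projection [continuous_intros]: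
  "continuous_on A f \<Longrightarrow> continuous_on A (\<lambda>x. tangential_projection n (f x))"
  unfolding tangential_projection_def by (intro continuous_intros)

text \<open>
  The Jacobian of the projection between hyperplanes is the cosine of the angle between the
  normals.  Both sides are the volume of the oblique prism \<open>Z\<close> with base \<open>B\<close> and edge \<open>n\<close>: sliced
  along \<open>n\<close> it is a unit segment over every point of the projection of \<open>B\<close>, and sliced along
  \<open>n0\<close> it is a family of translates of \<open>B\<close> of total height \<open>n \<bullet> n0\<close>.
\<close>

lemma hausdorff_outer_projection_of_plane:
  fixes n n0 :: "'a::euclidean_space"
  assumes n: "norm n = 1" and n0: "norm n0 = 1" and dim: "DIM('a) \<ge> 2" and c: "n \<bullet> n0 > 0"
    and [measurable]: "B \<in> sets borel" and B: "B \<subseteq> normal_plane n0"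
  shows "hausdorff_outer (DIM('a) - 1) (tangential_projection n ` B)
    = ennreal (n \<bullet> n0) * hausdorff_outer (DIM('a) - 1) B"
proof -
  define c where "c = n \<bullet> n0"
  have c0: "c > 0" "n0 \<bullet> n = c" using c by (auto simp: c_def inner_commute)
  have nn: "n \<bullet> n = 1" "n0 \<bullet> n0 = 1" using n n0 by (auto simp: norm_eq_1)
  define E where "E z = z - ((z \<bullet> n0) / c) *\<^sub>R n" for z
  have [measurable]: "E \<in> borel_measurable borel" unfolding E_def by measurable
  \<comment> \<open>\<open>E\<close> projects along \<open>n\<close> to the hyperplane orthogonal to \<open>n0\<close>, so \<open>Z\<close> consists of the \<open>b + r n\<close>
    with \<open>b \<in> B\<close> and \<open>0 \<le> r \<le> 1\<close>.\<close>
  define Z where "Z = {z. (z \<bullet> n0) / c \<in> {0..1} \<and> E z \<in> B}"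
  have [measurable]: "Z \<in> sets borel" unfolding Z_def by measurable
  have EB: "E -` B \<inter> normal_plane n = tangential_projection n ` B"
  proof
    have "tangential_projection n (E y) = y" if "y \<in> normal_plane n" for y
      using that nn by (simp add: E_def tangential_projection_def normal_plane_def inner_diff_left)
    then show "E -` B \<inter> normal_plane n \<subseteq> tangential_projection n ` B"
      by (auto simp: image_iff) (metis)
    have "E (tangential_projection n x) = x" if "x \<bullet> n0 = 0" for x
      using that c0 by (simp add: E_def tangential_projection_def inner_diff_left c_def)
    then show "tangential_projection n ` B \<subseteq> E -` B \<inter> normal_plane n"
      using B n by (auto simp: normal_plane_def inner_tangential_projection subset_iff)
  qed
  have "emeasure (plane_times_line n) Z = (\<integral>\<^sup>+x. indicator Z x \<partial>plane_times_line n)"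
    by simp
  also have "\<dots> = (\<integral>\<^sup>+y. \<integral>\<^sup>+h. indicator Z (y + h *\<^sub>R n) \<partial>lborel \<partial>plane_measure n)"
    by (rule nn_integral_plane_times_line[OF n dim]) measurable
  also have "\<dots> = (\<integral>\<^sup>+y. indicator (E -` B) y \<partial>plane_measure n)"
  proof (rule nn_integral_cong)
    fix y
    have "y + h *\<^sub>R n \<in> Z \<longleftrightarrow> E y \<in> B \<and> (y \<bullet> n0) / c + h \<in> {0..1}" for h
    proof -
      have quot: "((y + h *\<^sub>R n) \<bullet> n0) / c = (y \<bullet> n0) / c + h"
        using c0 by (simp add: inner_add_left c_def[symmetric] add_divide_distrib)
      have "E (y + h *\<^sub>R n) = E y" unfolding E_def quot by (simp add: scaleR_add_left)
      then show ?thesis unfolding Z_def mem_Collect_eq quot by auto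
    qed
    then have "(\<integral>\<^sup>+h. indicator Z (y + h *\<^sub>R n) \<partial>lborel) = (\<integral>\<^sup>+h. indicator (E -` B) y * indicator {0..1::real} ((y \<bullet> n0) / c + h) \<partial>lborel)"
      by (intro nn_integral_cong) (simp add: indicator_def)
    also have "\<dots> = indicator (E -` B) y"
      by (subst nn_integral_cmult) (auto simp: ennreal_indicator_line)
    finally show "(\<integral>\<^sup>+h. indicator Z (y + h *\<^sub>R n) \<partial>lborel) = (indicator (E -` B) y :: ennreal)" .
  qed
  also have "\<dots> = hausdorff_outer (DIM('a) - 1) (tangential_projection n ` B)"
  proof -
    have m: "E -` B \<in> sets borel" by (rule measurable_sets_borel) measurable
    show ?thesis unfolding EB[symmetric] emeasure_plane_measure[OF m, symmetric]
      using m by (intro nn_integral_indicator) simp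
  qed
  finally have 1: "emeasure (plane_times_line n) Z = hausdorff_outer (DIM('a) - 1) (tangential_projection n ` B)" .
  have "emeasure (plane_times_line n0) Z = (\<integral>\<^sup>+x. indicator Z x \<partial>plane_times_line n0)"
    by simp
  also have "\<dots> = (\<integral>\<^sup>+h. \<integral>\<^sup>+y. indicator Z (y + h *\<^sub>R n0) \<partial>plane_measure n0 \<partial>lborel)"
    by (rule nn_integral_plane_times_line'[OF n0 dim]) measurable
  also have "\<dots> = (\<integral>\<^sup>+h. indicator {0..c} h * hausdorff_outer (DIM('a) - 1) B \<partial>lborel)"
  proof (rule nn_integral_cong)
    fix h :: real
    define w where "w = h *\<^sub>R n0 - (h / c) *\<^sub>R n"
    have w: "w \<bullet> n0 = 0" using nn c0 by (simp add: w_def inner_simps c_def[symmetric])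
    have "(\<integral>\<^sup>+y. indicator Z (y + h *\<^sub>R n0) \<partial>plane_measure n0) = (\<integral>\<^sup>+y. indicator {0..c} h * indicator B (y + w) \<partial>plane_measure n0)"
    proof (intro nn_integral_cong_AE, use AE_plane_measure in eventually_elim)
      fix y assume y: "y \<bullet> n0 = 0"
      have "(y + h *\<^sub>R n0) \<bullet> n0 = h" using y nn by (simp add: inner_simps)
      moreover from this have "E (y + h *\<^sub>R n0) = y + w" by (simp add: E_def w_def)
      ultimately show "indicator Z (y + h *\<^sub>R n0) = (indicator {0..c} h * indicator B (y + w) :: ennreal)"
        using c0 by (auto simp: Z_def indicator_def field_simps)
    qed
    also have "\<dots> = indicator {0..c} h * (\<integral>\<^sup>+y. indicator B (y + w) \<partial>plane_measure n0)"
      by (rule nn_integral_cmult) auto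
    also have "(\<integral>\<^sup>+y. indicator B (y + w) \<partial>plane_measure n0) = (\<integral>\<^sup>+y. indicator B y \<partial>plane_measure n0)"
      by (rule nn_integral_plane_measure_translation[OF w]) auto
    also have "\<dots> = hausdorff_outer (DIM('a) - 1) B"
      using B by (simp add: emeasure_plane_measure Int_absorb2)
    finally show "(\<integral>\<^sup>+y. indicator Z (y + h *\<^sub>R n0) \<partial>plane_measure n0) = indicator {0..c} h * hausdorff_outer (DIM('a) - 1) B" .
  qed
  also have "\<dots> = ennreal c * hausdorff_outer (DIM('a) - 1) B"
    using c0 by (subst nn_integral_multc) auto
  finally show ?thesis
    using 1 plane_times_line_independent[OF n n0 dim] by (simp add: c_def)
qed

text \<open>
  The inverse is continuous on the compact image, so images of Borel sets are preimages.
\<close>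

lemma borel_injective_image_of_compact:
  fixes f :: "'a::euclidean_space \<Rightarrow> 'b::euclidean_space"
  assumes K: "compact K" and f: "continuous_on K f" "inj_on f K" and A: "A \<in> sets borel" "A \<subseteq> K"
  shows "f ` A \<in> sets borel"
proof -
  let ?g = "the_inv_into K f"
  have fK: "f ` K \<in> sets borel"
    using compact_continuous_image[OF f(1) K] by (auto dest: compact_imp_closed)
  have "continuous_on (f ` K) ?g"
    by (rule continuous_on_inv_into[OF f(1) K f(2)])
  then have "?g \<in> borel_measurable (restrict_space borel (f ` K))"
    by (rule borel_measurable_continuous_on_restrict)
  from measurable_sets[OF this A(1)] have "?g -` A \<inter> f ` K \<in> sets borel"
    using fK by (simp add: sets_restrict_space_iff space_restrict_space)
  moreover have "?g -` A \<inter> f ` K = f ` A"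
    using f(2) A(2) by (auto simp: image_iff) (metis the_inv_into_f_f subsetD)+
  ultimately show ?thesis by simp
qed

lemma norm_tangential_projection_square:
  assumes "norm n = 1"
  shows "(norm (tangential_projection n x))\<^sup>2 = (norm x)\<^sup>2 - (x \<bullet> n)\<^sup>2"
proof -
  have nn: "n \<bullet> n = 1" using assms by (simp add: norm_eq_1)
  have "tangential_projection n x \<bullet> tangential_projection n x = x \<bullet> x - (x \<bullet> n) * (x \<bullet> n)"
    by (simp add: tangential_projection_def inner_diff_left inner_diff_right inner_commute[of n x] nn)
  then show ?thesis by (simp add: power2_norm_eq_inner power2_eq_square[of "x \<bullet> n"])
qed

lemma norm_tangential_projection_le:
  "norm n = 1 \<Longrightarrow> norm (tangential_projection n x) \<le> norm x"
proof -
  assume n: "norm n = 1"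
  have "(norm (tangential_projection n x))\<^sup>2 \<le> (norm x)\<^sup>2"
    by (simp add: norm_tangential_projection_square[OF n])
  then show ?thesis by (rule power2_le_imp_le) simp
qed

text \<open>
  The cosine of the angle between the hyperplanes is the smallest singular value of the
  projection of one to the other.
\<close>

lemma norm_tangential_projection_ge:
  assumes n: "norm n = 1" and n0: "norm n0 = 1" and x: "x \<bullet> n0 = 0" and c: "n \<bullet> n0 > 0"
  shows "(n \<bullet> n0) * norm x \<le> norm (tangential_projection n x)"
proof -
  have nn: "n \<bullet> n = 1" "n0 \<bullet> n0 = 1" using n n0 by (auto simp: norm_eq_1)
  define u where "u = n - (n \<bullet> n0) *\<^sub>R n0"
  have "x \<bullet> n = x \<bullet> u" using x by (simp add: u_def inner_diff_right)
  then have "(x \<bullet> n)\<^sup>2 \<le> (x \<bullet> x) * (u \<bullet> u)" using Cauchy_Schwarz_ineq[of x u] by simp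
  also have "u \<bullet> u = 1 - (n \<bullet> n0)\<^sup>2"
    using nn by (simp add: u_def inner_simps inner_commute power2_eq_square)
  finally have "(x \<bullet> n)\<^sup>2 \<le> (norm x)\<^sup>2 - ((n \<bullet> n0) * norm x)\<^sup>2"
    by (simp add: power2_norm_eq_inner power_mult_distrib algebra_simps)
  with norm_tangential_projection_square[OF n, of x] have "((n \<bullet> n0) * norm x)\<^sup>2 \<le> (norm (tangential_projection n x))\<^sup>2" by linarith
  then show ?thesis by (rule power2_le_imp_le) simp
qed

lemma flat_norm_le:
  assumes n0: "norm n0 = 1" and e: "\<bar>n0 \<bullet> w\<bar> \<le> e * norm w"
  shows "(1 - e) * norm w \<le> norm (tangential_projection n0 w)"
proof -
  have "w = tangential_projection n0 w + (w \<bullet> n0) *\<^sub>R n0" by (simp add: tangential_projection_def)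
  then have "norm w \<le> norm (tangential_projection n0 w) + norm ((w \<bullet> n0) *\<^sub>R n0)"
    by (metis norm_triangle_ineq)
  then show ?thesis using e n0 by (simp add: inner_commute algebra_simps)
qed

text \<open>
  For a vector \<open>w\<close> at a small angle to the hyperplane orthogonal to \<open>n0\<close>, projecting along \<open>n\<close> at
  once differs little from projecting along \<open>n0\<close> first.
\<close>

lemma flat_projection_bounds:
  assumes n: "norm n = 1" and n0: "norm n0 = 1" and c: "n \<bullet> n0 > 0"
    and e: "0 \<le> e" "e < 1" "\<bar>n0 \<bullet> w\<bar> \<le> e * norm w"
  defines "\<eta> \<equiv> e / ((n \<bullet> n0) * (1 - e))"
  shows "norm (tangential_projection n w) \<le> (1 + \<eta>) * norm (tangential_projection n (tangential_projection n0 w))"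
    and "(1 - \<eta>) * norm (tangential_projection n (tangential_projection n0 w)) \<le> norm (tangential_projection n w)"
proof -
  let ?P = "tangential_projection n" and ?Q = "tangential_projection n0"
  have "(n \<bullet> n0) * ((1 - e) * norm w) \<le> (n \<bullet> n0) * norm (?Q w)"
    using c by (intro mult_left_mono flat_norm_le n0 e) auto
  also have "\<dots> \<le> norm (?P (?Q w))"
    using inner_tangential_projection[OF n0] by (intro norm_tangential_projection_ge n n0 c)
  finally have "norm w \<le> norm (?P (?Q w)) / ((n \<bullet> n0) * (1 - e))"
    using c e by (subst pos_le_divide_eq) (auto simp: algebra_simps)
  then have "e * norm w \<le> e * (norm (?P (?Q w)) / ((n \<bullet> n0) * (1 - e)))"
    by (intro mult_left_mono e)
  then have ew: "e * norm w \<le> \<eta> * norm (?P (?Q w))" by (simp add: \<eta>_def)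
  have "?P (w - ?Q w) = (w \<bullet> n0) *\<^sub>R ?P n0"
    by (simp add: tangential_projection_def algebra_simps)
  then have "norm (?P w - ?P (?Q w)) \<le> \<bar>n0 \<bullet> w\<bar> * 1"
    using mult_left_le[of "norm (?P n0)" "\<bar>n0 \<bullet> w\<bar>"] norm_tangential_projection_le[OF n, of n0] n0
    by (simp add: tangential_projection_diff[symmetric] inner_commute)
  then have "norm (?P w - ?P (?Q w)) \<le> \<eta> * norm (?P (?Q w))" using e ew by linarith
  then show "norm (?P w) \<le> (1 + \<eta>) * norm (?P (?Q w))" "(1 - \<eta>) * norm (?P (?Q w)) \<le> norm (?P w)"
    using norm_triangle_ineq2[of "?P w" "?P (?Q w)"] norm_triangle_ineq3[of "?P w" "?P (?Q w)"]
    by (auto simp: algebra_simps)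
qed

text \<open>
  The choice of \<open>e\<close> makes the relative error of \<open>flat_projection_bounds\<close> equal to \<open>1/2\<close>.
\<close>

lemma inverse_projection_bound:
  assumes n: "norm n = 1" and n0: "norm n0 = 1" and c: "n0 \<bullet> n > 0"
  defines "e \<equiv> (n0 \<bullet> n) / ((n0 \<bullet> n) + 2)"
  assumes w: "\<bar>n0 \<bullet> w\<bar> \<le> e * norm w"
  shows "norm w \<le> 2 / ((n0 \<bullet> n) * (1 - e)) * norm (tangential_projection n w)"
proof -
  define c where "c = n0 \<bullet> n"
  have c: "0 < c" "n \<bullet> n0 = c" using c by (auto simp: c_def inner_commute)
  have e: "0 < e" "e < 1" "e * (c + 2) = c" using c by (auto simp: e_def c_def[symmetric])
  define \<eta> where "\<eta> = e / (c * (1 - e))"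
  have "c * (1 - e) = 2 * e" using e(3) by (simp add: algebra_simps)
  then have eta: "\<eta> = 1/2" using e by (simp add: \<eta>_def)
  let ?P = "tangential_projection n" and ?Q = "tangential_projection n0"
  have "c * ((1 - e) * norm w) \<le> c * norm (?Q w)"
    using c flat_norm_le[OF n0 w] by (intro mult_left_mono) auto
  also have "\<dots> \<le> norm (?P (?Q w))"
    using norm_tangential_projection_ge[OF n n0 inner_tangential_projection[OF n0]] c by simp
  also have "\<dots> \<le> 2 * norm (?P w)"
    using flat_projection_bounds(2)[OF n n0 _ _ _ w] c e eta by (simp add: \<eta>_def)
  finally show "norm w \<le> 2 / ((n0 \<bullet> n) * (1 - e)) * norm (?P w)"
    using c e by (simp add: pos_le_divide_eq mult_ac c_def[symmetric])
qed

text \<open>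
  A flat set is compared with its projection to the hyperplane orthogonal to \<open>n0\<close>, to which the
  exact Jacobian applies; both bounds tend to equality as \<open>e\<close> tends to \<open>0\<close>.
\<close>

lemma hausdorff_outer_projection_of_flat:
  fixes n n0 :: "'a::euclidean_space"
  assumes n: "norm n = 1" and n0: "norm n0 = 1" and dim: "DIM('a) \<ge> 2" and c: "n \<bullet> n0 > 0"
    and e: "0 < e" "e < 1" and K: "compact K"
    and flat: "\<And>x y. x \<in> K \<Longrightarrow> y \<in> K \<Longrightarrow> \<bar>n0 \<bullet> (x - y)\<bar> \<le> e * norm (x - y)"
    and A: "A \<in> sets borel" "A \<subseteq> K"
  defines "\<eta> \<equiv> e / ((n \<bullet> n0) * (1 - e))" and "k \<equiv> DIM('a) - 1"
  assumes eta: "\<eta> < 1"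
  shows "hausdorff_outer k (tangential_projection n ` A) \<le> ennreal ((1 + \<eta>) ^ k * (n \<bullet> n0)) * hausdorff_outer k A"
    and "ennreal (n \<bullet> n0) * hausdorff_outer k A \<le> ennreal ((1 / ((1 - e) * (1 - \<eta>))) ^ k) * hausdorff_outer k (tangential_projection n ` A)"
proof -
  let ?P = "tangential_projection n" and ?Q = "tangential_projection n0"
  have eta0: "0 \<le> \<eta>" using e c by (simp add: \<eta>_def)
  have distQ: "(1 - e) * dist x y \<le> dist (?Q x) (?Q y)" if "x \<in> K" "y \<in> K" for x y
    using flat_norm_le[OF n0 flat[OF that]] by (simp add: dist_norm tangential_projection_diff)
  have injQ: "inj_on ?Q K"
  proof (rule inj_onI)
    fix x y assume "x \<in> K" "y \<in> K" "?Q x = ?Q y"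
    then have "(1 - e) * dist x y \<le> 0" using distQ[of x y] by simp
    then show "x = y" using e by (simp add: mult_le_0_iff)
  qed
  have QA: "?Q ` A \<in> sets borel"
    by (rule borel_injective_image_of_compact[OF K _ injQ A]) (intro continuous_intros)
  have QAp: "?Q ` A \<subseteq> normal_plane n0"
    using inner_tangential_projection[OF n0] by (auto simp: normal_plane_def)
  have lin: "hausdorff_outer k (?P ` ?Q ` A) = ennreal (n \<bullet> n0) * hausdorff_outer k (?Q ` A)"
    unfolding k_def by (rule hausdorff_outer_projection_of_plane[OF n n0 dim c QA QAp])
  have "hausdorff_outer k (?P ` A) \<le> ennreal ((1 + \<eta>) ^ k) * hausdorff_outer k ((\<lambda>x. ?P (?Q x)) ` A)"
  proof (rule hausdorff_outer_compare_images)
    show "dist (?P x) (?P y) \<le> (1 + \<eta>) * dist (?P (?Q x)) (?P (?Q y))" if "x \<in> A" "y \<in> A" for x y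
      using flat_projection_bounds(1)[OF n n0 c, of e "x - y"] that A flat e
      by (auto simp: dist_norm tangential_projection_diff \<eta>_def subset_iff)
  qed (use eta0 in auto)
  also have "(\<lambda>x. ?P (?Q x)) ` A = ?P ` ?Q ` A" by (simp add: image_image)
  also have "ennreal ((1 + \<eta>) ^ k) * hausdorff_outer k (?P ` ?Q ` A) \<le> ennreal ((1 + \<eta>) ^ k) * (ennreal (n \<bullet> n0) * hausdorff_outer k A)"
  proof -
    have "hausdorff_outer k (?Q ` A) \<le> ennreal (1 ^ k) * hausdorff_outer k A"
      using norm_tangential_projection_le[OF n0]
      by (intro hausdorff_outer_lipschitz) (auto simp: dist_norm tangential_projection_diff[symmetric])
    then show ?thesis unfolding lin by (intro mult_left_mono) auto
  qed
  also have "\<dots> = ennreal ((1 + \<eta>) ^ k * (n \<bullet> n0)) * hausdorff_outer k A"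
    using c eta0 by (simp add: ennreal_mult mult.assoc)
  finally show "hausdorff_outer k (?P ` A) \<le> ennreal ((1 + \<eta>) ^ k * (n \<bullet> n0)) * hausdorff_outer k A" .
  have "hausdorff_outer k (id ` A) \<le> ennreal ((1 / (1 - e)) ^ k) * hausdorff_outer k (?Q ` A)"
    using distQ e A by (intro hausdorff_outer_compare_images) (auto simp: field_simps subset_iff)
  then have "ennreal (n \<bullet> n0) * hausdorff_outer k A \<le> ennreal (n \<bullet> n0) * (ennreal ((1 / (1 - e)) ^ k) * hausdorff_outer k (?Q ` A))"
    by (intro mult_left_mono) auto
  also have "\<dots> = ennreal ((1 / (1 - e)) ^ k) * hausdorff_outer k (?P ` ?Q ` A)"
    unfolding lin by (simp add: mult_ac)
  also have "\<dots> \<le> ennreal ((1 / (1 - e)) ^ k) * (ennreal ((1 / (1 - \<eta>)) ^ k) * hausdorff_outer k (?P ` A))"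
  proof -
    have "hausdorff_outer k ((\<lambda>x. ?P (?Q x)) ` A) \<le> ennreal ((1 / (1 - \<eta>)) ^ k) * hausdorff_outer k (?P ` A)"
    proof (rule hausdorff_outer_compare_images)
      show "dist (?P (?Q x)) (?P (?Q y)) \<le> 1 / (1 - \<eta>) * dist (?P x) (?P y)" if "x \<in> A" "y \<in> A" for x y
      proof -
        have "(1 - \<eta>) * dist (?P (?Q x)) (?P (?Q y)) \<le> dist (?P x) (?P y)"
          using flat_projection_bounds(2)[OF n n0 c, of e "x - y", folded \<eta>_def] that A flat[of x y] e
          by (simp add: dist_norm tangential_projection_diff subset_iff)
        then have "dist (?P (?Q x)) (?P (?Q y)) \<le> dist (?P x) (?P y) / (1 - \<eta>)"
          using eta by (simp add: pos_le_divide_eq mult.commute)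
        then show ?thesis by simp
      qed
    qed (use eta in auto)
    then show ?thesis by (intro mult_left_mono) (auto simp: image_image)
  qed
  also have "\<dots> = ennreal ((1 / ((1 - e) * (1 - \<eta>))) ^ k) * hausdorff_outer k (?P ` A)"
    using e eta by (simp add: mult.assoc[symmetric] ennreal_mult[symmetric] power_mult_distrib power_divide)
  finally show "ennreal (n \<bullet> n0) * hausdorff_outer k A \<le> ennreal ((1 / ((1 - e) * (1 - \<eta>))) ^ k) * hausdorff_outer k (?P ` A)" .
qed

section \<open>Area of a closed oriented hypersurface\<close>

lemma ennreal_le_if_le_mult:
  fixes a b :: ennreal
  assumes le: "\<And>t. 1 < t \<Longrightarrow> a \<le> ennreal t * b"
  shows "a \<le> b"
proof (cases "b = top")
  case False
  then obtain b' where b': "0 \<le> b'" "b = ennreal b'" by (cases b) auto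
  have "a \<le> ennreal (2 * b')" using le[of 2] b' by (simp add: ennreal_mult')
  then have "a \<noteq> top" by (metis ennreal_neq_top top.extremum_uniqueI)
  then obtain a' where a': "0 \<le> a'" "a = ennreal a'" by (cases a) auto
  have "z * a' \<le> b'" if z: "0 < z" "z < 1" for z
  proof -
    have nn: "0 \<le> 1 / z * b'" using z b' by simp
    have "ennreal (1 / z) * ennreal b' = ennreal (1 / z * b')"
      using z b' by (intro ennreal_mult[symmetric]) auto
    then have "ennreal a' \<le> ennreal (1 / z * b')"
      using le[of "1 / z"] z a'(2) b'(2) by (metis less_divide_eq_1_pos)
    then have "a' \<le> 1 / z * b'" using nn by (simp only: ennreal_le_iff)
    then show ?thesis using z by (simp add: field_simps)
  qed
  then have "a' \<le> b'" by (rule field_le_mult_one_interval)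
  then show ?thesis using a' b' by (simp add: ennreal_leI)
qed simp

lemma finite_hausdorff_outer_compact:
  assumes K: "compact K" and loc: "\<And>p. p \<in> K \<Longrightarrow> \<exists>r>0. hausdorff_outer k (K \<inter> ball p r) < \<infinity>"
  shows "hausdorff_outer k K < \<infinity>"
proof -
  obtain r where r: "\<And>p. p \<in> K \<Longrightarrow> 0 < r p \<and> hausdorff_outer k (K \<inter> ball p (r p)) < \<infinity>"
    using loc by metis
  have "K \<subseteq> (\<Union>p\<in>K. ball p (r p))" using r by auto
  then obtain F where F: "F \<subseteq> K" "finite F" "K \<subseteq> (\<Union>p\<in>F. ball p (r p))"
    using compactE_image[OF K, of K "\<lambda>p. ball p (r p)"] by auto
  have "hausdorff_outer k (K \<inter> (\<Union>p\<in>F'. ball p (r p))) < \<infinity>" if "finite F'" "F' \<subseteq> K" for F'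
    using that
  proof (induction F')
    case (insert p F')
    have "hausdorff_outer k (K \<inter> (\<Union>p\<in>insert p F'. ball p (r p)))
        \<le> hausdorff_outer k (K \<inter> ball p (r p)) + hausdorff_outer k (K \<inter> (\<Union>p\<in>F'. ball p (r p)))"
      using hausdorff_outer_subadditive by (simp add: Int_Un_distrib)
    also have "\<dots> < \<infinity>" using insert r[of p] by simp
    finally show ?case .
  qed (simp add: hausdorff_outer_empty)
  from this[OF F(2,1)] show ?thesis using F(3) by (simp add: Int_absorb2)
qed

text \<open>
  A compact hypersurface of class \<open>C\<^sup>1\<close> without boundary, described without charts by its unit
  normal field: \<open>flat\<close> is strict differentiability, and \<open>full\<close> says that the projection along a
  transversal direction reaches a whole neighbourhood, which excludes boundary points.
\<close>

locale oriented_hypersurface =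
  fixes S :: "'a::euclidean_space set" and N :: "'a \<Rightarrow> 'a"
  assumes dim: "DIM('a) \<ge> 2"
    and compact: "compact S"
    and cont: "continuous_on S N"
    and unit: "\<And>p. p \<in> S \<Longrightarrow> norm (N p) = 1"
    and flat: "\<And>p e. p \<in> S \<Longrightarrow> 0 < e \<Longrightarrow>
      \<exists>r>0. \<forall>x\<in>S \<inter> ball p r. \<forall>y\<in>S \<inter> ball p r. \<bar>N p \<bullet> (x - y)\<bar> \<le> e * norm (x - y)"
    and full: "\<And>p n r. p \<in> S \<Longrightarrow> norm n = 1 \<Longrightarrow> N p \<bullet> n > 0 \<Longrightarrow> 0 < r \<Longrightarrow>
      \<exists>\<rho>>0. \<forall>y\<in>normal_plane n \<inter> ball (tangential_projection n p) \<rho>.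
        \<exists>x\<in>S \<inter> ball p r. tangential_projection n x = y"
begin

abbreviation area :: "'a set \<Rightarrow> ennreal" where
  "area \<equiv> hausdorff_outer (DIM('a) - 1)"

abbreviation H :: "'a measure" where
  "H \<equiv> hausdorff_measure (DIM('a) - 1)"

lemma S_borel [measurable]: "S \<in> sets borel"
  using compact by (simp add: borel_closed compact_imp_closed)

lemma finite_area: "area S < \<infinity>"
proof (rule finite_hausdorff_outer_compact[OF compact])
  fix p assume p: "p \<in> S"
  then obtain r where r: "r > 0"
    "\<And>x y. x \<in> S \<inter> ball p r \<Longrightarrow> y \<in> S \<inter> ball p r \<Longrightarrow> \<bar>N p \<bullet> (x - y)\<bar> \<le> (1/2) * norm (x - y)"
    using flat[OF p, of "1/2"] by auto
  let ?A = "S \<inter> ball p r" and ?Q = "tangential_projection (N p)"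
  have "area (id ` ?A) \<le> ennreal (2 ^ (DIM('a) - 1)) * area (?Q ` ?A)"
  proof (rule hausdorff_outer_compare_images)
    fix x y assume "x \<in> ?A" "y \<in> ?A"
    from flat_norm_le[OF unit[OF p] r(2)[OF this]]
    show "dist (id x) (id y) \<le> 2 * dist (?Q x) (?Q y)"
      by (simp add: dist_norm tangential_projection_diff)
  qed simp
  also have "area (?Q ` ?A) = area (?Q ` ?A \<inter> normal_plane (N p))"
    using inner_tangential_projection[OF unit[OF p]]
    by (intro arg_cong[of _ _ area]) (auto simp: normal_plane_def)
  also have "ennreal (2 ^ (DIM('a) - 1)) * \<dots> < \<infinity>"
  proof -
    have "bounded (?Q ` ?A)"
    proof (rule bounded_subset)
      show "bounded (?Q ` S)"
        by (intro compact_imp_bounded compact_continuous_image compact continuous_intros)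
    qed auto
    then have "area (?Q ` ?A \<inter> normal_plane (N p)) < \<infinity>"
      by (rule hausdorff_outer_normal_plane_bounded[OF unit[OF p] dim])
    then show ?thesis by (simp add: ennreal_mult_less_top)
  qed
  finally show "\<exists>r>0. area (S \<inter> ball p r) < \<infinity>"
    using r(1) by auto
qed

lemma positive_area:
  assumes "S \<noteq> {}"
  shows "area S > 0"
proof -
  obtain p where p: "p \<in> S" using assms by blast
  let ?P = "tangential_projection (N p)"
  have np: "N p \<bullet> N p > 0" using unit[OF p] by (simp add: norm_eq_1)
  obtain \<rho> where \<rho>: "\<rho> > 0" "\<forall>y\<in>normal_plane (N p) \<inter> ball (?P p) \<rho>. \<exists>x\<in>S \<inter> ball p 1. ?P x = y"
    using full[OF p unit[OF p] np, of 1] by auto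
  have "0 < area (ball (?P p) \<rho> \<inter> normal_plane (N p))"
    by (intro hausdorff_outer_plane_ball_pos unit p dim \<rho> inner_tangential_projection)
  also have "\<dots> \<le> area (?P ` S)"
  proof (rule hausdorff_outer_mono, rule subsetI)
    fix y assume "y \<in> ball (?P p) \<rho> \<inter> normal_plane (N p)"
    then obtain x where "x \<in> S" "?P x = y" using \<rho>(2) by blast
    then show "y \<in> ?P ` S" by blast
  qed
  also have "\<dots> \<le> ennreal (1 ^ (DIM('a) - 1)) * area S"
  proof (rule hausdorff_outer_lipschitz)
    show "dist (?P x) (?P y) \<le> 1 * dist x y" for x y
      using norm_tangential_projection_le[OF unit[OF p], of "x - y"]
      by (simp add: dist_norm tangential_projection_diff)
  qed simp
  finally show ?thesis by simp
qed

lemma inverse_projection_lipschitz: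
  assumes p: "p \<in> S" and n: "norm n = 1" and np: "N p \<bullet> n > 0"
  obtains r C where "0 < r" "0 < C"
    "\<And>x y. x \<in> S \<inter> ball p r \<Longrightarrow> y \<in> S \<inter> ball p r \<Longrightarrow>
      norm (x - y) \<le> C * norm (tangential_projection n x - tangential_projection n y)"
proof -
  define e where "e = (N p \<bullet> n) / ((N p \<bullet> n) + 2)"
  have e: "0 < e" "e < 1" using np by (auto simp: e_def)
  obtain r where r: "r > 0"
    "\<And>x y. x \<in> S \<inter> ball p r \<Longrightarrow> y \<in> S \<inter> ball p r \<Longrightarrow> \<bar>N p \<bullet> (x - y)\<bar> \<le> e * norm (x - y)"
    using flat[OF p e(1)] by auto
  show thesis
  proof (rule that[OF r(1), of "2 / ((N p \<bullet> n) * (1 - e))"])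
    show "0 < 2 / ((N p \<bullet> n) * (1 - e))" using np e by simp
    fix x y assume "x \<in> S \<inter> ball p r" "y \<in> S \<inter> ball p r"
    from inverse_projection_bound[OF n unit[OF p] np r(2)[OF this, unfolded e_def]]
    show "norm (x - y) \<le> 2 / ((N p \<bullet> n) * (1 - e)) * norm (tangential_projection n x - tangential_projection n y)"
      by (simp add: e_def tangential_projection_diff)
  qed
qed

lemma normal_continuous:
  assumes "p \<in> S" "a < N p \<bullet> n" "N p \<bullet> n < b"
  shows "\<exists>r>0. \<forall>x\<in>S \<inter> ball p r. a < N x \<bullet> n \<and> N x \<bullet> n < b"
proof -
  have "continuous_on S (\<lambda>x. N x \<bullet> n)" using cont by (intro continuous_intros)
  then have "((\<lambda>x. N x \<bullet> n) \<longlongrightarrow> N p \<bullet> n) (at p within S)"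
    using assms(1) by (simp add: continuous_on)
  then have "eventually (\<lambda>x. a < N x \<bullet> n \<and> N x \<bullet> n < b) (at p within S)"
    using assms by (intro eventually_conj order_tendstoD)
  then obtain r where r: "r > 0" "\<And>x. x \<in> S \<Longrightarrow> x \<noteq> p \<Longrightarrow> dist x p < r \<Longrightarrow> a < N x \<bullet> n \<and> N x \<bullet> n < b"
    unfolding eventually_at by blast
  have "a < N x \<bullet> n \<and> N x \<bullet> n < b" if "x \<in> S \<inter> ball p r" for x
    using r(2)[of x] that assms by (cases "x = p") (simp_all add: dist_commute)
  with r(1) show ?thesis by blast
qed

definition flux :: "'a \<Rightarrow> 'a set \<Rightarrow> ennreal" where
  "flux n A = (\<integral>\<^sup>+x. ennreal (N x \<bullet> n) * indicator A x \<partial>H)"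

lemma measurable_normal_component:
  "(\<lambda>x. (N x \<bullet> n) * indicator S x) \<in> borel_measurable borel"
proof -
  have "(\<lambda>x. indicator S x *\<^sub>R (N x \<bullet> n)) \<in> borel_measurable borel"
    by (intro borel_measurable_continuous_on_indicator S_borel continuous_intros cont)
  then show ?thesis by (simp add: mult.commute)
qed

lemma flux_measurable:
  assumes "A \<in> sets borel" "A \<subseteq> S"
  shows "(\<lambda>x. ennreal (N x \<bullet> n) * indicator A x) \<in> borel_measurable borel"
proof -
  have [measurable]: "A \<in> sets borel" by fact
  have "(\<lambda>x. ennreal ((N x \<bullet> n) * indicator S x) * indicator A x) \<in> borel_measurable borel"
    using measurable_normal_component by measurable
  also have "(\<lambda>x. ennreal ((N x \<bullet> n) * indicator S x) * indicator A x) = (\<lambda>x. ennreal (N x \<bullet> n) * indicator A x)"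
    using assms(2) by (auto simp: indicator_def fun_eq_iff)
  finally show ?thesis .
qed

lemma flux_Un:
  assumes A: "A \<in> sets borel" "A \<subseteq> S" and B: "B \<in> sets borel" "B \<subseteq> S" and AB: "A \<inter> B = {}"
  shows "flux n (A \<union> B) = flux n A + flux n B"
proof -
  have "flux n (A \<union> B) = (\<integral>\<^sup>+x. ennreal (N x \<bullet> n) * indicator A x + ennreal (N x \<bullet> n) * indicator B x \<partial>H)"
    unfolding flux_def using AB by (intro nn_integral_cong) (auto simp: indicator_def)
  also have "\<dots> = flux n A + flux n B"
    unfolding flux_def using flux_measurable[OF A] flux_measurable[OF B]
    by (intro nn_integral_add) auto
  finally show ?thesis .
qed

lemma small_flatness_exists:
  assumes c: "(c::real) > 0" and \<tau>: "\<tau> > 1"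
  shows "\<exists>e>0. e < 1 \<and> e / (c * (1 - e)) < 1 \<and> (1 + e / (c * (1 - e))) ^ m < \<tau> \<and>
    (1 / ((1 - e) * (1 - e / (c * (1 - e))))) ^ m < \<tau>"
proof -
  let ?\<eta> = "\<lambda>e::real. e / (c * (1 - e))"
  have t1: "(?\<eta> \<longlongrightarrow> 0 / (c * (1 - 0))) (at_right 0)"
    using c by (intro tendsto_intros) auto
  have t2: "((\<lambda>e. (1 + ?\<eta> e) ^ m) \<longlongrightarrow> (1 + 0 / (c * (1 - 0))) ^ m) (at_right 0)"
    by (intro tendsto_intros t1)
  have t3: "((\<lambda>e. (1 / ((1 - e) * (1 - ?\<eta> e))) ^ m) \<longlongrightarrow> (1 / ((1 - 0) * (1 - 0 / (c * (1 - 0))))) ^ m) (at_right 0)"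
    by (intro tendsto_intros t1) auto
  have "eventually (\<lambda>e. e \<in> {0<..<1} \<and> ?\<eta> e < 1 \<and> (1 + ?\<eta> e) ^ m < \<tau> \<and> (1 / ((1 - e) * (1 - ?\<eta> e))) ^ m < \<tau>) (at_right 0)"
    using t1 t2 t3 \<tau>
    by (intro eventually_conj order_tendstoD(2)[where f = ?\<eta>] eventually_at_right_real
        order_tendstoD(2)[OF t2] order_tendstoD(2)[OF t3]) auto
  then obtain e where "e \<in> {0<..<1} \<and> ?\<eta> e < 1 \<and> (1 + ?\<eta> e) ^ m < \<tau> \<and> (1 / ((1 - e) * (1 - ?\<eta> e))) ^ m < \<tau>"
    using eventually_happens'[OF trivial_limit_at_right_real] by blast
  then show ?thesis by (intro exI[of _ e]) auto
qed

text \<open>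
  Near \<open>p\<close> the set is flat and \<open>\<langle>N, n\<rangle>\<close> is nearly constant.  The error is multiplicative, so it
  survives the decomposition of a large set into small pieces.
\<close>

lemma projection_flux_local:
  assumes p: "p \<in> S" and n: "norm n = 1" and np: "N p \<bullet> n > 0" and \<tau>: "\<tau> > 1"
  shows "\<exists>r>0. \<forall>A\<in>sets borel. A \<subseteq> S \<inter> ball p r \<longrightarrow>
    area (tangential_projection n ` A) \<le> ennreal (\<tau>\<^sup>2) * flux n A \<and>
    flux n A \<le> ennreal (\<tau>\<^sup>2) * area (tangential_projection n ` A)"
proof -
  let ?P = "tangential_projection n"
  define c where "c = N p \<bullet> n"
  have c: "0 < c" "n \<bullet> N p = c" using np by (auto simp: c_def inner_commute)
  obtain e where e: "0 < e" "e < 1" "e / (c * (1 - e)) < 1" "(1 + e / (c * (1 - e))) ^ (DIM('a) - 1) < \<tau>"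
    "(1 / ((1 - e) * (1 - e / (c * (1 - e))))) ^ (DIM('a) - 1) < \<tau>"
    using small_flatness_exists[OF c(1) \<tau>] by blast
  obtain r1 where r1: "r1 > 0"
    "\<And>x y. x \<in> S \<inter> ball p r1 \<Longrightarrow> y \<in> S \<inter> ball p r1 \<Longrightarrow> \<bar>N p \<bullet> (x - y)\<bar> \<le> e * norm (x - y)"
    using flat[OF p e(1)] by auto
  have "c / \<tau> < c" "c < \<tau> * c" using c \<tau> by (auto simp: divide_less_eq)
  then obtain r2 where r2: "r2 > 0" "\<And>x. x \<in> S \<inter> ball p r2 \<Longrightarrow> c / \<tau> < N x \<bullet> n \<and> N x \<bullet> n < \<tau> * c"
    using normal_continuous[OF p, of "c / \<tau>" n "\<tau> * c"] by (auto simp: c_def)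
  define r where "r = min r1 r2 / 2"
  have r: "r > 0" "r < r1" "r < r2" using r1(1) r2(1) by (auto simp: r_def min_def)
  show ?thesis
  proof (intro exI[of _ r] conjI ballI impI r(1))
    fix A :: "'a set" assume A: "A \<in> sets borel" "A \<subseteq> S \<inter> ball p r"
    let ?K = "S \<inter> cball p r"
    have K: "compact ?K" using compact by (intro compact_Int_closed) auto
    have AK: "A \<subseteq> ?K" using A by auto
    have AS: "A \<subseteq> S" using A by auto
    have flatK: "\<bar>N p \<bullet> (x - y)\<bar> \<le> e * norm (x - y)" if "x \<in> ?K" "y \<in> ?K" for x y
      using that r by (intro r1(2)) auto
    have HA: "area A = emeasure H A" using A(1) by (simp add: emeasure_hausdorff_measure)
    note bounds = hausdorff_outer_projection_of_flat[OF n unit[OF p] dim _ e(1,2) K flatK A(1) AK, unfolded c(2), OF c(1) _ _ e(3)]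
    have NA: "c / \<tau> \<le> N x \<bullet> n" "N x \<bullet> n \<le> \<tau> * c" if "x \<in> A" for x
    proof -
      have "x \<in> S \<inter> ball p r2" using that A(2) r by auto
      from r2(2)[OF this] show "c / \<tau> \<le> N x \<bullet> n" "N x \<bullet> n \<le> \<tau> * c"
        by (simp_all only: less_imp_le)
    qed
    have up: "flux n A \<le> ennreal (\<tau> * c) * area A"
    proof -
      have "flux n A \<le> (\<integral>\<^sup>+x. ennreal (\<tau> * c) * indicator A x \<partial>H)"
        unfolding flux_def using NA by (intro nn_integral_mono) (auto simp: indicator_def intro!: ennreal_leI)
      also have "\<dots> = ennreal (\<tau> * c) * area A"
        unfolding HA using A(1) by (subst nn_integral_cmult_indicator) auto
      finally show ?thesis .
    qed
    have low: "ennreal (c / \<tau>) * area A \<le> flux n A"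
    proof -
      have "ennreal (c / \<tau>) * area A = (\<integral>\<^sup>+x. ennreal (c / \<tau>) * indicator A x \<partial>H)"
        unfolding HA using A(1) by (subst nn_integral_cmult_indicator) auto
      also have "\<dots> \<le> flux n A"
        unfolding flux_def using NA by (intro nn_integral_mono) (auto simp: indicator_def intro!: ennreal_leI)
      finally show ?thesis .
    qed
    have "area (?P ` A) \<le> ennreal ((1 + e / (c * (1 - e))) ^ (DIM('a) - 1) * c) * area A"
      using bounds(1) by simp
    also have "\<dots> \<le> ennreal (\<tau> * c) * area A"
      using e c by (intro mult_right_mono ennreal_leI) auto
    also have "\<dots> = ennreal (\<tau>\<^sup>2) * (ennreal (c / \<tau>) * area A)"
      using \<tau> c by (simp add: mult.assoc[symmetric] ennreal_mult[symmetric] power2_eq_square)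
    also have "\<dots> \<le> ennreal (\<tau>\<^sup>2) * flux n A" by (intro mult_left_mono low) auto
    finally show "area (?P ` A) \<le> ennreal (\<tau>\<^sup>2) * flux n A" .
    have "flux n A \<le> ennreal \<tau> * (ennreal c * area A)"
      using up \<tau> c by (simp add: ennreal_mult mult.assoc)
    also have "\<dots> \<le> ennreal \<tau> * (ennreal ((1 / ((1 - e) * (1 - e / (c * (1 - e))))) ^ (DIM('a) - 1)) * area (?P ` A))"
      using bounds(2) by (intro mult_left_mono) auto
    also have "\<dots> \<le> ennreal \<tau> * (ennreal \<tau> * area (?P ` A))"
      using e by (intro mult_left_mono mult_right_mono ennreal_leI) auto
    also have "\<dots> = ennreal (\<tau>\<^sup>2) * area (?P ` A)"
      using \<tau> by (simp add: mult.assoc[symmetric] ennreal_mult[symmetric] power2_eq_square)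
    finally show "flux n A \<le> ennreal (\<tau>\<^sup>2) * area (?P ` A)" .
  qed
qed

text \<open>
  The area formula for the projection of a graph.  A finite partition into pieces that are small
  enough gives the equality up to any factor \<open>\<tau>\<^sup>2 > 1\<close>.
\<close>

lemma projection_flux:
  assumes K: "compact K" "K \<subseteq> S" and n: "norm n = 1" and np: "\<And>x. x \<in> K \<Longrightarrow> N x \<bullet> n > 0"
    and inj: "inj_on (tangential_projection n) K" and A: "A \<in> sets borel" "A \<subseteq> K"
  shows "area (tangential_projection n ` A) = flux n A"
proof -
  let ?P = "tangential_projection n"
  \<comment> \<open>The relation \<open>good\<close> is inherited by disjoint unions, so it passes from small balls to \<open>A\<close>.\<close>
  have *: "area (?P ` A) \<le> ennreal (\<tau>\<^sup>2) * flux n A \<and> flux n A \<le> ennreal (\<tau>\<^sup>2) * area (?P ` A)"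
    if \<tau>: "1 < \<tau>" for \<tau>
  proof -
    define good where "good B \<longleftrightarrow> area (?P ` B) \<le> ennreal (\<tau>\<^sup>2) * flux n B \<and>
      flux n B \<le> ennreal (\<tau>\<^sup>2) * area (?P ` B)" for B
    obtain r where r: "\<And>p. p \<in> K \<Longrightarrow> r p > 0 \<and> (\<forall>B\<in>sets borel. B \<subseteq> S \<inter> ball p (r p) \<longrightarrow> good B)"
      using projection_flux_local[OF _ n np \<tau>] K(2) unfolding good_def by (metis subsetD)
    have "K \<subseteq> (\<Union>p\<in>K. ball p (r p))" using r by auto
    then obtain F where F: "F \<subseteq> K" "finite F" "K \<subseteq> (\<Union>p\<in>F. ball p (r p))"
      using compactE_image[OF K(1), of K "\<lambda>p. ball p (r p)"] by auto
    have "good B" if "finite F'" "F' \<subseteq> K" "B \<in> sets borel" "B \<subseteq> K \<inter> (\<Union>p\<in>F'. ball p (r p))" for F' B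
      using that
    proof (induction F' arbitrary: B)
      case empty
      then show ?case by (simp add: good_def hausdorff_outer_empty flux_def)
    next
      case (insert p F')
      define B1 where "B1 = B \<inter> ball p (r p)"
      define B2 where "B2 = B - ball p (r p)"
      have B: "B = B1 \<union> B2" "B1 \<inter> B2 = {}" by (auto simp: B1_def B2_def)
      have m: "B1 \<in> sets borel" "B2 \<in> sets borel"
        unfolding B1_def B2_def using insert.prems by (auto intro: sets.Diff)
      have sub: "B1 \<subseteq> K" "B2 \<subseteq> K" using insert.prems by (auto simp: B1_def B2_def)
      have "B1 \<subseteq> S \<inter> ball p (r p)" using sub K(2) by (auto simp: B1_def)
      then have g1: "good B1" using r[of p] insert.prems(1) m(1) by blast
      have g2: "good B2" by (rule insert.IH) (use insert.prems m in \<open>auto simp: B2_def\<close>)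
      have img: "?P ` B1 \<in> sets borel" "?P ` B2 \<in> sets borel"
        using m sub by (auto intro!: borel_injective_image_of_compact[OF K(1) _ inj] continuous_intros)
      have "?P ` B1 \<inter> ?P ` B2 = {}"
        using inj sub B(2) by (metis image_empty inj_on_image_Int)
      then have "emeasure H (?P ` B1) + emeasure H (?P ` B2) = emeasure H (?P ` B1 \<union> ?P ` B2)"
        using img by (intro plus_emeasure) auto
      then have "area (?P ` B) = area (?P ` B1) + area (?P ` B2)"
        using img by (simp add: emeasure_hausdorff_measure B(1) image_Un sets.Un)
      moreover have "flux n B = flux n B1 + flux n B2"
        unfolding B(1) using m sub K(2) B(2) by (intro flux_Un) auto
      ultimately show ?case
        using g1 g2 by (auto simp: good_def distrib_left intro!: add_mono)
    qed
    from this[OF F(2,1) A(1)] show ?thesis using A(2) F(3) unfolding good_def by auto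
  qed
  have **: "a \<le> b" if "\<And>\<tau>. 1 < \<tau> \<Longrightarrow> a \<le> ennreal (\<tau>\<^sup>2) * b" for a b
  proof (rule ennreal_le_if_le_mult)
    fix t :: real assume "1 < t"
    then have "1 < sqrt t" "(sqrt t)\<^sup>2 = t" by simp_all
    with that[of "sqrt t"] show "a \<le> ennreal t * b" by simp
  qed
  show ?thesis
  proof (rule antisym)
    show "area (?P ` A) \<le> flux n A" by (rule **) (use * in blast)
    show "flux n A \<le> area (?P ` A)" by (rule **) (use * in blast)
  qed
qed

end

section \<open>Integrals over a hypersurface in graph coordinates\<close>

lemma integrable_plane_bounded_support:
  fixes f :: "'a::euclidean_space \<Rightarrow> real"
  assumes n: "norm n = 1" and dim: "DIM('a) \<ge> 2" and [measurable]: "f \<in> borel_measurable borel"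
    and B: "\<And>y. y \<bullet> n = 0 \<Longrightarrow> \<bar>f y\<bar> \<le> B" and supp: "\<And>y. y \<bullet> n = 0 \<Longrightarrow> R < norm y \<Longrightarrow> f y = 0"
  shows "integrable (plane_measure n) f"
proof (rule Bochner_Integration.integrable_bound)
  show "integrable (plane_measure n) (\<lambda>y. B * indicator (cball 0 R) y)"
    using plane_measure_bounded[OF n dim, of "cball 0 R"]
    by (intro integrable_mult_right integrable_real_indicator) (auto intro: borel_closed)
  show "AE y in plane_measure n. norm (f y) \<le> norm (B * indicator (cball 0 R) y)"
    using AE_plane_measure
  proof eventually_elim
    fix y assume y: "y \<bullet> n = 0"
    show "norm (f y) \<le> norm (B * indicator (cball 0 R) y)"
      using B[OF y] supp[OF y] by (cases "norm y \<le> R") (auto simp: indicator_def)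
  qed
qed simp

lemma integral_plane_translation:
  fixes f :: "'a::euclidean_space \<Rightarrow> real"
  assumes "w \<bullet> n = 0" and [measurable]: "f \<in> borel_measurable borel"
  shows "(LINT y|plane_measure n. f (y + w)) = (LINT y|plane_measure n. f y)"
proof -
  have "(LINT y|distr (plane_measure n) borel (\<lambda>x. x + w). f y) = (LINT y|plane_measure n. f (y + w))"
    by (rule integral_distr) auto
  then show ?thesis by (simp add: plane_measure_translation assms)
qed

text \<open>
  Difference quotients in a direction of the hyperplane integrate to zero by translation
  invariance, and they converge boundedly to the derivative.
\<close>

lemma integral_directional_derivative_plane:
  fixes f f' :: "'a::euclidean_space \<Rightarrow> real"
  assumes n: "norm n = 1" and dim: "DIM('a) \<ge> 2" and v: "v \<bullet> n = 0"
    and [measurable]: "f \<in> borel_measurable borel" "f' \<in> borel_measurable borel"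
    and der: "\<And>y. y \<bullet> n = 0 \<Longrightarrow> ((\<lambda>s. f (y + s *\<^sub>R v)) has_real_derivative f' y) (at 0)"
    and A: "\<And>y. y \<bullet> n = 0 \<Longrightarrow> \<bar>f y\<bar> \<le> A" and B: "\<And>y. y \<bullet> n = 0 \<Longrightarrow> \<bar>f' y\<bar> \<le> B"
    and supp: "\<And>y. y \<bullet> n = 0 \<Longrightarrow> R < norm y \<Longrightarrow> f y = 0"
  shows "(LINT y|plane_measure n. f' y) = 0"
proof -
  \<comment> \<open>Difference quotients with step \<open>1 / (m + 1)\<close>.\<close>
  define q where "q m y = real (Suc m) * (f (y + (1 / real (Suc m)) *\<^sub>R v) - f y)" for m y
  have meas [measurable]: "q m \<in> borel_measurable borel" for m unfolding q_def by measurable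
  have der': "((\<lambda>s. f (y + s *\<^sub>R v)) has_real_derivative f' (y + t *\<^sub>R v)) (at t)" if y: "y \<bullet> n = 0" for y t
  proof -
    have "((\<lambda>s. f (y + t *\<^sub>R v + s *\<^sub>R v)) has_real_derivative f' (y + t *\<^sub>R v)) (at 0)"
      using y v by (intro der) (simp add: inner_add_left)
    then have "((\<lambda>s. f (y + (t + s) *\<^sub>R v)) has_real_derivative f' (y + t *\<^sub>R v)) (at 0)"
      by (simp add: scaleR_add_left add.assoc)
    then show ?thesis
      using DERIV_shift[of "\<lambda>s. f (y + s *\<^sub>R v)" "f' (y + t *\<^sub>R v)" 0 t] by (simp add: add.commute)
  qed
  have int_f: "integrable (plane_measure n) f"
    by (rule integrable_plane_bounded_support[OF n dim _ A supp]) auto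
  have zero: "(LINT y|plane_measure n. q m y) = 0" for m
  proof -
    let ?w = "(1 / real (Suc m)) *\<^sub>R v"
    have w: "?w \<bullet> n = 0" using v by simp
    have "integrable (distr (plane_measure n) borel (\<lambda>x. x + ?w)) f"
      using int_f by (simp only: plane_measure_translation[OF w])
    then have "integrable (plane_measure n) (\<lambda>y. f (y + ?w))"
      by (subst (asm) integrable_distr_eq) auto
    then have "(LINT y|plane_measure n. q m y) = real (Suc m) * ((LINT y|plane_measure n. f (y + ?w)) - (LINT y|plane_measure n. f y))"
      unfolding q_def using int_f by simp
    then show ?thesis using integral_plane_translation[OF w, of f] by simp
  qed
  have "(\<lambda>m. LINT y|plane_measure n. q m y) \<longlonglongrightarrow> (LINT y|plane_measure n. f' y)"
  proof (rule integral_dominated_convergence)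
    show "integrable (plane_measure n) (\<lambda>y. B * indicator (cball 0 (R + norm v)) y)"
      using plane_measure_bounded[OF n dim, of "cball 0 (R + norm v)"]
      by (intro integrable_mult_right integrable_real_indicator) (auto intro: borel_closed)
    show "AE y in plane_measure n. (\<lambda>m. q m y) \<longlonglongrightarrow> f' y"
      using AE_plane_measure
    proof eventually_elim
      fix y assume y: "y \<bullet> n = 0"
      have "((\<lambda>s. (f (y + s *\<^sub>R v) - f y) / s) \<longlongrightarrow> f' y) (at 0)"
        using der[OF y] by (simp add: DERIV_def)
      moreover have "filterlim (\<lambda>m. 1 / real (Suc m)) (at 0) sequentially"
        using LIMSEQ_inverse_real_of_nat
        by (intro filterlim_atI) (auto simp: inverse_eq_divide)
      ultimately have "(\<lambda>m. (f (y + (1 / real (Suc m)) *\<^sub>R v) - f y) / (1 / real (Suc m))) \<longlonglongrightarrow> f' y"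
        by (rule filterlim_compose)
      then show "(\<lambda>m. q m y) \<longlonglongrightarrow> f' y"
        by (simp add: q_def mult.commute)
    qed
    fix m
    show "AE y in plane_measure n. norm (q m y) \<le> B * indicator (cball 0 (R + norm v)) y"
      using AE_plane_measure
    proof eventually_elim
      fix y assume y: "y \<bullet> n = 0"
      let ?s = "1 / real (Suc m)"
      show "norm (q m y) \<le> B * indicator (cball 0 (R + norm v)) y"
      proof (cases "norm y \<le> R + norm v")
        case True
        have "0 < ?s" by simp
        then obtain z where z: "0 < z" "z < ?s"
          "f (y + ?s *\<^sub>R v) - f (y + 0 *\<^sub>R v) = (?s - 0) * f' (y + z *\<^sub>R v)"
          using MVT2[of 0 ?s "\<lambda>s. f (y + s *\<^sub>R v)" "\<lambda>t. f' (y + t *\<^sub>R v)"] der'[OF y] by blast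
        then have "q m y = f' (y + z *\<^sub>R v)" by (simp add: q_def)
        then show ?thesis using B[of "y + z *\<^sub>R v"] y v True by (simp add: inner_add_left)
      next
        case False
        have "norm y \<le> norm (y + ?s *\<^sub>R v) + norm (?s *\<^sub>R v)"
          using norm_triangle_ineq4[of "y + ?s *\<^sub>R v" "?s *\<^sub>R v"] by simp
        moreover have "norm (?s *\<^sub>R v) \<le> norm v" by (simp add: field_simps mult_left_le)
        ultimately have "R < norm (y + ?s *\<^sub>R v)" using False by linarith
        then have "f (y + ?s *\<^sub>R v) = 0" using y v by (intro supp) (auto simp: inner_add_left)
        moreover have "f y = 0" using False y norm_ge_zero[of v] by (intro supp; linarith)
        ultimately show ?thesis using False by (simp add: q_def)
      qed
    qed
  qed auto
  then show ?thesis unfolding zero using LIMSEQ_unique tendsto_const by metis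
qed

context oriented_hypersurface
begin

lemma emeasure_S_finite: "emeasure H S < \<infinity>"
  using finite_area by (simp add: emeasure_hausdorff_measure)

lemma set_integrable_continuous:
  fixes f :: "'a \<Rightarrow> real"
  assumes f: "continuous_on S f"
  shows "set_integrable H S f"
proof -
  obtain B where B: "\<And>x. x \<in> S \<Longrightarrow> norm (f x) \<le> B"
    using compact_imp_bounded[OF compact_continuous_image[OF f compact]] unfolding bounded_iff by auto
  show ?thesis unfolding set_integrable_def
  proof (rule integrableI_bounded_set[where A = S and B = B])
    show "(\<lambda>x. indicator S x *\<^sub>R f x) \<in> borel_measurable H"
      using borel_measurable_continuous_on_indicator[OF S_borel f] by simp
    show "emeasure H S < \<infinity>" by (rule emeasure_S_finite)
    show "AE x in H. x \<in> S \<longrightarrow> norm (indicator S x *\<^sub>R f x) \<le> B" using B by auto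
    show "AE x in H. x \<notin> S \<longrightarrow> indicator S x *\<^sub>R f x = 0" by auto
  qed simp
qed

text \<open>
  The function \<open>u\<close> is \<open>h\<close> read in the graph coordinates, extended by zero; by \<open>projection_flux\<close>
  the projection carries \<open>\<langle>N, n\<rangle> dA\<close> to the measure of the hyperplane.
\<close>

lemma integral_projection:
  fixes h u :: "'a \<Rightarrow> real"
  assumes K: "compact K" "K \<subseteq> S" and n: "norm n = 1" and np: "\<And>x. x \<in> K \<Longrightarrow> N x \<bullet> n > 0"
    and inj: "inj_on (tangential_projection n) K"
    and u [measurable]: "u \<in> borel_measurable borel"
    and hu: "\<And>x. x \<in> K \<Longrightarrow> u (tangential_projection n x) = h x"
    and u0: "\<And>y. y \<bullet> n = 0 \<Longrightarrow> y \<notin> tangential_projection n ` K \<Longrightarrow> u y = 0"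
  shows "(LINT x:K|H. (N x \<bullet> n) * h x) = (LINT y|plane_measure n. u y)"
proof -
  let ?P = "tangential_projection n"
  have Pm [measurable]: "?P \<in> borel_measurable borel"
    by (intro borel_measurable_continuous_onI continuous_intros)
  have KB [measurable]: "K \<in> sets borel" using K by (simp add: borel_closed compact_imp_closed)
  have PK [measurable]: "?P ` K \<in> sets borel"
    by (rule borel_injective_image_of_compact[OF K(1) _ inj KB]) (auto intro: continuous_intros)
  define f where "f x = (N x \<bullet> n) * indicator K x" for x
  have "(\<lambda>x. (N x \<bullet> n) * indicator S x * indicator K x) \<in> borel_measurable borel"
    using measurable_normal_component by measurable
  also have "(\<lambda>x. (N x \<bullet> n) * indicator S x * indicator K x) = f"
    using K(2) by (auto simp: f_def indicator_def fun_eq_iff)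
  finally have fm [measurable]: "f \<in> borel_measurable borel" .
  have f0: "0 \<le> f x" for x using np[of x] by (auto simp: f_def indicator_def)
  have eq: "distr (density H (\<lambda>x. ennreal (f x))) borel ?P = density (plane_measure n) (\<lambda>y. ennreal (indicator (?P ` K) y))"
  proof (rule measure_eqI)
    fix B assume "B \<in> sets (distr (density H (\<lambda>x. ennreal (f x))) borel ?P)"
    then have B [measurable]: "B \<in> sets borel" by simp
    have vB [measurable]: "?P -` B \<in> sets borel" by (rule measurable_sets_borel[OF Pm B])
    have "emeasure (distr (density H (\<lambda>x. ennreal (f x))) borel ?P) B = (\<integral>\<^sup>+x. ennreal (f x) * indicator (?P -` B) x \<partial>H)"
      by (subst emeasure_distr) (auto simp: emeasure_density)
    also have "\<dots> = flux n (K \<inter> ?P -` B)"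
      unfolding flux_def f_def by (intro nn_integral_cong) (auto simp: indicator_def)
    also have "\<dots> = area (?P ` (K \<inter> ?P -` B))"
      by (rule projection_flux[OF K n np inj, symmetric]) auto
    also have "?P ` (K \<inter> ?P -` B) = (?P ` K \<inter> B) \<inter> normal_plane n"
      using inner_tangential_projection[OF n] by (auto simp: normal_plane_def)
    also have "area \<dots> = emeasure (plane_measure n) (?P ` K \<inter> B)"
      by (rule emeasure_plane_measure[symmetric]) auto
    also have "\<dots> = (\<integral>\<^sup>+y. indicator (?P ` K \<inter> B) y \<partial>plane_measure n)"
      by (rule nn_integral_indicator[symmetric]) auto
    also have "\<dots> = emeasure (density (plane_measure n) (\<lambda>y. ennreal (indicator (?P ` K) y))) B"
    proof -
      have "emeasure (density (plane_measure n) (\<lambda>y. ennreal (indicator (?P ` K) y))) B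
          = (\<integral>\<^sup>+y. ennreal (indicator (?P ` K) y) * indicator B y \<partial>plane_measure n)"
        by (rule emeasure_density) auto
      also have "\<dots> = (\<integral>\<^sup>+y. indicator (?P ` K \<inter> B) y \<partial>plane_measure n)"
        by (intro nn_integral_cong) (simp add: indicator_def)
      finally show ?thesis by simp
    qed
    finally show "emeasure (distr (density H (\<lambda>x. ennreal (f x))) borel ?P) B
        = emeasure (density (plane_measure n) (\<lambda>y. ennreal (indicator (?P ` K) y))) B" .
  qed simp
  have "(LINT x:K|H. (N x \<bullet> n) * h x) = (LINT x|H. f x *\<^sub>R u (?P x))"
    unfolding set_lebesgue_integral_def
    by (intro Bochner_Integration.integral_cong) (auto simp: f_def hu indicator_def)
  also have "\<dots> = (LINT x|density H (\<lambda>x. ennreal (f x)). u (?P x))"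
    using f0 by (intro integral_density[symmetric]) auto
  also have "\<dots> = (LINT y|distr (density H (\<lambda>x. ennreal (f x))) borel ?P. u y)"
    by (rule integral_distr[symmetric]) auto
  also have "\<dots> = (LINT y|plane_measure n. indicator (?P ` K) y *\<^sub>R u y)"
    unfolding eq by (intro integral_density) auto
  also have "\<dots> = (LINT y|plane_measure n. u y)"
  proof (intro integral_cong_AE)
    show "AE y in plane_measure n. indicator (?P ` K) y *\<^sub>R u y = u y"
      using AE_plane_measure by eventually_elim (auto simp: indicator_def u0)
  qed auto
  finally show ?thesis .
qed

text \<open>
  The graph over the hyperplane orthogonal to \<open>n\<close> contains a curve over every line in that
  hyperplane; by flatness its velocity is the tangent vector that projects to \<open>v\<close>.
\<close>

lemma tangent_curve:
  assumes p: "p \<in> S" and n: "norm n = 1" and np: "N p \<bullet> n > 0" and v: "v \<bullet> n = 0"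
  obtains c where "c 0 = p" "\<forall>\<^sub>F s in nhds (0::real). c s \<in> S \<and> tangential_projection n (c s) = tangential_projection n p + s *\<^sub>R v"
    "(c has_vector_derivative (v - ((N p \<bullet> v) / (N p \<bullet> n)) *\<^sub>R n)) (at 0)"
proof -
  let ?P = "tangential_projection n"
  obtain r C where r: "0 < r" "0 < C"
    "\<And>x y. x \<in> S \<inter> ball p r \<Longrightarrow> y \<in> S \<inter> ball p r \<Longrightarrow> norm (x - y) \<le> C * norm (?P x - ?P y)"
    using inverse_projection_lipschitz[OF p n np] by blast
  obtain \<rho> where \<rho>: "\<rho> > 0" "\<forall>y\<in>normal_plane n \<inter> ball (?P p) \<rho>. \<exists>x\<in>S \<inter> ball p r. ?P x = y"
    using full[OF p n np r(1)] by blast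
  define c where "c s = (if s = 0 then p else SOME x. x \<in> S \<inter> ball p r \<and> ?P x = ?P p + s *\<^sub>R v)" for s :: real
  have c0: "c 0 = p" by (simp add: c_def)
  have cs: "c s \<in> S \<inter> ball p r \<and> ?P (c s) = ?P p + s *\<^sub>R v" if s: "\<bar>s\<bar> * norm v < \<rho>" for s
  proof (cases "s = 0")
    case True
    then show ?thesis using p r by (simp add: c0)
  next
    case False
    have "?P p + s *\<^sub>R v \<in> normal_plane n \<inter> ball (?P p) \<rho>"
      using s v inner_tangential_projection[OF n] by (simp add: normal_plane_def inner_add_left dist_norm)
    then have "\<exists>x. x \<in> S \<inter> ball p r \<and> ?P x = ?P p + s *\<^sub>R v" using \<rho>(2) by blast
    from someI_ex[OF this] show ?thesis using False by (simp add: c_def)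
  qed
  have small: "\<forall>\<^sub>F s in nhds (0::real). \<bar>s\<bar> * norm v < d" if "d > 0" for d
  proof -
    have "((\<lambda>s. \<bar>s\<bar> * norm v) \<longlongrightarrow> \<bar>0::real\<bar> * norm v) (nhds 0)"
      by (intro tendsto_intros filterlim_ident)
    then show ?thesis using order_tendstoD(2)[of _ "\<bar>0::real\<bar> * norm v" _ d] that by simp
  qed
  have lip: "norm (c s - p) \<le> C * (\<bar>s\<bar> * norm v)" if s: "\<bar>s\<bar> * norm v < \<rho>" for s
    using r(3)[of "c s" p] cs[OF s] p r by simp
  let ?d = "v - ((N p \<bullet> v) / (N p \<bullet> n)) *\<^sub>R n"
  have dec: "c s - p = s *\<^sub>R v + ((c s - p) \<bullet> n) *\<^sub>R n" if s: "\<bar>s\<bar> * norm v < \<rho>" for s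
    using cs[OF s] by (simp add: tangential_projection_def inner_diff_left algebra_simps)
  have "(c has_derivative (\<lambda>s. s *\<^sub>R ?d)) (at 0)"
    unfolding has_derivative_at_within
  proof (intro conjI)
    show "bounded_linear (\<lambda>s. s *\<^sub>R ?d)" by (rule bounded_linear_scaleR_left)
    show "((\<lambda>y. ((c y - c 0) - (y - 0) *\<^sub>R ?d) /\<^sub>R norm (y - 0)) \<longlongrightarrow> 0) (at 0 within UNIV)"
    proof (rule tendstoI)
      fix \<epsilon> :: real assume \<epsilon>: "0 < \<epsilon>"
      define D where "D = C * norm v + 1"
      \<comment> \<open>\<open>D\<close> exceeds the Lipschitz constant of the curve, so flatness \<open>e\<close> leaves an error of at most \<open>\<epsilon> / 2\<close>.\<close>
      define e where "e = \<epsilon> * (N p \<bullet> n) / (2 * D)"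
      have pos: "0 < D" using r(2) by (simp add: D_def add_nonneg_pos)
      have e: "0 < e" using \<epsilon> np pos by (simp add: e_def)
      obtain r' where r': "r' > 0"
        "\<And>x y. x \<in> S \<inter> ball p r' \<Longrightarrow> y \<in> S \<inter> ball p r' \<Longrightarrow> \<bar>N p \<bullet> (x - y)\<bar> \<le> e * norm (x - y)"
        using flat[OF p e] by auto
      have "0 < r' / C" using r'(1) r(2) by simp
      from eventually_conj[OF small[OF \<rho>(1)] small[OF this]]
      have "\<forall>\<^sub>F s in at 0. s \<noteq> (0::real) \<and> \<bar>s\<bar> * norm v < \<rho> \<and> \<bar>s\<bar> * norm v < r' / C"
        unfolding eventually_at_filter by (rule eventually_mono) auto
      then show "\<forall>\<^sub>F y in at 0. dist (((c y - c 0) - (y - 0) *\<^sub>R ?d) /\<^sub>R norm (y - 0)) 0 < \<epsilon>"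
      proof eventually_elim
        fix s :: real assume s: "s \<noteq> 0 \<and> \<bar>s\<bar> * norm v < \<rho> \<and> \<bar>s\<bar> * norm v < r' / C"
        then have s0: "\<bar>s\<bar> * norm v < \<rho>" by blast
        define \<delta> where "\<delta> = (c s - p) \<bullet> n"
        have dec': "c s - p = s *\<^sub>R v + \<delta> *\<^sub>R n" using dec[OF s0] by (simp add: \<delta>_def)
        have "C * (\<bar>s\<bar> * norm v) < r'" using s r(2) by (simp add: field_simps)
        then have "dist p (c s) < r'" using lip[OF s0] by (simp add: dist_norm norm_minus_commute)
        then have "\<bar>N p \<bullet> (c s - p)\<bar> \<le> e * norm (c s - p)"
          using cs[OF s0] p r'(1) by (intro r'(2)) auto
        also have "\<dots> \<le> e * (C * (\<bar>s\<bar> * norm v))" using e by (intro mult_left_mono lip s0) auto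
        finally have le: "\<bar>s * (N p \<bullet> v) + \<delta> * (N p \<bullet> n)\<bar> \<le> e * (C * (\<bar>s\<bar> * norm v))"
          unfolding dec' by (simp add: inner_add_right)
        have "c s - c 0 - (s - 0) *\<^sub>R ?d = ((s * (N p \<bullet> v) + \<delta> * (N p \<bullet> n)) / (N p \<bullet> n)) *\<^sub>R n"
          using dec' np unfolding c0 by (simp add: algebra_simps add_divide_distrib)
        then have "norm (c s - c 0 - (s - 0) *\<^sub>R ?d) = \<bar>s * (N p \<bullet> v) + \<delta> * (N p \<bullet> n)\<bar> / (N p \<bullet> n)"
          using n np by simp
        also have "\<dots> \<le> e * (C * (\<bar>s\<bar> * norm v)) / (N p \<bullet> n)"
          using le np by (intro divide_right_mono) auto
        also have "\<dots> = \<bar>s\<bar> * (\<epsilon> / 2 * (C * norm v / D))"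
          using np pos by (simp add: e_def field_simps)
        also have "\<dots> < \<bar>s\<bar> * \<epsilon>"
        proof (rule mult_strict_left_mono)
          have "C * norm v / D \<le> 1" using pos by (simp add: D_def)
          then have "\<epsilon> / 2 * (C * norm v / D) \<le> \<epsilon> / 2 * 1"
            using \<epsilon> by (intro mult_left_mono) auto
          then show "\<epsilon> / 2 * (C * norm v / D) < \<epsilon>" using \<epsilon> by linarith
        qed (use s in auto)
        finally show "dist (((c s - c 0) - (s - 0) *\<^sub>R ?d) /\<^sub>R norm (s - 0)) 0 < \<epsilon>"
          using s by (simp add: dist_norm divide_inverse_commute[symmetric] divide_simps mult.commute)
      qed
    qed
  qed
  then have vd: "(c has_vector_derivative ?d) (at 0)" by (simp add: has_vector_derivative_def)
  show thesis
    by (rule that[OF c0 _ vd]) (use small[OF \<rho>(1)] cs in \<open>auto elim!: eventually_mono\<close>)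
qed

end

section \<open>The integral of the unit normal\<close>

text \<open>
  Carrying the gradient along as a second argument keeps sums and products of test functions
  free of choices of derivatives.
\<close>

definition C1_gradient :: "('a::euclidean_space \<Rightarrow> real) \<Rightarrow> ('a \<Rightarrow> 'a) \<Rightarrow> bool" where
  "C1_gradient \<psi> g \<longleftrightarrow> continuous_on UNIV g \<and> (\<forall>x. (\<psi> has_derivative (\<lambda>w. g x \<bullet> w)) (at x))"

lemma C1_gradient_derivative: "C1_gradient \<psi> g \<Longrightarrow> (\<psi> has_derivative (\<lambda>w. g x \<bullet> w)) (at x)"
  by (simp add: C1_gradient_def)

lemma C1_gradient_continuous:
  assumes "C1_gradient \<psi> g"
  shows "continuous_on A g" "continuous_on A \<psi>"
proof -
  show "continuous_on A g" using assms by (auto simp: C1_gradient_def intro: continuous_on_subset)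
  show "continuous_on A \<psi>"
    using C1_gradient_derivative[OF assms]
    by (intro differentiable_imp_continuous_on) (auto simp: differentiable_on_def intro: differentiableI has_derivative_at_withinI)
qed

lemma C1_gradient_mult:
  assumes "C1_gradient \<psi> g" "C1_gradient \<beta> b"
  shows "C1_gradient (\<lambda>x. \<beta> x * \<psi> x) (\<lambda>x. \<beta> x *\<^sub>R g x + \<psi> x *\<^sub>R b x)"
  unfolding C1_gradient_def
proof (intro conjI allI)
  show "continuous_on UNIV (\<lambda>x. \<beta> x *\<^sub>R g x + \<psi> x *\<^sub>R b x)"
    using assms by (intro continuous_intros C1_gradient_continuous)
  fix x
  have "((\<lambda>x. \<beta> x * \<psi> x) has_derivative (\<lambda>h. \<beta> x * (g x \<bullet> h) + (b x \<bullet> h) * \<psi> x)) (at x)"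
    using assms by (intro has_derivative_mult C1_gradient_derivative)
  then show "((\<lambda>x. \<beta> x * \<psi> x) has_derivative (\<lambda>w. (\<beta> x *\<^sub>R g x + \<psi> x *\<^sub>R b x) \<bullet> w)) (at x)"
    by (simp add: inner_add_left mult.commute)
qed

lemma C1_gradient_one_minus:
  assumes "C1_gradient \<beta> b"
  shows "C1_gradient (\<lambda>x. 1 - \<beta> x) (\<lambda>x. - b x)"
  unfolding C1_gradient_def
proof (intro conjI allI)
  show "continuous_on UNIV (\<lambda>x. - b x)"
    using assms by (intro continuous_intros C1_gradient_continuous)
  fix x
  have "((\<lambda>x. 1 - \<beta> x) has_derivative (\<lambda>h. 0 - b x \<bullet> h)) (at x)"
    using assms by (intro has_derivative_diff has_derivative_const C1_gradient_derivative)
  then show "((\<lambda>x. 1 - \<beta> x) has_derivative (\<lambda>w. - b x \<bullet> w)) (at x)" by simp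
qed

lemma C1_gradient_zero:
  assumes "C1_gradient \<psi> g" "open U" "x \<in> U" "\<And>y. y \<in> U \<Longrightarrow> \<psi> y = 0"
  shows "g x = 0"
proof -
  have "((\<lambda>y. 0::real) has_derivative (\<lambda>w. g x \<bullet> w)) (at x)"
    using C1_gradient_derivative[OF assms(1), of x] assms(2-)
    by (rule has_derivative_transform_within_open) auto
  then have "(\<lambda>w. g x \<bullet> w) = (\<lambda>w. 0)"
    using has_derivative_unique[OF _ has_derivative_const] by blast
  then show ?thesis by (metis inner_eq_zero_iff)
qed

lemma positive_part_square_derivative:
  "((\<lambda>t::real. (max 0 t)\<^sup>2) has_real_derivative 2 * max 0 t) (at t)"
proof (cases "t = 0")
  case True
  have "((\<lambda>h. ((max 0 (0 + h))\<^sup>2 - (max 0 0)\<^sup>2) / h) \<longlongrightarrow> 0) (at (0::real))"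
  proof (rule Lim_null_comparison)
    show "\<forall>\<^sub>F h in at (0::real). norm (((max 0 (0 + h))\<^sup>2 - (max 0 0)\<^sup>2) / h) \<le> \<bar>h\<bar>"
      by (intro always_eventually allI) (auto simp: max_def power2_eq_square)
    show "((\<lambda>h::real. \<bar>h\<bar>) \<longlongrightarrow> 0) (at 0)"
      by (rule tendsto_rabs_zero[OF tendsto_ident_at])
  qed
  then show ?thesis using True by (simp add: DERIV_def)
next
  case False
  then consider "t < 0" | "0 < t" by linarith
  then show ?thesis
  proof cases
    case 1
    have "((\<lambda>t::real. 0) has_real_derivative 2 * max 0 t) (at t)" using 1 by simp
    then show ?thesis
      by (rule has_field_derivative_transform_within_open[where S = "{..<0}"]) (use 1 in auto)
  next
    case 2
    have "((\<lambda>t::real. t\<^sup>2) has_real_derivative 2 * max 0 t) (at t)"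
      using 2 by (auto intro!: derivative_eq_intros)
    then show ?thesis
      by (rule has_field_derivative_transform_within_open[where S = "{0<..}"]) (use 2 in auto)
  qed
qed

lemma C1_gradient_compose:
  assumes "C1_gradient \<psi> g" and \<sigma>: "\<And>t. (\<sigma> has_real_derivative \<sigma>' t) (at t)" "continuous_on UNIV \<sigma>'"
  shows "C1_gradient (\<lambda>x. \<sigma> (\<psi> x)) (\<lambda>x. \<sigma>' (\<psi> x) *\<^sub>R g x)"
  unfolding C1_gradient_def
proof (intro conjI allI)
  show "continuous_on UNIV (\<lambda>x. \<sigma>' (\<psi> x) *\<^sub>R g x)"
    by (intro continuous_on_scaleR continuous_on_compose2[OF \<sigma>(2) C1_gradient_continuous(2)[OF assms(1)]]
        C1_gradient_continuous(1)[OF assms(1)]) simp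
  fix x
  have "(\<sigma> has_derivative (*) (\<sigma>' (\<psi> x))) (at (\<psi> x))"
    using \<sigma>(1) by (simp add: has_field_derivative_def)
  from diff_chain_at[OF C1_gradient_derivative[OF assms(1), of x] this]
  show "((\<lambda>x. \<sigma> (\<psi> x)) has_derivative (\<lambda>w. (\<sigma>' (\<psi> x) *\<^sub>R g x) \<bullet> w)) (at x)"
    by (simp add: o_def)
qed

text \<open>
  With \<open>q t = (max 0 t)\<^sup>2\<close>, a function of class \<open>C\<^sup>1\<close>, the function \<open>t \<mapsto> q (1 - q t)\<close> is \<open>1\<close> for \<open>t \<le> 0\<close> and
  \<open>0\<close> for \<open>t \<ge> 1\<close>; the argument \<open>a\<close> is quadratic in the distance from \<open>p\<close>, with \<open>a \<le> 0\<close> up to distance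
  \<open>r/2\<close> and \<open>a \<ge> 1\<close> from distance \<open>r\<close> on.
\<close>

lemma bump_exists:
  fixes p :: "'a::euclidean_space"
  assumes r: "r > 0"
  obtains \<beta> b where "C1_gradient \<beta> b" "\<And>x. r \<le> dist p x \<Longrightarrow> \<beta> x = 0"
    "\<And>x. dist p x \<le> r / 2 \<Longrightarrow> \<beta> x = 1"
proof -
  define q where "q t = (max 0 t)\<^sup>2" for t :: real
  have q: "(q has_real_derivative 2 * max 0 t) (at t)" for t
    using positive_part_square_derivative[of t] by (simp add: q_def[abs_def])
  define a where "a x = 4 / (3 * r\<^sup>2) * ((x - p) \<bullet> (x - p)) - 1 / 3" for x
  have a: "C1_gradient a (\<lambda>x. (8 / (3 * r\<^sup>2)) *\<^sub>R (x - p))"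
    unfolding C1_gradient_def a_def
  proof (intro conjI allI)
    fix x
    have "((\<lambda>x. (x - p) \<bullet> (x - p)) has_derivative (\<lambda>w. 2 * ((x - p) \<bullet> w))) (at x)"
      by (auto intro!: derivative_eq_intros simp: inner_commute)
    then have "((\<lambda>x. 4 / (3 * r\<^sup>2) * ((x - p) \<bullet> (x - p)) - 1 / 3) has_derivative
        (\<lambda>w. 4 / (3 * r\<^sup>2) * (2 * ((x - p) \<bullet> w)) - 0)) (at x)"
      by (intro has_derivative_diff has_derivative_const has_derivative_mult_right)
    then show "((\<lambda>x. 4 / (3 * r\<^sup>2) * ((x - p) \<bullet> (x - p)) - 1 / 3) has_derivative
        (\<lambda>w. ((8 / (3 * r\<^sup>2)) *\<^sub>R (x - p)) \<bullet> w)) (at x)"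
      by simp
  qed (intro continuous_intros)
  have qa: "C1_gradient (\<lambda>x. q (1 - q (a x))) (\<lambda>x. (2 * max 0 (1 - q (a x))) *\<^sub>R - ((2 * max 0 (a x)) *\<^sub>R (8 / (3 * r\<^sup>2)) *\<^sub>R (x - p)))"
    by (intro C1_gradient_compose C1_gradient_one_minus a q continuous_intros)
  show thesis
  proof (rule that[OF qa])
    fix x
    have n2: "(x - p) \<bullet> (x - p) = (dist p x)\<^sup>2"
      by (simp add: dist_norm power2_norm_eq_inner[symmetric] norm_minus_commute)
    have r2: "0 < r\<^sup>2" using r by simp
    define Y where "Y = (dist p x)\<^sup>2 / r\<^sup>2"
    have ax: "a x = (4 * Y - 1) / 3"
      unfolding a_def n2 Y_def by (simp add: diff_divide_distrib)
    { assume "r \<le> dist p x"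
      then have "r\<^sup>2 \<le> (dist p x)\<^sup>2" using r by (intro power_mono) auto
      then have "1 \<le> Y" unfolding Y_def le_divide_eq_1_pos[OF r2] .
      then have "1 \<le> a x" unfolding ax by (simp add: pos_le_divide_eq)
      then have "1 \<le> q (a x)" by (simp add: q_def)
      then have "max 0 (1 - q (a x)) = 0" by simp
      then show "q (1 - q (a x)) = 0" by (simp only: q_def[of "1 - q (a x)"]) simp }
    { assume "dist p x \<le> r / 2"
      then have "(dist p x)\<^sup>2 \<le> (r / 2)\<^sup>2" by (intro power_mono) auto
      then have "Y \<le> 1 / 4" unfolding Y_def pos_divide_le_eq[OF r2] by (simp add: power_divide)
      then have "a x \<le> 0" unfolding ax by (simp add: pos_divide_le_eq)
      then have "max 0 (a x) = 0" by (rule max_absorb1)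
      then have "q (a x) = 0" unfolding q_def by simp
      moreover have "q 1 = 1" unfolding q_def by simp
      ultimately show "q (1 - q (a x)) = 1" by simp }
  qed
qed

context oriented_hypersurface
begin

text \<open>
  In graph coordinates over the hyperplane orthogonal to \<open>n\<close> the integrand is \<open>\<langle>N, n\<rangle>\<close> times the
  derivative in direction \<open>v\<close> of the test function, and the coordinates absorb the factor
  \<open>\<langle>N, n\<rangle>\<close>.  The support condition makes the coordinate expression \<open>f\<close> vanish near the boundary
  of the chart, so that its extension by zero is still differentiable along \<open>v\<close>.
\<close>

lemma integral_tangential_derivative_local:
  assumes p: "p \<in> S" and n: "norm n = 1" and np: "N p \<bullet> n > 0"
  shows "\<exists>r>0. \<forall>\<psi> g v. C1_gradient \<psi> g \<longrightarrow> v \<bullet> n = 0 \<longrightarrow> (\<forall>x. r \<le> dist p x \<longrightarrow> \<psi> x = 0) \<longrightarrow>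
    (LINT x:S|H. (N x \<bullet> n) * (g x \<bullet> v) - (N x \<bullet> v) * (g x \<bullet> n)) = 0"
proof -
  let ?P = "tangential_projection n"
  obtain r1 C where r1: "0 < r1" "0 < C"
    "\<And>x y. x \<in> S \<inter> ball p r1 \<Longrightarrow> y \<in> S \<inter> ball p r1 \<Longrightarrow> norm (x - y) \<le> C * norm (?P x - ?P y)"
    using inverse_projection_lipschitz[OF p n np] by blast
  obtain r2 where r2: "r2 > 0" "\<forall>x\<in>S \<inter> ball p r2. 0 < N x \<bullet> n \<and> N x \<bullet> n < N p \<bullet> n + 1"
    using normal_continuous[OF p, of 0 n "N p \<bullet> n + 1"] np by auto
  define R where "R = min r1 r2 / 2"
  have R: "0 < R" "R < r1" "R < r2" using r1(1) r2(1) by (auto simp: R_def min_def)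
  define K where "K = S \<inter> cball p R"
  have K: "compact K" "K \<subseteq> S" using compact by (auto simp: K_def intro: compact_Int_closed)
  have npK: "N x \<bullet> n > 0" if "x \<in> K" for x using r2(2) that R by (auto simp: K_def)
  have inj: "inj_on ?P K"
  proof (rule inj_onI)
    fix x y assume xy: "x \<in> K" "y \<in> K" "?P x = ?P y"
    then have "norm (x - y) \<le> C * norm (?P x - ?P y)" using R by (intro r1(3)) (auto simp: K_def)
    then show "x = y" using xy by simp
  qed
  define G where "G = the_inv_into K ?P"
  have contP: "continuous_on K ?P" by (intro continuous_intros)
  have GP: "G (?P x) = x" if "x \<in> K" for x using that inj by (simp add: G_def the_inv_into_f_f)
  have contG: "continuous_on (?P ` K) G"
    unfolding G_def by (rule continuous_on_inv_into[OF contP K(1) inj])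
  have cPK: "compact (?P ` K)" by (rule compact_continuous_image[OF contP K(1)])
  have bPK: "?P ` K \<in> sets borel" using cPK by (simp add: borel_closed compact_imp_closed)
  have GK: "G ` ?P ` K \<subseteq> K" using GP by auto
  show ?thesis
  proof (intro exI[of _ "R / 2"] conjI allI impI)
    show "0 < R / 2" using R by simp
    fix \<psi> :: "'a \<Rightarrow> real" and g v
    assume C1: "C1_gradient \<psi> g" and v: "v \<bullet> n = 0" and supp: "\<forall>x. R / 2 \<le> dist p x \<longrightarrow> \<psi> x = 0"
    have g0: "g x = 0" if "R / 2 < dist p x" for x
    proof (rule C1_gradient_zero[OF C1])
      show "open (- cball p (R / 2))" by (intro open_Compl closed_cball)
    qed (use that supp in auto)
    define h where "h x = g x \<bullet> (v - ((N x \<bullet> v) / (N x \<bullet> n)) *\<^sub>R n)" for x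
    have conth: "continuous_on K h"
      unfolding h_def using npK
      by (intro continuous_intros C1_gradient_continuous[OF C1] continuous_on_subset[OF cont K(2)]) fastforce
    define u where "u y = (if y \<in> ?P ` K then h (G y) else 0)" for y
    define f where "f y = (if y \<in> ?P ` K then \<psi> (G y) else 0)" for y
    have contu: "continuous_on (?P ` K) (\<lambda>y. h (G y))"
      by (rule continuous_on_compose2[OF conth contG GK])
    have contf: "continuous_on (?P ` K) (\<lambda>y. \<psi> (G y))"
      by (rule continuous_on_compose2[OF C1_gradient_continuous(2)[OF C1, of K] contG GK])
    have "(\<lambda>y. indicator (?P ` K) y *\<^sub>R h (G y)) \<in> borel_measurable borel"
      by (rule borel_measurable_continuous_on_indicator[OF bPK contu])
    also have "(\<lambda>y. indicator (?P ` K) y *\<^sub>R h (G y)) = u" by (auto simp: u_def fun_eq_iff)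
    finally have um: "u \<in> borel_measurable borel" .
    have "(\<lambda>y. indicator (?P ` K) y *\<^sub>R \<psi> (G y)) \<in> borel_measurable borel"
      by (rule borel_measurable_continuous_on_indicator[OF bPK contf])
    also have "(\<lambda>y. indicator (?P ` K) y *\<^sub>R \<psi> (G y)) = f" by (auto simp: f_def fun_eq_iff)
    finally have fm: "f \<in> borel_measurable borel" .
    have bnd: "\<exists>B\<ge>0. \<forall>y\<in>?P ` K. \<bar>w y\<bar> \<le> B" if "continuous_on (?P ` K) w" for w :: "'a \<Rightarrow> real"
      using compact_imp_bounded[OF compact_continuous_image[OF that cPK]]
      unfolding bounded_pos by (auto intro: less_imp_le)
    obtain A where A: "A \<ge> 0" "\<And>y. y \<in> ?P ` K \<Longrightarrow> \<bar>\<psi> (G y)\<bar> \<le> A" using bnd[OF contf] by blast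
    obtain B where B: "B \<ge> 0" "\<And>y. y \<in> ?P ` K \<Longrightarrow> \<bar>h (G y)\<bar> \<le> B" using bnd[OF contu] by blast
    obtain M where M: "\<And>y. y \<in> ?P ` K \<Longrightarrow> norm y \<le> M"
      using compact_imp_bounded[OF cPK] unfolding bounded_iff by blast
    have lim: "((\<lambda>s. y + s *\<^sub>R v) \<longlongrightarrow> y) (nhds (0::real))" for y :: 'a
    proof -
      have "((\<lambda>s. y + s *\<^sub>R v) \<longlongrightarrow> y + 0 *\<^sub>R v) (nhds (0::real))"
        by (intro tendsto_intros filterlim_ident)
      then show ?thesis by simp
    qed
    have flat_case: "((\<lambda>s. f (y + s *\<^sub>R v)) has_real_derivative 0) (at 0)"
      if "\<forall>\<^sub>F z in nhds y. f z = 0" for y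
    proof -
      have "\<forall>\<^sub>F s in nhds 0. f (y + s *\<^sub>R v) = 0"
        using eventually_compose_filterlim[OF that lim] .
      then have "((\<lambda>s. f (y + s *\<^sub>R v)) has_real_derivative 0) (at 0) \<longleftrightarrow> ((\<lambda>s. 0) has_real_derivative 0) (at (0::real))"
        by (intro DERIV_cong_ev) auto
      then show ?thesis by simp
    qed
    have der: "((\<lambda>s. f (y + s *\<^sub>R v)) has_real_derivative u y) (at 0)" for y
    proof (cases "y \<in> ?P ` K")
      case False
      have "\<forall>\<^sub>F z in nhds y. z \<in> - (?P ` K)"
        using False compact_imp_closed[OF cPK] by (intro eventually_nhds_in_open) auto
      then have "\<forall>\<^sub>F z in nhds y. f z = 0" by (rule eventually_mono) (simp add: f_def)
      from flat_case[OF this] show ?thesis using False by (simp add: u_def)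
    next
      case True
      then obtain q where q: "q \<in> K" "y = ?P q" by blast
      have Gy: "G y = q" using GP q by simp
      have qS: "q \<in> S" using q K by blast
      show ?thesis
      proof (cases "dist p q < R")
        case True
        obtain c where c: "c 0 = q" "\<forall>\<^sub>F s in nhds (0::real). c s \<in> S \<and> ?P (c s) = ?P q + s *\<^sub>R v"
          "(c has_vector_derivative (v - ((N q \<bullet> v) / (N q \<bullet> n)) *\<^sub>R n)) (at 0)"
          using tangent_curve[OF qS n npK[OF q(1)] v] by blast
        have "isCont c 0" using has_vector_derivative_continuous[OF c(3)] .
        then have "(c \<longlongrightarrow> c 0) (nhds 0)" by (simp only: isCont_def tendsto_at_iff_tendsto_nhds)
        then have "\<forall>\<^sub>F s in nhds 0. c s \<in> ball p R"
          by (rule topological_tendstoD) (use True c(1) in auto)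
        with c(2) have "\<forall>\<^sub>F s in nhds 0. f (y + s *\<^sub>R v) = \<psi> (c s)"
        proof eventually_elim
          fix s assume s: "c s \<in> S \<and> ?P (c s) = ?P q + s *\<^sub>R v" "c s \<in> ball p R"
          then have cK: "c s \<in> K" by (auto simp: K_def)
          have "y + s *\<^sub>R v = ?P (c s)" using s q by simp
          then show "f (y + s *\<^sub>R v) = \<psi> (c s)" using cK GP by (simp add: f_def)
        qed
        then have eq: "((\<lambda>s. f (y + s *\<^sub>R v)) has_real_derivative h q) (at 0) \<longleftrightarrow> ((\<lambda>s. \<psi> (c s)) has_real_derivative h q) (at 0)"
          by (intro DERIV_cong_ev) auto
        let ?d = "v - ((N q \<bullet> v) / (N q \<bullet> n)) *\<^sub>R n"
        have "(\<psi> \<circ> c has_derivative (\<lambda>w. g q \<bullet> w) \<circ> (\<lambda>s. s *\<^sub>R ?d)) (at 0)"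
        proof (rule diff_chain_at)
          show "(c has_derivative (\<lambda>s. s *\<^sub>R ?d)) (at 0)" using c(3) by (simp only: has_vector_derivative_def)
          show "(\<psi> has_derivative (\<lambda>w. g q \<bullet> w)) (at (c 0))"
            unfolding c(1) by (rule C1_gradient_derivative[OF C1])
        qed
        moreover have "(\<lambda>w. g q \<bullet> w) \<circ> (\<lambda>s. s *\<^sub>R ?d) = (*) (h q)"
          by (rule ext) (simp only: o_def inner_scaleR_right h_def mult.commute)
        ultimately have "((\<lambda>s. \<psi> (c s)) has_real_derivative h q) (at 0)"
          by (simp only: has_field_derivative_def o_def)
        then show ?thesis using eq \<open>y \<in> ?P ` K\<close> Gy by (simp add: u_def)
      next
        case far: False
        have "continuous_on (?P ` K) (\<lambda>z. dist p (G z))" by (intro continuous_intros contG)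
        then have "((\<lambda>z. dist p (G z)) \<longlongrightarrow> dist p (G y)) (at y within ?P ` K)"
          unfolding continuous_on_def by (rule bspec[OF _ True])
        then have "\<forall>\<^sub>F z in at y within ?P ` K. R / 2 < dist p (G z)"
          by (rule order_tendstoD) (use far R Gy in auto)
        then have "\<forall>\<^sub>F z in nhds y. f z = 0"
          unfolding eventually_at_filter
        proof (rule eventually_mono)
          fix z assume z: "z \<noteq> y \<longrightarrow> z \<in> ?P ` K \<longrightarrow> R / 2 < dist p (G z)"
          show "f z = 0"
          proof (cases "z \<in> ?P ` K")
            case True
            then have "R / 2 \<le> dist p (G z)" using z far R Gy by (cases "z = y") auto
            then show ?thesis using supp by (simp add: f_def)
          qed (simp add: f_def)
        qed
        moreover have "u y = 0" using far R Gy g0[of q] by (simp add: u_def h_def)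
        ultimately show ?thesis using flat_case by simp
      qed
    qed
    have "(LINT x:S|H. (N x \<bullet> n) * (g x \<bullet> v) - (N x \<bullet> v) * (g x \<bullet> n)) = (LINT x:K|H. (N x \<bullet> n) * h x)"
      unfolding set_lebesgue_integral_def
    proof (rule Bochner_Integration.integral_cong)
      fix x
      show "indicator S x *\<^sub>R ((N x \<bullet> n) * (g x \<bullet> v) - (N x \<bullet> v) * (g x \<bullet> n)) = indicator K x *\<^sub>R ((N x \<bullet> n) * h x)"
      proof (cases "x \<in> K")
        case True
        then show ?thesis using npK[OF True] K(2)
          by (auto simp: h_def inner_diff_right field_simps)
      next
        case False
        then have "x \<notin> S \<or> g x = 0" using g0[of x] R by (auto simp: K_def)
        then show ?thesis using False by auto
      qed
    qed simp
    also have "\<dots> = (LINT y|plane_measure n. u y)"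
      by (rule integral_projection[OF K n npK inj um]) (auto simp: u_def GP)
    also have "\<dots> = 0"
    proof (rule integral_directional_derivative_plane[OF n dim v fm um der, where A = A and B = B and R = M])
      show "\<bar>f y\<bar> \<le> A" for y using A by (auto simp: f_def)
      show "\<bar>u y\<bar> \<le> B" for y using B by (auto simp: u_def)
      show "f y = 0" if "M < norm y" for y using M[of y] that by (auto simp: f_def)
    qed
    finally show "(LINT x:S|H. (N x \<bullet> n) * (g x \<bullet> v) - (N x \<bullet> v) * (g x \<bullet> n)) = 0" .
  qed
qed

text \<open>
  The integral of the derivative of a function with gradient \<open>g\<close> along the tangential field
  \<open>\<langle>N, e\<rangle> f - \<langle>N, f\<rangle> e\<close>; it is bilinear and alternating in \<open>e\<close> and \<open>f\<close>.
\<close>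

definition tangential_flux :: "'a \<Rightarrow> 'a \<Rightarrow> ('a \<Rightarrow> 'a) \<Rightarrow> real" where
  "tangential_flux e f g = (LINT x:S|H. (N x \<bullet> e) * (g x \<bullet> f) - (N x \<bullet> f) * (g x \<bullet> e))"

lemma tangential_flux_integrable:
  assumes "continuous_on S g"
  shows "set_integrable H S (\<lambda>x. (N x \<bullet> e) * (g x \<bullet> f) - (N x \<bullet> f) * (g x \<bullet> e))"
proof -
  have "continuous_on S (\<lambda>x. N x \<bullet> a)" "continuous_on S (\<lambda>x. g x \<bullet> a)" for a
    by (rule continuous_on_inner[OF cont continuous_on_const], rule continuous_on_inner[OF assms continuous_on_const])
  then show ?thesis by (intro set_integrable_continuous continuous_on_diff continuous_on_mult)
qed

lemma tangential_flux_diff_left: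
  assumes "continuous_on S g"
  shows "tangential_flux (e - e') f g = tangential_flux e f g - tangential_flux e' f g"
  unfolding tangential_flux_def
  by (subst set_integral_diff(2)[symmetric, OF tangential_flux_integrable[OF assms] tangential_flux_integrable[OF assms]])
     (simp add: inner_diff_right algebra_simps)

lemma tangential_flux_add:
  assumes "continuous_on S g" "continuous_on S g'"
  shows "tangential_flux e f (\<lambda>x. g x + g' x) = tangential_flux e f g + tangential_flux e f g'"
  unfolding tangential_flux_def
  by (subst set_integral_add(2)[symmetric, OF tangential_flux_integrable[OF assms(1)] tangential_flux_integrable[OF assms(2)]])
     (simp add: inner_add_left algebra_simps)

text \<open>
  Since \<open>tangential_flux\<close> is alternating, only the part of \<open>f\<close> orthogonal to \<open>m\<close> matters.
\<close>

lemma tangential_flux_transversal: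
  assumes p: "p \<in> S" and m: "N p \<bullet> m > 0"
  shows "\<exists>r>0. \<forall>\<psi> g f. C1_gradient \<psi> g \<longrightarrow> (\<forall>x. r \<le> dist p x \<longrightarrow> \<psi> x = 0) \<longrightarrow> tangential_flux m f g = 0"
proof -
  have m0: "m \<noteq> 0" using m by auto
  define n where "n = m /\<^sub>R norm m"
  have n: "norm n = 1" using m0 by (simp add: n_def)
  have np: "N p \<bullet> n > 0" using m m0 by (simp add: n_def)
  have mn: "m = norm m *\<^sub>R n" using m0 by (simp add: n_def)
  obtain r where r: "r > 0" "\<And>\<psi> g v. C1_gradient \<psi> g \<Longrightarrow> v \<bullet> n = 0 \<Longrightarrow> (\<And>x. r \<le> dist p x \<Longrightarrow> \<psi> x = 0) \<Longrightarrow>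
    tangential_flux n v g = 0"
    using integral_tangential_derivative_local[OF p n np] unfolding tangential_flux_def by blast
  show ?thesis
  proof (intro exI[of _ r] conjI allI impI r(1))
    fix \<psi> :: "'a \<Rightarrow> real" and g f
    assume C1: "C1_gradient \<psi> g" and supp: "\<forall>x. r \<le> dist p x \<longrightarrow> \<psi> x = 0"
    have fn: "tangential_projection n f \<bullet> n = 0" by (rule inner_tangential_projection[OF n])
    have "tangential_flux m f g = (LINT x:S|H. norm m * ((N x \<bullet> n) * (g x \<bullet> tangential_projection n f) - (N x \<bullet> tangential_projection n f) * (g x \<bullet> n)))"
      unfolding tangential_flux_def
    proof (intro arg_cong[of _ _ "\<lambda>f. set_lebesgue_integral H S f"] ext)
      fix x
      have "y \<bullet> m = norm m * (y \<bullet> n)" for y by (subst mn) simp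
      then show "(N x \<bullet> m) * (g x \<bullet> f) - (N x \<bullet> f) * (g x \<bullet> m) =
        norm m * ((N x \<bullet> n) * (g x \<bullet> tangential_projection n f) - (N x \<bullet> tangential_projection n f) * (g x \<bullet> n))"
        by (simp add: tangential_projection_def inner_diff_right algebra_simps)
    qed
    also have "\<dots> = norm m * tangential_flux n (tangential_projection n f) g"
      unfolding tangential_flux_def by simp
    also have "\<dots> = 0" using r(2)[OF C1 fn] supp by simp
    finally show "tangential_flux m f g = 0" .
  qed
qed

text \<open>
  Every direction \<open>e\<close> is the difference of two directions that are transversal to the
  hypersurface at \<open>p\<close>, namely \<open>e + m'\<close> and \<open>m'\<close> for a large multiple \<open>m'\<close> of the normal.
\<close>

lemma tangential_flux_local:
  assumes p: "p \<in> S"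
  shows "\<exists>r>0. \<forall>\<psi> g. C1_gradient \<psi> g \<longrightarrow> (\<forall>x. r \<le> dist p x \<longrightarrow> \<psi> x = 0) \<longrightarrow> tangential_flux e f g = 0"
proof -
  \<comment> \<open>Large enough for \<open>e + m'\<close> to have a positive normal component.\<close>
  define m' where "m' = (norm e + 1) *\<^sub>R N p"
  have NN: "N p \<bullet> N p = 1" using unit[OF p] by (simp add: norm_eq_1)
  have "\<bar>N p \<bullet> e\<bar> \<le> norm e" using Cauchy_Schwarz_ineq2[of "N p" e] unit[OF p] by simp
  then have pos: "N p \<bullet> (e + m') > 0" "N p \<bullet> m' > 0"
    using NN by (simp_all add: m'_def inner_add_right add_nonneg_pos)
  obtain r1 where r1: "r1 > 0" "\<And>\<psi> g. C1_gradient \<psi> g \<Longrightarrow> (\<And>x. r1 \<le> dist p x \<Longrightarrow> \<psi> x = 0) \<Longrightarrow> tangential_flux (e + m') f g = 0"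
    using tangential_flux_transversal[OF p pos(1)] by blast
  obtain r2 where r2: "r2 > 0" "\<And>\<psi> g. C1_gradient \<psi> g \<Longrightarrow> (\<And>x. r2 \<le> dist p x \<Longrightarrow> \<psi> x = 0) \<Longrightarrow> tangential_flux m' f g = 0"
    using tangential_flux_transversal[OF p pos(2)] by blast
  show ?thesis
  proof (intro exI[of _ "min r1 r2"] conjI allI impI)
    show "0 < min r1 r2" using r1(1) r2(1) by simp
    fix \<psi> :: "'a \<Rightarrow> real" and g
    assume C1: "C1_gradient \<psi> g" and supp: "\<forall>x. min r1 r2 \<le> dist p x \<longrightarrow> \<psi> x = 0"
    have "tangential_flux (e + m' - m') f g = tangential_flux (e + m') f g - tangential_flux m' f g"
      by (rule tangential_flux_diff_left[OF C1_gradient_continuous(1)[OF C1]])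
    also have "\<dots> = 0"
      using r1(2)[OF C1] r2(2)[OF C1] supp by simp
    finally show "tangential_flux e f g = 0" by simp
  qed
qed

text \<open>
  Instead of a partition of unity: multiplying \<open>\<psi>\<close> by \<open>1 - \<beta>\<close> for a bump function \<open>\<beta>\<close> with small
  support does not change the integral, and after finitely many steps \<open>\<psi>\<close> vanishes near \<open>S\<close>.
\<close>

lemma tangential_flux_zero:
  assumes C1: "C1_gradient \<psi> g"
  shows "tangential_flux e f g = 0"
proof -
  obtain r where r: "\<And>p. p \<in> S \<Longrightarrow> r p > 0 \<and> (\<forall>\<psi> g. C1_gradient \<psi> g \<longrightarrow> (\<forall>x. r p \<le> dist p x \<longrightarrow> \<psi> x = 0) \<longrightarrow> tangential_flux e f g = 0)"
    using tangential_flux_local[of _ e f] by metis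
  have "S \<subseteq> (\<Union>p\<in>S. ball p (r p / 2))" using r by force
  then obtain F where F: "F \<subseteq> S" "finite F" "S \<subseteq> (\<Union>p\<in>F. ball p (r p / 2))"
    using compactE_image[OF compact, of S "\<lambda>p. ball p (r p / 2)"] by auto
  have "tangential_flux e f g = 0"
    if "finite F" "F \<subseteq> S" "C1_gradient \<psi> g" "open U" "\<And>x. x \<in> U \<Longrightarrow> \<psi> x = 0" "S \<subseteq> U \<union> (\<Union>p\<in>F. ball p (r p / 2))"
    for F U \<psi> g
    using that
  proof (induction F arbitrary: U \<psi> g)
    case empty
    then have "g x = 0" if "x \<in> S" for x using that C1_gradient_zero[of \<psi> g U x] by auto
    then have "tangential_flux e f g = (LINT x:S|H. 0)"
      unfolding tangential_flux_def by (intro set_lebesgue_integral_cong) auto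
    then show ?case by simp
  next
    case (insert p F)
    have p: "p \<in> S" "r p > 0" using insert.prems(1) r by auto
    obtain \<beta> b where \<beta>: "C1_gradient \<beta> b" "\<And>x. r p \<le> dist p x \<Longrightarrow> \<beta> x = 0" "\<And>x. dist p x \<le> r p / 2 \<Longrightarrow> \<beta> x = 1"
      using bump_exists[OF p(2)] by blast
    note C1 = insert.prems(2)
    have in': "C1_gradient (\<lambda>x. \<beta> x * \<psi> x) (\<lambda>x. \<beta> x *\<^sub>R g x + \<psi> x *\<^sub>R b x)"
      by (rule C1_gradient_mult[OF C1 \<beta>(1)])
    have out: "C1_gradient (\<lambda>x. (1 - \<beta> x) * \<psi> x) (\<lambda>x. (1 - \<beta> x) *\<^sub>R g x + \<psi> x *\<^sub>R - b x)"
      by (rule C1_gradient_mult[OF C1 C1_gradient_one_minus[OF \<beta>(1)]])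
    have "tangential_flux e f (\<lambda>x. \<beta> x *\<^sub>R g x + \<psi> x *\<^sub>R b x) = 0"
    proof -
      have "\<forall>x. r p \<le> dist p x \<longrightarrow> \<beta> x * \<psi> x = 0" using \<beta>(2) by simp
      with r[OF p(1)] in' show ?thesis by blast
    qed
    moreover have "tangential_flux e f (\<lambda>x. (1 - \<beta> x) *\<^sub>R g x + \<psi> x *\<^sub>R - b x) = 0"
    proof (rule insert.IH[OF _ out])
      show "open (U \<union> ball p (r p / 2))" using insert.prems(3) by auto
      show "(1 - \<beta> x) * \<psi> x = 0" if "x \<in> U \<union> ball p (r p / 2)" for x
        using that insert.prems(4)[of x] \<beta>(3)[of x] by auto
    qed (use insert.prems in auto)
    moreover have "tangential_flux e f (\<lambda>x. (\<beta> x *\<^sub>R g x + \<psi> x *\<^sub>R b x) + ((1 - \<beta> x) *\<^sub>R g x + \<psi> x *\<^sub>R - b x))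
      = tangential_flux e f (\<lambda>x. \<beta> x *\<^sub>R g x + \<psi> x *\<^sub>R b x) + tangential_flux e f (\<lambda>x. (1 - \<beta> x) *\<^sub>R g x + \<psi> x *\<^sub>R - b x)"
      by (intro tangential_flux_add C1_gradient_continuous[OF in'] C1_gradient_continuous[OF out])
    moreover have "(\<lambda>x. (\<beta> x *\<^sub>R g x + \<psi> x *\<^sub>R b x) + ((1 - \<beta> x) *\<^sub>R g x + \<psi> x *\<^sub>R - b x)) = g"
      by (simp add: fun_eq_iff scaleR_diff_left)
    ultimately show ?case by simp
  qed
  from this[OF F(2,1) C1, of "{}"] F(3) show ?thesis by simp
qed

text \<open>
  Here the dimension enters: a unit vector \<open>f\<close> orthogonal to \<open>e\<close> is needed, and the linear
  function with gradient \<open>f\<close> turns the tangential flux into the integral of \<open>\<langle>N, e\<rangle>\<close>.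
\<close>

theorem integral_normal_eq_0: "(LINT x:S|H. N x \<bullet> e) = 0"
proof -
  obtain f0 where f0: "f0 \<noteq> 0" "orthogonal e f0" using orthogonal_to_vector_exists[OF dim] by blast
  define f where "f = f0 /\<^sub>R norm f0"
  have "norm f = 1" using f0(1) by (simp add: f_def)
  then have f: "f \<bullet> f = 1" "f \<bullet> e = 0"
    using f0(2) by (simp_all only: norm_eq_1) (simp add: f_def orthogonal_def inner_commute)
  have "C1_gradient (\<lambda>x. f \<bullet> x) (\<lambda>_. f)"
    unfolding C1_gradient_def by (auto intro!: derivative_eq_intros)
  from tangential_flux_zero[OF this, of e f] show ?thesis
    by (simp add: tangential_flux_def f)
qed

end

section \<open>Hypersurfaces with a Gauss map\<close>

lemma linear_norm_le_basis_sum: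
  fixes L :: "'a::euclidean_space \<Rightarrow> 'b::real_normed_vector"
  assumes "linear L"
  shows "norm (L w) \<le> (\<Sum>i\<in>Basis. norm (L i)) * norm w"
proof -
  have "L w = (\<Sum>i\<in>Basis. (w \<bullet> i) *\<^sub>R L i)"
    by (subst euclidean_representation[of w, symmetric]) (simp add: linear_sum[OF assms] linear_scale[OF assms])
  also have "norm \<dots> \<le> (\<Sum>i\<in>Basis. norm (L i) * norm w)"
  proof (rule sum_norm_le)
    fix i :: 'a assume "i \<in> Basis"
    then have "\<bar>w \<bullet> i\<bar> * norm (L i) \<le> norm w * norm (L i)"
      by (intro mult_right_mono Basis_le_norm) auto
    then show "norm ((w \<bullet> i) *\<^sub>R L i) \<le> norm (L i) * norm w" by (simp add: mult.commute)
  qed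
  finally show ?thesis by (simp add: sum_distrib_right)
qed

text \<open>
  The mean value inequality for \<open>X\<close> minus its derivative at \<open>u0\<close>; strictness (two moving points)
  is what makes the surface flat in the sense of \<open>oriented_hypersurface\<close>.
\<close>

lemma C1_strictly_differentiable:
  fixes X :: "'a::euclidean_space \<Rightarrow> 'b::real_normed_vector"
  assumes U: "open U" "u0 \<in> U" and diff: "\<And>x. x \<in> U \<Longrightarrow> X differentiable (at x)"
    and cont: "\<And>i. i \<in> Basis \<Longrightarrow> continuous_on U (\<lambda>x. frechet_derivative X (at x) i)"
    and \<eta>: "0 < \<eta>"
  shows "\<exists>\<delta>>0. ball u0 \<delta> \<subseteq> U \<and> (\<forall>u\<in>ball u0 \<delta>. \<forall>u'\<in>ball u0 \<delta>.
    norm (X u - X u' - frechet_derivative X (at u0) (u - u')) \<le> \<eta> * norm (u - u'))"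
proof -
  define D where "D = frechet_derivative X (at u0)"
  define X' where "X' x = frechet_derivative X (at x)" for x
  have der: "(X has_derivative X' x) (at x)" if "x \<in> U" for x
    using diff[OF that] by (simp add: X'_def frechet_derivative_works)
  have lin: "linear (X' x)" if "x \<in> U" for x
    using der[OF that] by (rule has_derivative_linear)
  have DX: "D = X' u0" by (simp add: D_def X'_def)
  have "continuous_on U (\<lambda>x. \<Sum>i\<in>Basis. norm (X' x i - D i))"
    unfolding X'_def by (intro continuous_intros cont)
  then have "((\<lambda>x. \<Sum>i\<in>Basis. norm (X' x i - D i)) \<longlongrightarrow> (\<Sum>i\<in>Basis. norm (X' u0 i - D i))) (at u0 within U)"
    using U(2) unfolding continuous_on_def by blast
  moreover have "(\<Sum>i\<in>Basis. norm (X' u0 i - D i)) = 0" by (simp add: DX)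
  ultimately have "\<forall>\<^sub>F x in at u0 within U. (\<Sum>i\<in>Basis. norm (X' x i - D i)) < \<eta>"
    using \<eta> by (intro order_tendstoD(2)) auto
  then have "\<forall>\<^sub>F x in at u0. (\<Sum>i\<in>Basis. norm (X' x i - D i)) < \<eta>"
    using at_within_open[OF U(2,1)] by simp
  then obtain \<delta>1 where \<delta>1: "\<delta>1 > 0" "\<And>x. x \<noteq> u0 \<Longrightarrow> dist x u0 < \<delta>1 \<Longrightarrow> (\<Sum>i\<in>Basis. norm (X' x i - D i)) < \<eta>"
    unfolding eventually_at by blast
  obtain \<delta>2 where \<delta>2: "\<delta>2 > 0" "ball u0 \<delta>2 \<subseteq> U" using U by (meson openE)
  define \<delta> where "\<delta> = min \<delta>1 \<delta>2"
  have \<delta>: "\<delta> > 0" "ball u0 \<delta> \<subseteq> U" using \<delta>1(1) \<delta>2 by (auto simp: \<delta>_def)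
  have small: "(\<Sum>i\<in>Basis. norm (X' x i - D i)) \<le> \<eta>" if "x \<in> ball u0 \<delta>" for x
    using \<delta>1(2)[of x] that \<eta> by (cases "x = u0") (auto simp: DX \<delta>_def dist_commute)
  have "norm (X u - X u' - D (u - u')) \<le> \<eta> * norm (u - u')"
    if u: "u \<in> ball u0 \<delta>" "u' \<in> ball u0 \<delta>" for u u'
  proof -
    have linD: "linear D" using lin[OF U(2)] by (simp add: DX)
    have "norm ((X u - D u) - (X u' - D u')) \<le> \<eta> * norm (u - u')"
    proof (rule differentiable_bound[OF convex_ball])
      fix x assume x: "x \<in> ball u0 \<delta>"
      then have xU: "x \<in> U" using \<delta> by blast
      show "((\<lambda>u. X u - D u) has_derivative (\<lambda>h. X' x h - D h)) (at x within ball u0 \<delta>)"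
        by (rule has_derivative_diff[OF has_derivative_at_withinI[OF der[OF xU]] linear_imp_has_derivative[OF linD]])
      have lin': "linear (\<lambda>h. X' x h - D h)" using lin[OF xU] linD by (rule linear_compose_sub)
      show "onorm (\<lambda>h. X' x h - D h) \<le> \<eta>"
      proof (rule onorm_le)
        fix h
        have "norm (X' x h - D h) \<le> (\<Sum>i\<in>Basis. norm (X' x i - D i)) * norm h"
          by (rule linear_norm_le_basis_sum[OF lin'])
        also have "\<dots> \<le> \<eta> * norm h" by (intro mult_right_mono small x) auto
        finally show "norm (X' x h - D h) \<le> \<eta> * norm h" .
      qed
    qed (use u in auto)
    then show ?thesis by (simp add: linear_diff[OF linD] algebra_simps)
  qed
  then show ?thesis using \<delta> unfolding D_def by blast
qed

lemma subspace_normal_plane: "subspace (normal_plane n)"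
  unfolding normal_plane_def by (auto simp: subspace_def inner_add_left)

lemma dim_normal_plane:
  fixes n :: "'a::euclidean_space"
  assumes "n \<noteq> 0"
  shows "dim (normal_plane n) = DIM('a) - 1"
  using dim_hyperplane[OF assms] by (simp add: normal_plane_def inner_commute)

locale hypersurface_with_normal =
  fixes M :: "('a::euclidean_space \<times> real) set" and \<gamma> :: "'a \<times> real \<Rightarrow> 'a \<times> real"
  assumes hyp: "embedded_hypersurface M" and gauss: "gauss_map M \<gamma>"
begin

lemma norm_gauss: "p \<in> M \<Longrightarrow> norm (\<gamma> p) = 1"
  using gauss by (simp add: gauss_map_def)

text \<open>
  What is used of a chart at \<open>p\<close>.  The image of the derivative consists of velocities of curves
  in \<open>M\<close>, so it lies in the hyperplane orthogonal to \<open>\<gamma> p\<close>, and equality follows by dimension.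
\<close>

lemma parametrization:
  assumes p: "p \<in> M"
  obtains U :: "'a set" and X :: "'a \<Rightarrow> 'a \<times> real" and u0 D where "open U" "u0 \<in> U" "X u0 = p" "X ` U \<subseteq> M" "continuous_on U X" "inj_on X U"
    "linear D" "inj D" "range D = normal_plane (\<gamma> p)" "range D \<subseteq> tangent_space M p"
    "\<forall>V. open V \<longrightarrow> V \<subseteq> U \<longrightarrow> openin (top_of_set M) (X ` V)"
    "\<forall>\<eta>>0. \<exists>\<delta>>0. ball u0 \<delta> \<subseteq> U \<and> (\<forall>u\<in>ball u0 \<delta>. \<forall>u'\<in>ball u0 \<delta>.
      norm (X u - X u' - D (u - u')) \<le> \<eta> * norm (u - u'))"
proof -
  obtain U X where UX: "local_parametrization M U X" "p \<in> X ` U"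
    using hyp p unfolding embedded_hypersurface_def by blast
  then obtain u0 where u0: "u0 \<in> U" "X u0 = p" by auto
  have U: "open U" and C2: "Ck_on 2 X U" and inj: "inj (frechet_derivative X (at u0))"
    and op: "openin (top_of_set M) (X ` U)"
    using UX u0 unfolding local_parametrization_def by auto
  obtain Y where Y: "homeomorphism U (X ` U) X Y" using UX unfolding local_parametrization_def by blast
  have diff: "X differentiable (at x)" if "x \<in> U" for x
    using C2 that by (simp add: numeral_2_eq_2)
  have cont: "continuous_on U (\<lambda>x. frechet_derivative X (at x) i)" if "i \<in> Basis" for i
    using C2 that U by (auto simp: numeral_2_eq_2 continuous_on_eq_continuous_at intro: differentiable_imp_continuous_within)
  define D where "D = frechet_derivative X (at u0)"
  have der: "(X has_derivative D) (at u0)"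
    using diff[OF u0(1)] by (simp add: D_def frechet_derivative_works)
  have lin: "linear D" using der by (rule has_derivative_linear)
  have XM: "X ` U \<subseteq> M" using op by (rule openin_imp_subset)
  have tan: "D w \<in> tangent_space M p" for w
  proof -
    define c where "c s = (if u0 + s *\<^sub>R w \<in> U then X (u0 + s *\<^sub>R w) else p)" for s :: real
    have "((\<lambda>s. u0 + s *\<^sub>R w) \<longlongrightarrow> u0 + 0 *\<^sub>R w) (nhds (0::real))"
      by (intro tendsto_intros filterlim_ident)
    then have ev: "\<forall>\<^sub>F s in nhds 0. u0 + s *\<^sub>R w \<in> U"
      using U u0 by (auto dest!: topological_tendstoD)
    have "((\<lambda>s. X (u0 + s *\<^sub>R w)) has_derivative (\<lambda>s. D (s *\<^sub>R w))) (at 0)"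
    proof -
      have "((\<lambda>s. u0 + s *\<^sub>R w) has_derivative (\<lambda>s. 0 + s *\<^sub>R w)) (at 0)"
        by (intro has_derivative_add has_derivative_const bounded_linear_imp_has_derivative bounded_linear_scaleR_left)
      moreover have "(X has_derivative D) (at (u0 + 0 *\<^sub>R w))" using der by simp
      ultimately show ?thesis using diff_chain_at by (force simp: o_def)
    qed
    then have v: "((\<lambda>s. X (u0 + s *\<^sub>R w)) has_vector_derivative D w) (at 0)"
      by (simp add: has_vector_derivative_def linear_scale[OF lin])
    obtain e where e: "e > 0" "\<And>s. dist s 0 < e \<Longrightarrow> u0 + s *\<^sub>R w \<in> U"
      using ev unfolding eventually_nhds_metric by blast
    have "(c has_vector_derivative D w) (at 0)"
      using v by (rule has_vector_derivative_transform_within_open[where S = "ball 0 e"])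
        (use e in \<open>auto simp: c_def dist_commute\<close>)
    moreover have "\<forall>\<^sub>F s in at 0. c s \<in> M"
      using p XM by (intro always_eventually) (auto simp: c_def)
    moreover have "c 0 = p" using u0 by (simp add: c_def)
    ultimately show ?thesis unfolding tangent_space_def by blast
  qed
  have sub: "range D \<subseteq> normal_plane (\<gamma> p)"
    using tan gauss p unfolding gauss_map_def normal_plane_def by (auto simp: inner_commute)
  have "\<gamma> p \<noteq> 0" using norm_gauss[OF p] by auto
  then have "dim (normal_plane (\<gamma> p)) = DIM('a)"
    by (simp add: dim_normal_plane)
  moreover have "dim (range D) = DIM('a)"
    using dim_image_eq[OF lin, of UNIV] inj by (simp add: D_def)
  ultimately have range: "range D = normal_plane (\<gamma> p)"
    using lin sub by (intro subspace_dim_equal subspace_normal_plane) (auto intro: linear_subspace_image)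
  have opV: "openin (top_of_set M) (X ` V)" if "open V" "V \<subseteq> U" for V
  proof -
    have "openin (top_of_set U) V" using that U by (simp add: openin_open_eq)
    then have "openin (top_of_set (X ` U)) (X ` V)"
      using homeomorphism_imp_open_map[OF Y] by blast
    then show ?thesis using op openin_trans by blast
  qed
  have strict: "\<exists>\<delta>>0. ball u0 \<delta> \<subseteq> U \<and> (\<forall>u\<in>ball u0 \<delta>. \<forall>u'\<in>ball u0 \<delta>.
      norm (X u - X u' - D (u - u')) \<le> \<eta> * norm (u - u'))" if "0 < \<eta>" for \<eta>
    unfolding D_def by (rule C1_strictly_differentiable[OF U u0(1) diff cont that])
  have 1: "continuous_on U X" by (rule homeomorphism_cont1[OF Y])
  have 2: "inj_on X U" by (rule inj_on_inverseI[where g = Y]) (rule homeomorphism_apply1[OF Y])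
  have 3: "inj D" using inj by (simp add: D_def)
  have 4: "range D \<subseteq> tangent_space M p" using tan by auto
  have 5: "\<forall>V. open V \<longrightarrow> V \<subseteq> U \<longrightarrow> openin (top_of_set M) (X ` V)" using opV by blast
  have 6: "\<forall>\<eta>>0. \<exists>\<delta>>0. ball u0 \<delta> \<subseteq> U \<and> (\<forall>u\<in>ball u0 \<delta>. \<forall>u'\<in>ball u0 \<delta>.
      norm (X u - X u' - D (u - u')) \<le> \<eta> * norm (u - u'))" using strict by blast
  show thesis
    by (rule that[of U u0 X D]) (fact U u0 XM lin range 1 2 3 4 5 6)+
qed

lemma tangent_space_eq:
  assumes p: "p \<in> M"
  shows "tangent_space M p = normal_plane (\<gamma> p)"
proof
  show "tangent_space M p \<subseteq> normal_plane (\<gamma> p)"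
    using gauss p unfolding gauss_map_def normal_plane_def by (auto simp: inner_commute)
  show "normal_plane (\<gamma> p) \<subseteq> tangent_space M p"
  proof -
    obtain D :: "'a \<Rightarrow> 'a \<times> real" where "range D = normal_plane (\<gamma> p)" "range D \<subseteq> tangent_space M p"
      by (rule parametrization[OF p]) (rule that, assumption+)
    then show ?thesis by simp
  qed
qed

lemma surface_flat:
  assumes p: "p \<in> M" and e: "0 < e"
  shows "\<exists>r>0. \<forall>x\<in>M \<inter> ball p r. \<forall>y\<in>M \<inter> ball p r. \<bar>\<gamma> p \<bullet> (x - y)\<bar> \<le> e * norm (x - y)"
proof -
  obtain U :: "'a set" and X :: "'a \<Rightarrow> 'a \<times> real" and u0 D where X: "open U" "u0 \<in> U" "X u0 = p" "X ` U \<subseteq> M" "continuous_on U X" "inj_on X U"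
    "linear D" "inj D" "range D = normal_plane (\<gamma> p)" "range D \<subseteq> tangent_space M p"
    "\<forall>V. open V \<longrightarrow> V \<subseteq> U \<longrightarrow> openin (top_of_set M) (X ` V)"
    "\<forall>\<eta>>0. \<exists>\<delta>>0. ball u0 \<delta> \<subseteq> U \<and> (\<forall>u\<in>ball u0 \<delta>. \<forall>u'\<in>ball u0 \<delta>.
      norm (X u - X u' - D (u - u')) \<le> \<eta> * norm (u - u'))"
    by (rule parametrization[OF p]) (rule that, assumption+)
  obtain c where c: "c > 0" "\<And>w. norm (D w) \<ge> c * norm w"
    using linear_inj_bounded_below_pos[OF X(7,8)] by (metis mult.commute)
  \<comment> \<open>Chosen so that \<open>\<eta> / (c - \<eta>) = e\<close>: chords are at least \<open>c - \<eta>\<close> times as long as in the chart.\<close>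
  define \<eta> where "\<eta> = c * e / (1 + e)"
  have eta: "0 < \<eta>" "\<eta> * (1 + e) = c * e" using c e by (auto simp: \<eta>_def)
  obtain \<delta> where \<delta>0: "\<delta> > 0" "ball u0 \<delta> \<subseteq> U" and \<delta>1: "\<forall>u\<in>ball u0 \<delta>. \<forall>u'\<in>ball u0 \<delta>.
      norm (X u - X u' - D (u - u')) \<le> \<eta> * norm (u - u')"
    using X(12)[rule_format, OF eta(1)] by blast
  note \<delta> = \<delta>0 \<delta>1[rule_format]
  have op: "openin (top_of_set M) (X ` ball u0 \<delta>)"
    by (rule X(11)[rule_format, OF open_ball \<delta>(2)])
  have "X u0 \<in> X ` ball u0 \<delta>" by (rule imageI) (simp add: \<delta>(1))
  then have mem: "p \<in> X ` ball u0 \<delta>" unfolding X(3) .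
  obtain r where r: "r > 0" "ball p r \<inter> M \<subseteq> X ` ball u0 \<delta>"
    using op[unfolded openin_contains_ball, THEN conjunct2, rule_format, OF mem] by blast
  show ?thesis
  proof (intro exI[of _ r] conjI ballI r(1))
    fix x y assume "x \<in> M \<inter> ball p r" "y \<in> M \<inter> ball p r"
    then obtain u u' where u: "u \<in> ball u0 \<delta>" "x = X u" "u' \<in> ball u0 \<delta>" "y = X u'"
      using r(2) by blast
    let ?R = "x - y - D (u - u')"
    have R: "norm ?R \<le> \<eta> * norm (u - u')" using \<delta>(3)[OF u(1,3)] u by simp
    have "D (u - u') \<in> normal_plane (\<gamma> p)" unfolding X(9)[symmetric] by (rule rangeI)
    then have "\<gamma> p \<bullet> D (u - u') = 0" by (simp add: normal_plane_def inner_commute)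
    then have "\<gamma> p \<bullet> (x - y) = \<gamma> p \<bullet> ?R" by (simp add: inner_diff_right)
    then have "\<bar>\<gamma> p \<bullet> (x - y)\<bar> \<le> norm ?R"
      using Cauchy_Schwarz_ineq2[of "\<gamma> p" ?R] norm_gauss[OF p] by simp
    then have 1: "\<bar>\<gamma> p \<bullet> (x - y)\<bar> \<le> \<eta> * norm (u - u')" using R by simp
    have "c * norm (u - u') \<le> norm (D (u - u'))" by (rule c)
    also have "\<dots> \<le> norm (x - y) + norm ?R"
      using norm_triangle_ineq4[of "x - y" ?R] by simp
    finally have "c * norm (u - u') \<le> norm (x - y) + \<eta> * norm (u - u')" using R by linarith
    then have "e * (c * norm (u - u')) \<le> e * (norm (x - y) + \<eta> * norm (u - u'))"
      using e by (intro mult_left_mono) auto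
    moreover have "e * (c * norm (u - u')) = \<eta> * norm (u - u') + e * (\<eta> * norm (u - u'))"
    proof -
      have "e * (c * norm (u - u')) = (c * e) * norm (u - u')" by simp
      also have "\<dots> = \<eta> * (1 + e) * norm (u - u')" by (simp only: eta(2))
      also have "\<dots> = \<eta> * norm (u - u') + e * (\<eta> * norm (u - u'))" by (simp add: algebra_simps)
      finally show ?thesis .
    qed
    ultimately have "\<eta> * norm (u - u') \<le> e * norm (x - y)" by (simp add: distrib_left)
    with 1 show "\<bar>\<gamma> p \<bullet> (x - y)\<bar> \<le> e * norm (x - y)" by linarith
  qed
qed

text \<open>
  Flatness makes the projection injective near \<open>p\<close> with a Lipschitz inverse; by invariance of
  domain its composition with a chart is open, so the surface is a graph over a full
  neighbourhood in the hyperplane orthogonal to \<open>m\<close>.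
\<close>

lemma surface_graph:
  assumes p: "p \<in> M" and m: "norm m = 1" and pos: "\<gamma> p \<bullet> m > 0" and r: "r > 0"
  obtains C \<rho> r' where "C > 0" "\<rho> > 0" "0 < r'" "r' \<le> r"
    "\<And>x y. x \<in> M \<inter> ball p r' \<Longrightarrow> y \<in> M \<inter> ball p r' \<Longrightarrow>
      norm (x - y) \<le> C * norm (tangential_projection m x - tangential_projection m y)"
    "\<And>z. z \<in> normal_plane m \<inter> ball (tangential_projection m p) \<rho> \<Longrightarrow>
      \<exists>x\<in>M \<inter> ball p r'. tangential_projection m x = z"
proof -
  let ?P = "tangential_projection m"
  define e where "e = (\<gamma> p \<bullet> m) / ((\<gamma> p \<bullet> m) + 2)"
  define C where "C = 2 / ((\<gamma> p \<bullet> m) * (1 - e))"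
  have e: "0 < e" "e < 1" using pos by (auto simp: e_def)
  have C: "0 < C" using pos e by (simp add: C_def)
  obtain r1 where r1: "r1 > 0" "\<And>x y. x \<in> M \<inter> ball p r1 \<Longrightarrow> y \<in> M \<inter> ball p r1 \<Longrightarrow> \<bar>\<gamma> p \<bullet> (x - y)\<bar> \<le> e * norm (x - y)"
    using surface_flat[OF p e(1)] by blast
  define r' where "r' = min r r1"
  have r': "0 < r'" "r' \<le> r" "r' \<le> r1" using r r1(1) by (auto simp: r'_def)
  have lip: "norm (x - y) \<le> C * norm (?P x - ?P y)" if "x \<in> M \<inter> ball p r'" "y \<in> M \<inter> ball p r'" for x y
  proof -
    have "\<bar>\<gamma> p \<bullet> (x - y)\<bar> \<le> e * norm (x - y)" using that r' by (intro r1(2)) auto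
    from inverse_projection_bound[OF m norm_gauss[OF p] pos this[unfolded e_def]]
    show ?thesis by (simp add: C_def e_def tangential_projection_diff)
  qed
  obtain U :: "'a set" and X :: "'a \<Rightarrow> 'a \<times> real" and u0 D where X: "open U" "u0 \<in> U" "X u0 = p" "X ` U \<subseteq> M" "continuous_on U X" "inj_on X U"
    "linear D" "inj D" "range D = normal_plane (\<gamma> p)" "range D \<subseteq> tangent_space M p"
    "\<forall>V. open V \<longrightarrow> V \<subseteq> U \<longrightarrow> openin (top_of_set M) (X ` V)"
    "\<forall>\<eta>>0. \<exists>\<delta>>0. ball u0 \<delta> \<subseteq> U \<and> (\<forall>u\<in>ball u0 \<delta>. \<forall>u'\<in>ball u0 \<delta>.
      norm (X u - X u' - D (u - u')) \<le> \<eta> * norm (u - u'))"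
    by (rule parametrization[OF p]) (rule that, assumption+)
  define V where "V = U \<inter> X -` ball p r'"
  have V: "open V" unfolding V_def by (rule continuous_open_preimage[OF X(5,1) open_ball])
  have u0V: "u0 \<in> V" using X r' by (simp add: V_def)
  have XV: "X u \<in> M \<inter> ball p r'" if "u \<in> V" for u using that X(4) by (auto simp: V_def)
  have contV: "continuous_on V (\<lambda>u. ?P (X u))"
    by (intro continuous_on_tangential_projection continuous_on_subset[OF X(5)]) (simp add: V_def)
  have injV: "inj_on (\<lambda>u. ?P (X u)) V"
  proof (rule inj_onI)
    fix u u' assume u: "u \<in> V" "u' \<in> V" "?P (X u) = ?P (X u')"
    then have "norm (X u - X u') \<le> 0" using lip[OF XV[OF u(1)] XV[OF u(2)]] by simp
    then show "u = u'" using X(6) u by (auto simp: inj_on_def V_def)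
  qed
  have m0: "m \<noteq> 0" using m by auto
  have "openin (top_of_set (normal_plane m)) ((\<lambda>u. ?P (X u)) ` V)"
  proof (rule invariance_of_domain_subspaces[OF _ subspace_UNIV subspace_normal_plane _ contV _ injV])
    show "openin (top_of_set UNIV) V" using V by simp
    show "dim (normal_plane m) \<le> dim (UNIV :: 'a set)" by (simp add: dim_normal_plane[OF m0])
    show "(\<lambda>u. ?P (X u)) \<in> V \<rightarrow> normal_plane m"
      using inner_tangential_projection[OF m] by (auto simp: normal_plane_def)
  qed
  note op = this
  have "?P (X u0) \<in> (\<lambda>u. ?P (X u)) ` V" using u0V by (rule imageI)
  then have mem: "?P p \<in> (\<lambda>u. ?P (X u)) ` V" unfolding X(3) .
  obtain \<rho> where \<rho>: "\<rho> > 0" "ball (?P p) \<rho> \<inter> normal_plane m \<subseteq> (\<lambda>u. ?P (X u)) ` V"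
    using op[unfolded openin_contains_ball, THEN conjunct2, rule_format, OF mem] by blast
  show thesis
  proof (rule that[OF C \<rho>(1) r'(1,2) lip])
    fix z assume "z \<in> normal_plane m \<inter> ball (?P p) \<rho>"
    then obtain u where "u \<in> V" "z = ?P (X u)" using \<rho>(2) by blast
    then show "\<exists>x\<in>M \<inter> ball p r'. ?P x = z" using XV by blast
  qed
qed

end

section \<open>Cycles in a horizontal cross-section\<close>

text \<open>
  A connected cycle is a component of its cross-section.  Its projection \<open>B\<close> to the hyperplane
  of the first coordinates is a hypersurface there, with unit normal \<open>N\<close> the normalised
  horizontal part of the Gauss map.
\<close>

locale regular_cycle = hypersurface_with_normal M \<gamma>
  for M :: "('a::euclidean_space \<times> real) set" and \<gamma> +
  fixes t :: real and S :: "('a \<times> real) set"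
  assumes dim: "DIM('a) \<ge> 2"
    and compact_section: "compact (cross_section M t)"
    and regular: "regular_value M t"
    and component: "S \<in> components (cross_section M t)"
begin

abbreviation B :: "'a set" where "B \<equiv> fst ` S"

definition horizontal :: "'a \<Rightarrow> 'a" where "horizontal x = fst (\<gamma> (x, t))"
definition vertical :: "'a \<Rightarrow> real" where "vertical x = snd (\<gamma> (x, t))"
definition N :: "'a \<Rightarrow> 'a" where "N x = horizontal x /\<^sub>R norm (horizontal x)"

lemma S_subset: "S \<subseteq> cross_section M t"
  using component by (rule in_components_subset)

lemma S_subset_M: "S \<subseteq> M"
  using S_subset by (auto simp: cross_section_def)

lemma snd_S: "p \<in> S \<Longrightarrow> snd p = t"
  using S_subset by (auto simp: cross_section_def hyperplane_def)

lemma mem_B_iff: "x \<in> B \<longleftrightarrow> (x, t) \<in> S"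
proof
  assume "x \<in> B"
  then obtain p where "p \<in> S" "x = fst p" by (rule imageE)
  then show "(x, t) \<in> S" using snd_S[of p] by (cases p) simp
next
  assume "(x, t) \<in> S"
  then have "fst (x, t) \<in> B" by (rule imageI)
  then show "x \<in> B" by simp
qed

lemma S_eq: "S = (\<lambda>x. (x, t)) ` B"
proof
  show "S \<subseteq> (\<lambda>x. (x, t)) ` B"
  proof
    fix p assume p: "p \<in> S"
    then have "p = (fst p, t)" using snd_S[of p] by (cases p) simp
    then show "p \<in> (\<lambda>x. (x, t)) ` B" by (rule image_eqI) (rule imageI[OF p])
  qed
  show "(\<lambda>x. (x, t)) ` B \<subseteq> S" using mem_B_iff by blast
qed

lemma mem_M: "x \<in> B \<Longrightarrow> (x, t) \<in> M"
  using mem_B_iff S_subset_M by blast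

lemma gauss_eq: "\<gamma> (x, t) = (horizontal x, vertical x)"
  by (simp add: horizontal_def vertical_def)

lemma horizontal_vertical_unit: "x \<in> B \<Longrightarrow> (norm (horizontal x))\<^sup>2 + (vertical x)\<^sup>2 = 1"
  using norm_gauss[OF mem_M, of x] by (simp add: gauss_eq norm_prod_def)

lemma horizontal_nonzero:
  assumes x: "x \<in> B"
  shows "horizontal x \<noteq> 0"
proof
  assume 0: "horizontal x = 0"
  have "(x, t) \<in> cross_section M t" using x mem_B_iff S_subset by blast
  then obtain v where v: "v \<in> tangent_space M (x, t)" "snd v \<noteq> 0"
    using regular unfolding regular_value_def by blast
  then have "snd v * vertical x = 0"
    unfolding tangent_space_eq[OF mem_M[OF x]] gauss_eq by (simp add: normal_plane_def 0 inner_prod_def)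
  moreover have "vertical x \<noteq> 0" using horizontal_vertical_unit[OF x] 0 by auto
  ultimately show False using v by simp
qed

lemma compact_S: "compact S"
  using compact_components[OF compact_section component] .

lemma continuous_gauss: "continuous_on B (\<lambda>x. \<gamma> (x, t))"
proof -
  have "continuous_on M \<gamma>" using gauss by (simp add: gauss_map_def)
  then show ?thesis
  proof (rule continuous_on_compose2)
    show "continuous_on B (\<lambda>x. (x, t))" by (intro continuous_intros)
    show "(\<lambda>x. (x, t)) ` B \<subseteq> M" using mem_M by (rule image_subsetI)
  qed
qed

lemma continuous_horizontal: "continuous_on B horizontal" and continuous_vertical: "continuous_on B vertical"
  unfolding horizontal_def[abs_def] vertical_def[abs_def]
  by (rule continuous_on_fst[OF continuous_gauss], rule continuous_on_snd[OF continuous_gauss])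

text \<open>
  A graph representation of \<open>M\<close> in a horizontal direction restricts to one of the cross-section.
  Over a ball this graph is connected, hence contained in the component \<open>S\<close>.
\<close>

lemma cycle_full:
  assumes p: "p \<in> B" and n: "norm n = 1" and pos: "N p \<bullet> n > 0" and r: "r > 0"
  shows "\<exists>\<rho>>0. \<forall>y\<in>normal_plane n \<inter> ball (tangential_projection n p) \<rho>. \<exists>x\<in>B \<inter> ball p r. tangential_projection n x = y"
proof -
  define m :: "'a \<times> real" where "m = (n, 0)"
  have m: "norm m = 1" using n by (simp add: m_def norm_prod_def)
  have Pm: "tangential_projection m (x, s) = (tangential_projection n x, s)" for x s
    by (simp add: tangential_projection_def m_def inner_prod_def)
  have "horizontal p \<bullet> n = norm (horizontal p) * (N p \<bullet> n)" using horizontal_nonzero[OF p] by (simp add: N_def)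
  then have pos': "\<gamma> (p, t) \<bullet> m > 0"
    using pos horizontal_nonzero[OF p] by (simp add: gauss_eq m_def inner_prod_def)
  obtain C \<rho> r' where C: "C > 0" "\<rho> > 0" "0 < r'" "r' \<le> r"
    "\<And>x y. x \<in> M \<inter> ball (p, t) r' \<Longrightarrow> y \<in> M \<inter> ball (p, t) r' \<Longrightarrow>
      norm (x - y) \<le> C * norm (tangential_projection m x - tangential_projection m y)"
    "\<And>z. z \<in> normal_plane m \<inter> ball (tangential_projection m (p, t)) \<rho> \<Longrightarrow>
      \<exists>x\<in>M \<inter> ball (p, t) r'. tangential_projection m x = z"
    using surface_graph[OF mem_M[OF p] m pos' r] by metis
  define D where "D = normal_plane n \<inter> ball (tangential_projection n p) \<rho>"
  have "\<exists>x. (x, t) \<in> M \<inter> ball (p, t) r' \<and> tangential_projection n x = y" if y: "y \<in> D" for y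
  proof -
    have "(y, t) \<in> normal_plane m \<inter> ball (tangential_projection m (p, t)) \<rho>"
      using y by (simp add: D_def normal_plane_def m_def inner_prod_def Pm[unfolded m_def] dist_Pair_Pair)
    from C(6)[OF this] obtain z where z: "z \<in> M \<inter> ball (p, t) r'" "tangential_projection m z = (y, t)" by blast
    then show ?thesis using Pm[of "fst z" "snd z"] by (intro exI[of _ "fst z"]) auto
  qed
  then obtain G where G: "\<And>y. y \<in> D \<Longrightarrow> (G y, t) \<in> M \<inter> ball (p, t) r'" "\<And>y. y \<in> D \<Longrightarrow> tangential_projection n (G y) = y"
    by metis
  have lipG: "dist (G y, t) (G y', t) \<le> C * dist y y'" if "y \<in> D" "y' \<in> D" for y y'
    using C(5)[OF G(1)[OF that(1)] G(1)[OF that(2)]] G(2) that by (simp add: Pm dist_norm norm_Pair)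
  have contG: "continuous_on D (\<lambda>y. (G y, t))"
  proof (rule continuous_onI)
    fix y e assume y: "y \<in> D" and e: "(0::real) < e"
    show "\<exists>d>0. \<forall>y'\<in>D. dist y' y < d \<longrightarrow> dist (G y', t) (G y, t) \<le> e"
    proof (intro exI[of _ "e / C"] conjI ballI impI)
      show "0 < e / C" using e C(1) by simp
      fix y' assume y': "y' \<in> D" "dist y' y < e / C"
      then have "C * dist y' y \<le> e" using C(1) by (simp add: field_simps)
      then show "dist (G y', t) (G y, t) \<le> e" using lipG[OF y'(1) y] by linarith
    qed
  qed
  have "convex D" unfolding D_def
    by (intro convex_Int convex_ball subspace_imp_convex subspace_normal_plane)
  then have conn: "connected ((\<lambda>y. (G y, t)) ` D)"
    by (intro connected_continuous_image contG convex_connected)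
  have pD: "tangential_projection n p \<in> D"
    using C(2) inner_tangential_projection[OF n] by (simp add: D_def normal_plane_def)
  have "(p, t) \<in> M \<inter> ball (p, t) r'" using mem_M[OF p] C(3) by simp
  from C(5)[OF G(1)[OF pD] this] have Gp: "G (tangential_projection n p) = p"
    using G(2)[OF pD] by (simp add: Pm norm_Pair)
  have "(\<lambda>y. (G y, t)) ` D \<subseteq> S"
  proof (rule components_maximal[OF component conn])
    show "(\<lambda>y. (G y, t)) ` D \<subseteq> cross_section M t"
      using G(1) by (auto simp: cross_section_def hyperplane_def)
    have "(p, t) \<in> (\<lambda>y. (G y, t)) ` D" using pD Gp by force
    then show "S \<inter> (\<lambda>y. (G y, t)) ` D \<noteq> {}" using p mem_B_iff by blast
  qed
  then have GB: "G y \<in> B" if "y \<in> D" for y using that mem_B_iff by auto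
  have Gball: "G y \<in> ball p r" if "y \<in> D" for y
    using G(1)[OF that] C(4) by (simp add: dist_Pair_Pair)
  show ?thesis
    using C(2) GB Gball G(2) unfolding D_def by blast
qed

sublocale base: oriented_hypersurface B N
proof
  show "2 \<le> DIM('a)" by (rule dim)
  show "compact B" by (intro compact_continuous_image compact_S continuous_intros)
  show "continuous_on B N"
    unfolding N_def[abs_def] using horizontal_nonzero by (intro continuous_intros continuous_horizontal) auto
  show "norm (N p) = 1" if "p \<in> B" for p using horizontal_nonzero[OF that] by (simp add: N_def)
  fix p assume p: "p \<in> B"
  { fix e :: real assume e: "0 < e"
    have gp: "0 < norm (horizontal p)" using horizontal_nonzero[OF p] by simp
    then have "0 < e * norm (horizontal p)" using e by simp
    from surface_flat[OF mem_M[OF p] this] obtain r where r: "r > 0"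
      "\<And>x y. x \<in> M \<inter> ball (p, t) r \<Longrightarrow> y \<in> M \<inter> ball (p, t) r \<Longrightarrow> \<bar>\<gamma> (p, t) \<bullet> (x - y)\<bar> \<le> e * norm (horizontal p) * norm (x - y)"
      by blast
    show "\<exists>r>0. \<forall>x\<in>B \<inter> ball p r. \<forall>y\<in>B \<inter> ball p r. \<bar>N p \<bullet> (x - y)\<bar> \<le> e * norm (x - y)"
    proof (intro exI[of _ r] conjI ballI r(1))
      fix x y assume "x \<in> B \<inter> ball p r" "y \<in> B \<inter> ball p r"
      then have "(x, t) \<in> M \<inter> ball (p, t) r" "(y, t) \<in> M \<inter> ball (p, t) r"
        using mem_M by (auto simp: dist_Pair_Pair)
      from r(2)[OF this] have "\<bar>horizontal p \<bullet> (x - y)\<bar> \<le> (e * norm (x - y)) * norm (horizontal p)"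
        by (simp add: gauss_eq inner_prod_def norm_Pair mult_ac)
      then have "\<bar>horizontal p \<bullet> (x - y)\<bar> / norm (horizontal p) \<le> e * norm (x - y)"
        using gp by (simp only: pos_divide_le_eq)
      then show "\<bar>N p \<bullet> (x - y)\<bar> \<le> e * norm (x - y)"
        by (simp add: N_def abs_mult divide_inverse mult.commute)
    qed }
  show "\<exists>\<rho>>0. \<forall>y\<in>normal_plane n \<inter> ball (tangential_projection n p) \<rho>. \<exists>x\<in>B \<inter> ball p r. tangential_projection n x = y"
    if "norm n = 1" "N p \<bullet> n > 0" "0 < r" for n r
    using cycle_full[OF p that] .
qed

lemma inner_horizontal: "horizontal x \<bullet> a = norm (horizontal x) * (N x \<bullet> a)"
  by (cases "horizontal x = 0") (simp_all add: N_def)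

lemma tangent_cross_section:
  assumes x: "x \<in> B" and v: "v \<bullet> N x = 0"
  shows "(v, 0) \<in> tangent_space (cross_section M t) (x, t)"
proof -
  have nN: "norm (N x) = 1" by (rule base.unit[OF x])
  then have pos: "N x \<bullet> N x > 0" by (simp add: norm_eq_1)
  obtain c where c: "c 0 = x" "\<forall>\<^sub>F s in nhds (0::real). c s \<in> B \<and> tangential_projection (N x) (c s) = tangential_projection (N x) x + s *\<^sub>R v"
    "(c has_vector_derivative (v - ((N x \<bullet> v) / (N x \<bullet> N x)) *\<^sub>R N x)) (at 0)"
    by (rule base.tangent_curve[OF x nN pos v])
  have "(c has_vector_derivative v) (at 0)" using c(3) v by (simp add: inner_commute)
  then have "((\<lambda>s. (c s, t)) has_vector_derivative (v, 0)) (at 0)"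
    unfolding has_vector_derivative_def by (auto intro!: derivative_eq_intros simp: fun_eq_iff)
  moreover have "\<forall>\<^sub>F s in at 0. (c s, t) \<in> cross_section M t"
    using c(2) unfolding eventually_at_filter
    by (rule eventually_mono) (use mem_B_iff S_subset in blast)
  ultimately show ?thesis unfolding tangent_space_def using c(1) by force
qed

text \<open>
  The vector on the right-hand side is the quarter turn of \<open>\<gamma> = (c N, s)\<close> to \<open>(- s N, c)\<close> in the
  plane spanned by \<open>N\<close> and \<open>e\<^sub>n\<close>, where \<open>c > 0\<close> is the length of the horizontal part.  For
  uniqueness the tangent vectors of the cross-section must fill the horizontal hyperplane
  orthogonal to \<open>N\<close> (\<open>tangent_cross_section\<close>).
\<close>

lemma conormal_eq:
  assumes x: "x \<in> B"
  shows "conormal M t (x, t) = (- vertical x *\<^sub>R N x, norm (horizontal x))"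
  unfolding conormal_def
proof (rule the_equality)
  have nN: "N x \<bullet> N x = 1" using base.unit[OF x] by (simp add: norm_eq_1)
  have horizontal0: "0 < norm (horizontal x)" using horizontal_nonzero[OF x] by simp
  note T = tangent_space_eq[OF mem_M[OF x]]
  have in_T: "(a, s) \<in> tangent_space M (x, t) \<longleftrightarrow> norm (horizontal x) * (N x \<bullet> a) + s * vertical x = 0" for a s
    unfolding T by (simp add: normal_plane_def gauss_eq inner_prod_def inner_commute[of a] inner_horizontal)
  show "(- vertical x *\<^sub>R N x, norm (horizontal x)) \<in> tangent_space M (x, t) \<and> norm (- vertical x *\<^sub>R N x, norm (horizontal x)) = 1 \<and>
    (\<forall>w\<in>tangent_space (cross_section M t) (x, t). (- vertical x *\<^sub>R N x, norm (horizontal x)) \<bullet> w = 0) \<and>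
    (- vertical x *\<^sub>R N x, norm (horizontal x)) \<bullet> (0, 1) > 0"
  proof (intro conjI ballI)
    show "(- vertical x *\<^sub>R N x, norm (horizontal x)) \<in> tangent_space M (x, t)"
      unfolding in_T by (simp add: nN)
    show "norm (- vertical x *\<^sub>R N x, norm (horizontal x)) = 1"
      using horizontal_vertical_unit[OF x] base.unit[OF x] by (simp add: norm_prod_def add.commute)
    show "(- vertical x *\<^sub>R N x, norm (horizontal x)) \<bullet> (0, 1) > 0" using horizontal0 by (simp add: inner_prod_def)
    fix w assume w: "w \<in> tangent_space (cross_section M t) (x, t)"
    then obtain c where c: "c 0 = (x, t)" "\<forall>\<^sub>F s in at (0::real). c s \<in> cross_section M t" "(c has_vector_derivative w) (at 0)"
      unfolding tangent_space_def by blast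
    have "w \<in> tangent_space M (x, t)"
      unfolding tangent_space_def using c by (auto simp: cross_section_def intro!: exI[of _ c] elim: eventually_mono)
    then have 1: "norm (horizontal x) * (N x \<bullet> fst w) + snd w * vertical x = 0"
      using in_T[of "fst w" "snd w"] by simp
    have "((\<lambda>s. snd (c s)) has_vector_derivative snd w) (at 0)"
      using bounded_linear.has_vector_derivative[OF bounded_linear_snd c(3)] .
    moreover have "((\<lambda>s. snd (c s)) has_vector_derivative 0) (at 0)"
    proof -
      have "\<forall>\<^sub>F s in nhds 0. snd (c s) = t"
        using c(2) unfolding eventually_at_filter
        by (rule eventually_mono) (use c(1) in \<open>force simp: cross_section_def hyperplane_def\<close>)
      then have "((\<lambda>s. snd (c s)) has_real_derivative 0) (at 0) \<longleftrightarrow> ((\<lambda>s. t) has_real_derivative 0) (at (0::real))"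
        by (intro DERIV_cong_ev) auto
      then show ?thesis by (simp add: has_real_derivative_iff_has_vector_derivative)
    qed
    ultimately have 2: "snd w = 0" by (rule vector_derivative_unique_at)
    then have "N x \<bullet> fst w = 0" using 1 horizontal0 by simp
    then show "(- vertical x *\<^sub>R N x, norm (horizontal x)) \<bullet> w = 0" using 2 by (simp add: inner_prod_def)
  qed
  fix \<nu> assume \<nu>: "\<nu> \<in> tangent_space M (x, t) \<and> norm \<nu> = 1 \<and>
    (\<forall>w\<in>tangent_space (cross_section M t) (x, t). \<nu> \<bullet> w = 0) \<and> \<nu> \<bullet> (0, 1) > 0"
  obtain a s where as: "\<nu> = (a, s)" by fastforce
  have s: "s > 0" using \<nu> as by (simp add: inner_prod_def)
  define b where "b = tangential_projection (N x) a"
  have bN: "b \<bullet> N x = 0" unfolding b_def by (rule inner_tangential_projection[OF base.unit[OF x]])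
  then have "(a, s) \<bullet> (b, 0) = 0" using \<nu> as tangent_cross_section[OF x bN] by blast
  then have "a \<bullet> b = 0" by (simp add: inner_prod_def)
  then have "b \<bullet> b = 0" using bN by (simp add: b_def tangential_projection_def inner_diff_left inner_commute)
  then have "a = (a \<bullet> N x) *\<^sub>R N x" by (simp add: b_def tangential_projection_def)
  then obtain l where l: "a = l *\<^sub>R N x" by blast
  have eq1: "norm (horizontal x) * l + s * vertical x = 0" using \<nu> unfolding as in_T l by (simp add: nN)
  have eq2: "l\<^sup>2 + s\<^sup>2 = 1" using \<nu> base.unit[OF x] by (simp add: as l norm_prod_def)
  define c where "c = norm (horizontal x)"
  have c: "c > 0" "c\<^sup>2 + (vertical x)\<^sup>2 = 1" using horizontal0 horizontal_vertical_unit[OF x] by (auto simp: c_def)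
  have "c * l = - (s * vertical x)" using eq1 by (simp add: c_def)
  then have "(c * l)\<^sup>2 = (s * vertical x)\<^sup>2" by simp
  then have "c\<^sup>2 * l\<^sup>2 = s\<^sup>2 * (vertical x)\<^sup>2" by (simp only: power_mult_distrib)
  moreover have "l\<^sup>2 = 1 - s\<^sup>2" "(vertical x)\<^sup>2 = 1 - c\<^sup>2" using eq2 c(2) by linarith+
  ultimately have "c\<^sup>2 * (1 - s\<^sup>2) = s\<^sup>2 * (1 - c\<^sup>2)" by simp
  moreover have "c\<^sup>2 * (1 - s\<^sup>2) = c\<^sup>2 - s\<^sup>2 * c\<^sup>2" by (simp add: right_diff_distrib)
  moreover have "s\<^sup>2 * (1 - c\<^sup>2) = s\<^sup>2 - s\<^sup>2 * c\<^sup>2" by (simp add: right_diff_distrib)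
  ultimately have "c\<^sup>2 = s\<^sup>2" by linarith
  then have sc: "s = c" using s c(1) by (metis less_imp_le power2_eq_imp_eq)
  have "c * (l + vertical x) = 0" using eq1 unfolding sc c_def[symmetric] by (simp only: distrib_left)
  then have "l = - vertical x" using c(1) by (simp add: eq_neg_iff_add_eq_0)
  then show "\<nu> = (- vertical x *\<^sub>R N x, norm (horizontal x))" using as l sc by (simp add: c_def)
qed

text \<open>
  The embedding of the hyperplane preserves distances and hence the Hausdorff measure.
\<close>

lemma integral_cycle:
  fixes f :: "'a \<times> real \<Rightarrow> real"
  assumes f: "continuous_on B (\<lambda>x. f (x, t))"
  shows "(LINT p:S|hausdorff_measure (DIM('a \<times> real) - 2). f p) = (LINT x:B|base.H. f (x, t))"
proof -
  let ?i = "\<lambda>x::'a. (x, t)" and ?H = "hausdorff_measure (DIM('a \<times> real) - 2) :: ('a \<times> real) measure"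
  have deg: "DIM('a \<times> real) - 2 = DIM('a) - 1" by simp
  have im [measurable]: "?i \<in> borel_measurable borel"
    by (intro borel_measurable_continuous_onI continuous_intros)
  have SB [measurable]: "S \<in> sets borel" using compact_S by (simp add: borel_closed compact_imp_closed)
  have BB [measurable]: "B \<in> sets borel" by (rule base.S_borel)
  have "continuous_on S (\<lambda>p. f (fst p, t))"
    by (rule continuous_on_compose2[OF f]) (auto intro!: continuous_intros)
  then have "continuous_on S f"
    by (rule continuous_on_eq) (metis prod.collapse snd_S)
  then have "(\<lambda>p. indicator S p *\<^sub>R f p) \<in> borel_measurable borel"
    by (rule borel_measurable_continuous_on_indicator[OF SB])
  moreover define F where "F p = indicator S p *\<^sub>R f p" for p
  ultimately have Fm [measurable]: "F \<in> borel_measurable borel" by (simp add: F_def[abs_def])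
  have eq: "distr (density base.H (\<lambda>x. ennreal (indicator B x))) borel ?i = density ?H (\<lambda>p. ennreal (indicator S p))"
  proof (rule measure_eqI)
    fix A assume "A \<in> sets (distr (density base.H (\<lambda>x. ennreal (indicator B x))) borel ?i)"
    then have A [measurable]: "A \<in> sets borel" by simp
    have vA [measurable]: "?i -` A \<in> sets borel" by (rule measurable_sets_borel[OF im A])
    have ind: "ennreal (indicator X y) * indicator Y y = indicator (X \<inter> Y) y" for X Y and y :: 'z
      by (simp add: indicator_def)
    have "emeasure (distr (density base.H (\<lambda>x. ennreal (indicator B x))) borel ?i) A
        = emeasure (density base.H (\<lambda>x. ennreal (indicator B x))) (?i -` A)"
      by (subst emeasure_distr) auto
    also have "\<dots> = emeasure base.H (B \<inter> ?i -` A)"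
      by (subst emeasure_density) (auto simp: ind)
    also have "\<dots> = hausdorff_outer (DIM('a) - 1) (B \<inter> ?i -` A)"
      by (rule emeasure_hausdorff_measure) auto
    also have "\<dots> = hausdorff_outer (DIM('a) - 1) (?i ` (B \<inter> ?i -` A))"
      by (intro hausdorff_outer_isometry[symmetric]) (simp add: dist_Pair_Pair)
    also have "?i ` (B \<inter> ?i -` A) = ?i ` B \<inter> A" by auto
    also have "?i ` B = S" by (rule S_eq[symmetric])
    also have "hausdorff_outer (DIM('a) - 1) (S \<inter> A) = emeasure ?H (S \<inter> A)"
      unfolding deg by (rule emeasure_hausdorff_measure[symmetric]) auto
    also have "\<dots> = emeasure (density ?H (\<lambda>p. ennreal (indicator S p))) A"
      by (subst emeasure_density) (auto simp: ind)
    finally show "emeasure (distr (density base.H (\<lambda>x. ennreal (indicator B x))) borel ?i) A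
        = emeasure (density ?H (\<lambda>p. ennreal (indicator S p))) A" .
  qed simp
  have "(LINT p:S|?H. f p) = (LINT p|?H. indicator S p *\<^sub>R F p)"
    unfolding set_lebesgue_integral_def
    by (intro Bochner_Integration.integral_cong) (auto simp: F_def indicator_def)
  also have "\<dots> = (LINT p|density ?H (\<lambda>p. ennreal (indicator S p)). F p)"
    by (rule integral_density[symmetric]) auto
  also have "\<dots> = (LINT x|density base.H (\<lambda>x. ennreal (indicator B x)). F (?i x))"
    unfolding eq[symmetric] by (rule integral_distr) auto
  also have "\<dots> = (LINT x|base.H. indicator B x *\<^sub>R F (?i x))"
    by (rule integral_density) auto
  also have "\<dots> = (LINT x:B|base.H. f (x, t))"
    unfolding set_lebesgue_integral_def
    by (intro Bochner_Integration.integral_cong) (auto simp: F_def indicator_def mem_B_iff)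
  finally show ?thesis .
qed

end

section \<open>The spherical diameter of the Gauss image of a cycle\<close>

lemma (in oriented_hypersurface) integral_pos:
  fixes f :: "'a \<Rightarrow> real"
  assumes f: "continuous_on S f" and pos: "\<And>x. x \<in> S \<Longrightarrow> f x > 0" and ne: "S \<noteq> {}"
  shows "(LINT x:S|H. f x) > 0"
proof -
  obtain x0 where x0: "x0 \<in> S" "\<And>x. x \<in> S \<Longrightarrow> f x0 \<le> f x"
    using continuous_attains_inf[OF compact ne f] by blast
  have "emeasure H S > 0" using positive_area[OF ne] by (simp add: emeasure_hausdorff_measure)
  then have "measure H S > 0"
    unfolding measure_def enn2real_positive_iff using emeasure_S_finite by simp
  then have "0 < f x0 * measure H S" using pos[OF x0(1)] by simp
  also have "f x0 * measure H S = (LINT x:S|H. f x0)"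
    using emeasure_S_finite by (simp add: set_lebesgue_integral_def)
  also have "\<dots> \<le> (LINT x:S|H. f x)"
    using x0(2) by (intro set_integral_mono set_integrable_continuous f continuous_intros)
  finally show ?thesis .
qed

lemma angle_unit: "norm u = 1 \<Longrightarrow> norm v = 1 \<Longrightarrow> angle u v = arccos (u \<bullet> v)"
  by (simp add: angle_def)

lemma angle_le_spherical_diameter:
  assumes unit: "\<And>u. u \<in> E \<Longrightarrow> norm u = 1" and uv: "u \<in> E" "v \<in> E"
  shows "angle u v \<le> spherical_diameter E"
proof -
  have "angle u v \<le> pi" if "u \<in> E" "v \<in> E" for u v
  proof -
    have "\<bar>u \<bullet> v\<bar> \<le> 1" using Cauchy_Schwarz_ineq2[of u v] unit that by simp
    then show ?thesis using unit that by (simp add: angle_unit arccos_ubound abs_le_iff)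
  qed
  then have "bdd_above ((\<lambda>(u, v). angle u v) ` (E \<times> E))" by (intro bdd_aboveI[of _ pi]) auto
  from cSUP_upper[OF _ this, of "(u, v)"] uv show ?thesis
    unfolding spherical_diameter_def by simp
qed

context regular_cycle
begin

text \<open>
  The horizontal part comes from representing the linear functional
  \<open>a \<mapsto> \<integral> sin \<theta> \<langle>N, a\<rangle>\<close> by a vector, as the adjoint applied to \<open>1\<close>.
\<close>

lemma flow_vector_eq:
  "\<exists>Jh. flow_vector M t S = (Jh, LINT x:B|base.H. norm (horizontal x)) \<and>
    (\<forall>a. a \<bullet> Jh = (LINT x:B|base.H. - vertical x * (N x \<bullet> a)))"
proof -
  define L where "L a = (LINT x:B|base.H. - vertical x * (N x \<bullet> a))" for a
  have contN: "continuous_on B (\<lambda>x. - vertical x * (N x \<bullet> a))" for a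
    by (intro continuous_on_mult continuous_on_minus continuous_vertical continuous_on_inner base.cont continuous_on_const)
  have conts: "continuous_on B (\<lambda>x. norm (horizontal x) * s)" for s
    by (intro continuous_on_mult continuous_on_norm continuous_horizontal continuous_on_const)
  have int: "set_integrable base.H B (\<lambda>x. - vertical x * (N x \<bullet> a))" for a
    by (rule base.set_integrable_continuous[OF contN])
  have "linear L"
  proof (rule linearI)
    show "L (a + b) = L a + L b" for a b
      unfolding L_def set_integral_add(2)[OF int int, symmetric] by (simp add: inner_add_right algebra_simps)
    show "L (r *\<^sub>R a) = r *\<^sub>R L a" for r a
    proof -
      have "L (r *\<^sub>R a) = (LINT x:B|base.H. r * (- vertical x * (N x \<bullet> a)))"
        unfolding L_def by (simp add: mult_ac)
      then show ?thesis by (simp only: L_def set_integral_mult_right real_scaleR_def)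
    qed
  qed
  define Jh where "Jh = adjoint L 1"
  have Jh: "a \<bullet> Jh = L a" for a
    using adjoint_works[OF \<open>linear L\<close>, of a 1] by (simp add: Jh_def)
  define Jn where "Jn = (LINT x:B|base.H. norm (horizontal x))"
  have I: "(LINT p:S|hausdorff_measure (DIM('a \<times> real) - 2). e \<bullet> conormal M t p) = e \<bullet> (Jh, Jn)" for e
  proof -
    obtain a s where e: "e = (a, s)" by fastforce
    have eq: "e \<bullet> conormal M t (x, t) = - vertical x * (N x \<bullet> a) + norm (horizontal x) * s" if "x \<in> B" for x
      by (simp add: conormal_eq[OF that] e inner_prod_def inner_commute)
    have "continuous_on B (\<lambda>x. e \<bullet> conormal M t (x, t))"
      by (rule continuous_on_eq[OF continuous_on_add[OF contN conts]]) (rule eq[symmetric])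
    then have "(LINT p:S|hausdorff_measure (DIM('a \<times> real) - 2). e \<bullet> conormal M t p)
        = (LINT x:B|base.H. e \<bullet> conormal M t (x, t))"
      by (rule integral_cycle)
    also have "\<dots> = (LINT x:B|base.H. - vertical x * (N x \<bullet> a) + norm (horizontal x) * s)"
      using eq by (intro set_lebesgue_integral_cong) auto
    also have "\<dots> = L a + (LINT x:B|base.H. norm (horizontal x) * s)"
      unfolding L_def by (intro set_integral_add int base.set_integrable_continuous conts)
    also have "\<dots> = e \<bullet> (Jh, Jn)" by (simp add: e Jh Jn_def inner_prod_def mult.commute)
    finally show ?thesis .
  qed
  have "flow_vector M t S = (Jh, Jn)"
    unfolding flow_vector_def I
  proof (rule the_equality)
    fix J assume "\<forall>e. e \<bullet> J = e \<bullet> (Jh, Jn)"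
    then show "J = (Jh, Jn)" by (simp only: vector_eq_ldot)
  qed simp
  then show ?thesis using Jh unfolding L_def Jn_def by blast
qed

text \<open>
  The angle \<open>\<theta>\<close> between the conormal and the vertical, positive where the conormal leans
  towards \<open>N\<close>.
\<close>

definition tilt :: "'a \<Rightarrow> real" where "tilt x = arcsin (- vertical x)"

lemma abs_vertical_less: "x \<in> B \<Longrightarrow> \<bar>vertical x\<bar> < 1"
proof -
  assume x: "x \<in> B"
  then have "0 < (norm (horizontal x))\<^sup>2" using horizontal_nonzero by simp
  then have "(vertical x)\<^sup>2 < 1" using horizontal_vertical_unit[OF x] by linarith
  then show ?thesis by (simp add: abs_square_less_1)
qed

lemma tilt_range_sin_cos:
  assumes x: "x \<in> B"
  shows "- (pi / 2) < tilt x" "tilt x < pi / 2" "sin (tilt x) = - vertical x" "cos (tilt x) = norm (horizontal x)"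
proof -
  have b: "-1 < - vertical x" "- vertical x < 1" using abs_vertical_less[OF x] by auto
  show "- (pi / 2) < tilt x" "tilt x < pi / 2" using arcsin_lt_bounded[OF b] by (auto simp: tilt_def)
  show "sin (tilt x) = - vertical x" unfolding tilt_def using b by (intro sin_arcsin) auto
  have "cos (tilt x) = sqrt (1 - (- vertical x)\<^sup>2)" unfolding tilt_def using b by (intro cos_arcsin) auto
  also have "1 - (- vertical x)\<^sup>2 = (norm (horizontal x))\<^sup>2" using horizontal_vertical_unit[OF x] by simp
  finally show "cos (tilt x) = norm (horizontal x)" by simp
qed

lemma continuous_tilt: "continuous_on B tilt"
  unfolding tilt_def[abs_def]
proof (rule continuous_on_arcsin)
  show "continuous_on B (\<lambda>x. - vertical x)" by (intro continuous_on_minus continuous_vertical)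
  show "\<forall>x\<in>B. - 1 \<le> - vertical x \<and> - vertical x \<le> 1" using abs_vertical_less by (fastforce simp: abs_less_iff)
qed

text \<open>
  The difference of tilts is the difference in latitude of the two points of the sphere; the
  longitudes enter through the Cauchy--Schwarz inequality.
\<close>

lemma gauss_angle_ge:
  assumes x: "x \<in> B" and y: "y \<in> B"
  shows "\<bar>tilt x - tilt y\<bar> \<le> angle (\<gamma> (x, t)) (\<gamma> (y, t))"
proof -
  have n: "norm (\<gamma> (x, t)) = 1" "norm (\<gamma> (y, t)) = 1" using norm_gauss mem_M x y by auto
  have "horizontal x \<bullet> horizontal y \<le> norm (horizontal x) * norm (horizontal y)" by (rule norm_cauchy_schwarz)
  then have "\<gamma> (x, t) \<bullet> \<gamma> (y, t) \<le> norm (horizontal x) * norm (horizontal y) + vertical x * vertical y"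
    by (simp add: gauss_eq inner_prod_def)
  also have "\<dots> = cos (tilt x - tilt y)" using tilt_range_sin_cos[OF x] tilt_range_sin_cos[OF y] by (simp add: cos_diff)
  also have "\<dots> = cos \<bar>tilt x - tilt y\<bar>" by simp
  finally have le: "\<gamma> (x, t) \<bullet> \<gamma> (y, t) \<le> cos \<bar>tilt x - tilt y\<bar>" .
  have "\<bar>\<gamma> (x, t) \<bullet> \<gamma> (y, t)\<bar> \<le> 1" using Cauchy_Schwarz_ineq2[of "\<gamma> (x, t)" "\<gamma> (y, t)"] n by simp
  then have "-1 \<le> \<gamma> (x, t) \<bullet> \<gamma> (y, t)" by linarith
  from arccos_le_arccos[OF this le cos_le_one]
  have "arccos (cos \<bar>tilt x - tilt y\<bar>) \<le> angle (\<gamma> (x, t)) (\<gamma> (y, t))" by (simp only: angle_unit[OF n])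
  moreover have "arccos (cos \<bar>tilt x - tilt y\<bar>) = \<bar>tilt x - tilt y\<bar>"
    using tilt_range_sin_cos(1,2)[OF x] tilt_range_sin_cos(1,2)[OF y] by (intro arccos_cos) linarith+
  ultimately show ?thesis by simp
qed

theorem spherical_diameter_ge: "spherical_diameter (\<gamma> ` S) \<ge> 2 * angle (flow_vector M t S) (0, 1)"
proof (rule ccontr)
  assume contr: "\<not> ?thesis"
  define \<alpha> where "\<alpha> = angle (flow_vector M t S) (0, 1)"
  have less: "spherical_diameter (\<gamma> ` S) < 2 * \<alpha>" using contr by (simp add: \<alpha>_def)
  obtain Jh where J: "flow_vector M t S = (Jh, LINT x:B|base.H. norm (horizontal x))"
    "\<And>a. a \<bullet> Jh = (LINT x:B|base.H. - vertical x * (N x \<bullet> a))" using flow_vector_eq by blast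
  define Jn where "Jn = (LINT x:B|base.H. norm (horizontal x))"
  have fJ: "flow_vector M t S = (Jh, Jn)" unfolding J(1) Jn_def ..
  have ne: "B \<noteq> {}" using in_components_nonempty[OF component] by simp
  have Jn: "0 < Jn"
    unfolding Jn_def by (rule base.integral_pos[OF continuous_on_norm[OF continuous_horizontal] _ ne]) (simp add: horizontal_nonzero)
  define nJ where "nJ = sqrt ((norm Jh)\<^sup>2 + Jn\<^sup>2)"
  have "0 < (norm Jh)\<^sup>2 + Jn\<^sup>2" by (rule add_nonneg_pos[OF zero_le_power2 zero_less_power[OF Jn]])
  then have nJ: "0 < nJ" "nJ\<^sup>2 = (norm Jh)\<^sup>2 + Jn\<^sup>2" unfolding nJ_def by simp_all
  have "Jn\<^sup>2 \<le> nJ\<^sup>2" unfolding nJ(2) by simp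
  then have "Jn \<le> nJ" by (rule power2_le_imp_le) (rule less_imp_le[OF nJ(1)])
  then have q: "0 \<le> Jn / nJ" "Jn / nJ \<le> 1"
    using Jn nJ(1) by (simp_all add: pos_divide_le_eq less_imp_le)
  have \<alpha>_eq: "\<alpha> = arccos (Jn / nJ)"
    unfolding \<alpha>_def fJ by (simp add: angle_def inner_prod_def norm_prod_def nJ_def)
  have cos\<alpha>: "cos \<alpha> = Jn / nJ" unfolding \<alpha>_eq using q by (intro cos_arccos) auto
  have \<alpha>_le: "\<alpha> \<le> pi / 2" unfolding \<alpha>_eq using q by (intro arccos_le_pi2)
  have sin\<alpha>: "sin \<alpha> = norm Jh / nJ"
  proof -
    have "sin \<alpha> = sqrt (1 - (Jn / nJ)\<^sup>2)" unfolding \<alpha>_eq using q by (intro sin_arccos) auto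
    also have "1 - (Jn / nJ)\<^sup>2 = (nJ\<^sup>2 - Jn\<^sup>2) / nJ\<^sup>2"
      using nJ(1) by (simp add: power_divide diff_divide_distrib)
    also have "nJ\<^sup>2 - Jn\<^sup>2 = (norm Jh)\<^sup>2" using nJ(2) by linarith
    finally show ?thesis using nJ(1) by (simp add: real_sqrt_divide)
  qed
  have unit: "norm u = 1" if "u \<in> \<gamma> ` S" for u using that S_subset_M norm_gauss by auto
  have in_image: "\<gamma> (x, t) \<in> \<gamma> ` S" if "x \<in> B" for x using that mem_B_iff by blast
  have osc: "\<bar>tilt x - tilt y\<bar> < 2 * \<alpha>" if "x \<in> B" "y \<in> B" for x y
    using gauss_angle_ge[OF that] angle_le_spherical_diameter[OF unit in_image[OF that(1)] in_image[OF that(2)]] less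
    by linarith
  \<comment> \<open>The sum-to-product formula; both factors are positive because \<open>\<alpha> \<le> \<pi>/2\<close>.\<close>
  have sep: "sin (tilt x - \<alpha>) < sin (tilt y + \<alpha>)" if x: "x \<in> B" and y: "y \<in> B" for x y
  proof -
    have "0 < sin ((tilt y + \<alpha> - (tilt x - \<alpha>)) / 2)"
    proof (rule sin_gt_zero)
      have "0 < tilt y + \<alpha> - (tilt x - \<alpha>)" "tilt y + \<alpha> - (tilt x - \<alpha>) < pi * 2"
        using osc[OF x y] \<alpha>_le by linarith+
      then show "0 < (tilt y + \<alpha> - (tilt x - \<alpha>)) / 2" "(tilt y + \<alpha> - (tilt x - \<alpha>)) / 2 < pi"
        by simp_all
    qed
    moreover have "0 < cos ((tilt y + \<alpha> + (tilt x - \<alpha>)) / 2)"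
    proof (rule cos_gt_zero_pi)
      have "- pi < tilt y + \<alpha> + (tilt x - \<alpha>)" "tilt y + \<alpha> + (tilt x - \<alpha>) < pi"
        using tilt_range_sin_cos(1,2)[OF x] tilt_range_sin_cos(1,2)[OF y] by linarith+
      then show "- (pi / 2) < (tilt y + \<alpha> + (tilt x - \<alpha>)) / 2" "(tilt y + \<alpha> + (tilt x - \<alpha>)) / 2 < pi / 2"
        by simp_all
    qed
    ultimately have "0 < sin (tilt y + \<alpha>) - sin (tilt x - \<alpha>)" unfolding sin_diff_sin by simp
    then show ?thesis by simp
  qed
  have "continuous_on B (\<lambda>x. sin (tilt x - \<alpha>))" "continuous_on B (\<lambda>x. sin (tilt x + \<alpha>))"
    by (intro continuous_intros continuous_tilt)+
  note cont = this
  obtain x1 where x1: "x1 \<in> B" "\<And>x. x \<in> B \<Longrightarrow> sin (tilt x - \<alpha>) \<le> sin (tilt x1 - \<alpha>)"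
    using continuous_attains_sup[OF base.compact ne cont(1)] by blast
  obtain x2 where x2: "x2 \<in> B" "\<And>x. x \<in> B \<Longrightarrow> sin (tilt x2 + \<alpha>) \<le> sin (tilt x + \<alpha>)"
    using continuous_attains_inf[OF base.compact ne cont(2)] by blast
  \<comment> \<open>Any value between the maximum of \<open>sin (\<theta> - \<alpha>)\<close> and the minimum of \<open>sin (\<theta> + \<alpha>)\<close> works.\<close>
  define k where "k = (sin (tilt x1 - \<alpha>) + sin (tilt x2 + \<alpha>)) / 2"
  have k2: "2 * k = sin (tilt x1 - \<alpha>) + sin (tilt x2 + \<alpha>)" by (simp add: k_def)
  have k: "\<bar>- vertical x * cos \<alpha> - k\<bar> < norm (horizontal x) * sin \<alpha>" if x: "x \<in> B" for x
  proof -
    have "sin (tilt x - \<alpha>) < k" "k < sin (tilt x + \<alpha>)"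
      using x1(2)[OF x] x2(2)[OF x] sep[OF x1(1) x2(1)] k2 by linarith+
    moreover have "sin (tilt x - \<alpha>) = - vertical x * cos \<alpha> - norm (horizontal x) * sin \<alpha>"
      "sin (tilt x + \<alpha>) = - vertical x * cos \<alpha> + norm (horizontal x) * sin \<alpha>"
      by (simp_all only: sin_diff sin_add tilt_range_sin_cos[OF x])
    ultimately show ?thesis by linarith
  qed
  \<comment> \<open>If \<open>Jh = 0\<close> then \<open>e = 0\<close>, and the argument below still applies.\<close>
  define e where "e = sgn Jh"
  have e: "norm e \<le> 1" "e \<bullet> Jh = norm Jh"
    by (simp add: e_def norm_sgn)
      (cases "Jh = 0", simp_all add: e_def sgn_div_norm dot_square_norm power2_eq_square)
  \<comment> \<open>The integrand of the introductory sketch, with the opposite sign.\<close>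
  define F where "F x = norm (horizontal x) * sin \<alpha> - (- vertical x * (N x \<bullet> e)) * cos \<alpha> + (N x \<bullet> e) * k" for x
  have cN: "continuous_on B (\<lambda>x. N x \<bullet> e)"
    by (rule continuous_on_inner[OF base.cont continuous_on_const])
  have c1: "continuous_on B (\<lambda>x. norm (horizontal x) * sin \<alpha>)"
    and c2: "continuous_on B (\<lambda>x. (- vertical x * (N x \<bullet> e)) * cos \<alpha>)"
    and c3: "continuous_on B (\<lambda>x. (N x \<bullet> e) * k)"
    by (intro continuous_on_mult continuous_on_norm continuous_horizontal continuous_on_const continuous_on_minus continuous_vertical cN)+
  have "0 < (LINT x:B|base.H. F x)"
  proof (rule base.integral_pos[OF _ _ ne])
    show "continuous_on B F" unfolding F_def[abs_def] by (intro continuous_on_add continuous_on_diff c1 c2 c3)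
    fix x assume x: "x \<in> B"
    have "\<bar>N x \<bullet> e\<bar> \<le> 1"
      using Cauchy_Schwarz_ineq2[of "N x" e] base.unit[OF x] e(1) by simp
    then have "\<bar>(- vertical x * cos \<alpha> - k) * (N x \<bullet> e)\<bar> \<le> \<bar>- vertical x * cos \<alpha> - k\<bar>"
      unfolding abs_mult by (intro mult_left_le) auto
    with k[OF x] have "(- vertical x * cos \<alpha> - k) * (N x \<bullet> e) < norm (horizontal x) * sin \<alpha>" by linarith
    then show "0 < F x" by (simp add: F_def algebra_simps)
  qed
  also have "(LINT x:B|base.H. F x) = Jn * sin \<alpha> - (e \<bullet> Jh) * cos \<alpha> + 0 * k"
  proof -
    note ints = base.set_integrable_continuous[OF c1] base.set_integrable_continuous[OF c2] base.set_integrable_continuous[OF c3]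
    have "(LINT x:B|base.H. F x) = (LINT x:B|base.H. norm (horizontal x) * sin \<alpha>) - (LINT x:B|base.H. (- vertical x * (N x \<bullet> e)) * cos \<alpha>) + (LINT x:B|base.H. (N x \<bullet> e) * k)"
      unfolding F_def set_integral_add(2)[OF set_integral_diff(1)[OF ints(1,2)] ints(3)] set_integral_diff(2)[OF ints(1,2)] ..
    then show ?thesis
      by (simp only: set_integral_mult_left J(2) Jn_def base.integral_normal_eq_0)
  qed
  also have "\<dots> = 0" by (simp add: e(2) sin\<alpha> cos\<alpha> mult.commute)
  finally show False by simp
qed

end

theorem theorem1:
  fixes M S :: "('a::euclidean_space \<times> real) set"
    and \<gamma> :: "'a \<times> real \<Rightarrow> 'a \<times> real"
    and I :: "real set" and t :: real
  assumes "DIM('a \<times> real) \<ge> 3"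
    and "embedded_hypersurface M"
    and "gauss_map M \<gamma>"
    and "minimal M \<gamma>"
    and "tube M I"
    and "t \<in> I"
    and "regular_value M t"
    and "simple_cycle M t S"
  shows "spherical_diameter (\<gamma> ` S) \<ge> 2 * angle (flow_vector M t S) (0, 1)"
proof -
  have "S \<in> components (cross_section M t)"
  proof -
    obtain C where C: "C \<subseteq> components (cross_section M t)" "C \<noteq> {}" "S = \<Union>C"
      using \<open>simple_cycle M t S\<close> unfolding simple_cycle_def cycle_def by blast
    have conn: "connected S" using \<open>simple_cycle M t S\<close> unfolding simple_cycle_def by blast
    obtain c where c: "c \<in> C" using C(2) by blast
    then have comp: "c \<in> components (cross_section M t)" using C(1) by blast
    have sub: "S \<subseteq> cross_section M t"
      unfolding C(3) using C(1) by (intro Union_least) (auto dest: in_components_subset)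
    have "c \<subseteq> S" using c C(3) by blast
    moreover have "S \<subseteq> c"
    proof (rule components_maximal[OF comp conn sub])
      show "c \<inter> S \<noteq> {}" using \<open>c \<subseteq> S\<close> in_components_nonempty[OF comp] by blast
    qed
    ultimately show ?thesis using comp by simp
  qed
  then interpret regular_cycle M \<gamma> t S
    using assms by unfold_locales (auto simp: tube_def)
  show ?thesis by (rule spherical_diameter_ge)
qed

end
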